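(* Let $d\ge2$. The space $\mathcal{T}_d^*$ is the unique monotone-light factor for the tree projection map $\mathcal{M}_d\to\mathcal{T}_d$; that is, in the factorization $\mathcal{M}_d\to\mathcal{T}_d^*\to\mathcal{T}_d$ the first map is monotone and the second is light, and $\mathcal{T}_d^*$ is the canonical (unique) space through which $\mathcal{M}_d\to\mathcal{T}_d$ factors in this way.
   Context: $\mathcal{M}_d$ is the space of conformal (affine) conjugacy classes of complex polynomials of degree $d$: the quotient of the space $\mathcal{P}_d\simeq\mathbb{C}^{d-1}$ of monic centered polynomials by conjugation by $z\mapsto\zeta z$, $\zeta^{d-1}=1$. $G_f(z)=\lim_{n\to\infty}d^{-n}\log^+|f^n(z)|$ is the escape-rate function. The critical points $c_1,\dots,c_{d-1}$ (with multiplicity) are ordered with $G_f(c_1)\ge\cdots\ge G_f(c_{d-1})$; the critical heights map is $\mathcal{G}(f)=(G_f(c_1),\dots,G_f(c_{d-1}))\in\mathcal{H}_d=\{h\in\mathbb{R}^{d-1}:h_1\ge\cdots\ge h_{d-1}\ge0\}$. $\mathcal{T}_d^*$ is the quotient space of $\mathcal{M}_d$ obtained by collapsing each connected component of each fiber of $\mathcal{G}$ to a point. Trees: $T(f)$ is the quotient of $\mathbb{C}$ obtained by collapsing each connected component of each level set of $G_f$ to a point; $f$ induces $F:T(f)\to T(f)$ and $G_f$ induces a height function on $T(f)$. $T(f)$ is metrized so that the distance between points $x,y$ is the total height variation along the arc joining them, i.e. $2s-\mathrm{ht}(x)-\mathrm{ht}(y)$, where $s$ is the least value such that $x,y$ correspond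 to subsets of the same connected component of $\{G_f\le s\}$. Two trees are equivalent if an isometry between them conjugates the dynamics. $\mathcal{T}_d$ is the set of equivalence classes of trees of degree $d$ polynomials, with the quotient topology from $\mathcal{M}_d$ (this agrees with its Gromov–Hausdorff topology, for which $\mathcal{M}_d\to\mathcal{T}_d$ is a continuous proper surjection). A continuous map is monotone if its fibers are connected, and light if its fibers are totally disconnected. A closed, proper continuous map $p:X\to Y$ between Hausdorff spaces factors canonically as a monotone map $m:X\to Z$ (continuous, closed, surjective) followed by a light map $Z\to Y$; $Z$ is the quotient of $X$ collapsing each connected component of each fiber of $p$ to a point, is unique up to homeomorphism compatible with the maps, and is called the monotone-light factor of $p$. *)

theory Defs
  imports "HOL-Analysis.Analysis" "HOL-Computational_Algebra.Polynomial"
begin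

section \<open>Quotient topologies, light maps, monotone-light factorizations\<close>

text \<open>The set \<open>f ` topspace X\<close> with the finest topology making \<open>f\<close> continuous.\<close>

definition quotient_topology :: "'a topology \<Rightarrow> ('a \<Rightarrow> 'b) \<Rightarrow> 'b topology" where
  "quotient_topology X f =
     topology (\<lambda>V. V \<subseteq> f ` topspace X \<and> openin X {x \<in> topspace X. f x \<in> V})"

lemma openin_quotient_topology:
  "openin (quotient_topology X f) V \<longleftrightarrow>
     V \<subseteq> f ` topspace X \<and> openin X {x \<in> topspace X. f x \<in> V}"
proof -
  have "istopology (\<lambda>V. V \<subseteq> f ` topspace X \<and> openin X {x \<in> topspace X. f x \<in> V})"
    unfolding istopology_def
  proof (intro conjI allI impI)
    fix S T
    assume "S \<subseteq> f ` topspace X \<and> openin X {x \<in> topspace X. f x \<in> S}"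
      and "T \<subseteq> f ` topspace X \<and> openin X {x \<in> topspace X. f x \<in> T}"
    moreover have "{x \<in> topspace X. f x \<in> S \<inter> T} =
        {x \<in> topspace X. f x \<in> S} \<inter> {x \<in> topspace X. f x \<in> T}"
      by auto
    ultimately show "S \<inter> T \<subseteq> f ` topspace X" "openin X {x \<in> topspace X. f x \<in> S \<inter> T}"
      by auto
  next
    fix \<K>
    assume K: "\<forall>K\<in>\<K>. K \<subseteq> f ` topspace X \<and> openin X {x \<in> topspace X. f x \<in> K}"
    have "{x \<in> topspace X. f x \<in> \<Union>\<K>} = (\<Union>K\<in>\<K>. {x \<in> topspace X. f x \<in> K})"
      by auto
    with K show "\<Union>\<K> \<subseteq> f ` topspace X" "openin X {x \<in> topspace X. f x \<in> \<Union>\<K>}"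
      by auto
  qed
  then show ?thesis
    by (simp add: quotient_topology_def)
qed

lemma topspace_quotient_topology: "topspace (quotient_topology X f) = f ` topspace X"
proof
  show "topspace (quotient_topology X f) \<subseteq> f ` topspace X"
    by (meson openin_quotient_topology openin_topspace)
  have "{x \<in> topspace X. f x \<in> f ` topspace X} = topspace X"
    by auto
  then show "f ` topspace X \<subseteq> topspace (quotient_topology X f)"
    by (intro openin_subset) (simp add: openin_quotient_topology)
qed

lemma quotient_map_quotient_topology: "quotient_map X (quotient_topology X f) f"
  by (simp add: quotient_map_def topspace_quotient_topology openin_quotient_topology)

definition fibre_component :: "'a topology \<Rightarrow> ('a \<Rightarrow> 'b) \<Rightarrow> 'a \<Rightarrow> 'a set" where
  "fibre_component X p x =
     connected_component_of_set (subtopology X {y \<in> topspace X. p y = p x}) x"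

text \<open>The quotient of \<open>X\<close> collapsing each connected component of each fibre of \<open>p\<close> to a point;
  the quotient map is \<open>fibre_component X p\<close>.\<close>

definition collapse_fibre_components :: "'a topology \<Rightarrow> ('a \<Rightarrow> 'b) \<Rightarrow> 'a set topology" where
  "collapse_fibre_components X p = quotient_topology X (fibre_component X p)"

definition totally_disconnectedin :: "'a topology \<Rightarrow> 'a set \<Rightarrow> bool" where
  "totally_disconnectedin X S \<longleftrightarrow>
     S \<subseteq> topspace X \<and> (\<forall>C. C \<subseteq> S \<and> connectedin X C \<longrightarrow> (\<exists>a. C \<subseteq> {a}))"

definition light_map :: "'a topology \<Rightarrow> 'b topology \<Rightarrow> ('a \<Rightarrow> 'b) \<Rightarrow> bool" where
  "light_map X Y f \<longleftrightarrow>
     continuous_map X Y f \<and>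
     (\<forall>y \<in> topspace Y. totally_disconnectedin X {x \<in> topspace X. f x = y})"

text \<open>The library's \<open>monotone_map\<close> only asks for connected fibres, so continuity, closedness and
  surjectivity of the first factor are listed separately.\<close>

definition monotone_light_factorization ::
    "'a topology \<Rightarrow> 'b topology \<Rightarrow> ('a \<Rightarrow> 'b) \<Rightarrow> 'z topology \<Rightarrow> ('a \<Rightarrow> 'z) \<Rightarrow> ('z \<Rightarrow> 'b) \<Rightarrow> bool" where
  "monotone_light_factorization X Y p Z m l \<longleftrightarrow>
     continuous_map X Z m \<and> closed_map X Z m \<and> m ` topspace X = topspace Z \<and>
     monotone_map X Z m \<and> light_map Z Y l \<and>
     (\<forall>x \<in> topspace X. l (m x) = p x)"


section \<open>The moduli space of polynomials\<close>

definition monic_centered :: "nat \<Rightarrow> complex poly set" where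
  "monic_centered d = {f. degree f = d \<and> lead_coeff f = 1 \<and> coeff f (d - 1) = 0}"

text \<open>\<open>monic_centered d\<close> is identified with \<open>\<complex>\<^sup>d\<^sup>-\<^sup>1\<close> through the coefficients of
  \<open>1, z, \<dots>, z\<^sup>d\<^sup>-\<^sup>2\<close>.\<close>

definition poly_space :: "nat \<Rightarrow> complex poly topology" where
  "poly_space d =
     pullback_topology (monic_centered d) (\<lambda>f. restrict (coeff f) {..<d - 1})
       (product_topology (\<lambda>_. euclidean) {..<d - 1})"

text \<open>\<open>g(z) = \<zeta>\<^sup>-\<^sup>1 f(\<zeta> z)\<close>\<close>

definition conj_rel :: "nat \<Rightarrow> (complex poly \<times> complex poly) set" where
  "conj_rel d = {(f, g). f \<in> monic_centered d \<and> g \<in> monic_centered d \<and>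
     (\<exists>\<zeta>. \<zeta> ^ (d - 1) = 1 \<and> g = smult (inverse \<zeta>) (pcompose f [:0, \<zeta>:]))}"

definition moduli_space :: "nat \<Rightarrow> complex poly set topology" where
  "moduli_space d = quotient_topology (poly_space d) (\<lambda>f. conj_rel d `` {f})"


section \<open>Escape rates and critical heights\<close>

definition escape_rate :: "complex poly \<Rightarrow> complex \<Rightarrow> real" where
  "escape_rate f z =
     lim (\<lambda>n. ln (max 1 (norm ((poly f ^^ n) z))) / real (degree f) ^ n)"

text \<open>The vector of critical heights in \<open>\<real>\<^sup>d\<^sup>-\<^sup>1\<close>, as a weakly decreasing list of length \<open>d - 1\<close>;
  \<open>proots\<close> counts critical points with multiplicity.\<close>

definition critical_heights :: "complex poly \<Rightarrow> real list" where
  "critical_heights f =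
     rev (sorted_list_of_multiset (image_mset (escape_rate f) (proots (pderiv f))))"

text \<open>\<open>critical_heights\<close> is constant on conjugacy classes; this is the induced map.\<close>

definition critical_heights_map :: "complex poly set \<Rightarrow> real list" where
  "critical_heights_map c = the_elem (critical_heights ` c)"

definition Tstar_space :: "nat \<Rightarrow> complex poly set set topology" where
  "Tstar_space d = collapse_fibre_components (moduli_space d) critical_heights_map"

definition Tstar_proj :: "nat \<Rightarrow> complex poly set \<Rightarrow> complex poly set set" where
  "Tstar_proj d = fibre_component (moduli_space d) critical_heights_map"


section \<open>Trees of polynomials\<close>

record 'a dyn_tree =
  points :: "'a set"
  tdist :: "'a \<Rightarrow> 'a \<Rightarrow> real"
  dyn :: "'a \<Rightarrow> 'a"

definition tree_points :: "complex poly \<Rightarrow> complex set set" where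
  "tree_points f = (\<Union>s. components {z. escape_rate f z = s})"

definition tree_height :: "complex poly \<Rightarrow> complex set \<Rightarrow> real" where
  "tree_height f x = the_elem (escape_rate f ` x)"

definition tree_join_height :: "complex poly \<Rightarrow> complex set \<Rightarrow> complex set \<Rightarrow> real" where
  "tree_join_height f x y =
     (LEAST s. \<exists>C \<in> components {z. escape_rate f z \<le> s}. x \<subseteq> C \<and> y \<subseteq> C)"

definition tree_dist :: "complex poly \<Rightarrow> complex set \<Rightarrow> complex set \<Rightarrow> real" where
  "tree_dist f x y = 2 * tree_join_height f x y - tree_height f x - tree_height f y"

text \<open>\<open>f\<close> maps each component of a level set into exactly one component of a level set.\<close>

definition tree_map :: "complex poly \<Rightarrow> complex set \<Rightarrow> complex set" where
  "tree_map f x = (THE y. y \<in> tree_points f \<and> poly f ` x \<subseteq> y)"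

definition poly_tree :: "complex poly \<Rightarrow> complex set dyn_tree" where
  "poly_tree f = \<lparr>points = tree_points f, tdist = tree_dist f, dyn = tree_map f\<rparr>"

definition tree_equiv :: "'a dyn_tree \<Rightarrow> 'b dyn_tree \<Rightarrow> bool" where
  "tree_equiv S T \<longleftrightarrow>
     (\<exists>\<phi>. bij_betw \<phi> (points S) (points T) \<and>
          (\<forall>x \<in> points S. \<forall>y \<in> points S. tdist T (\<phi> x) (\<phi> y) = tdist S x y) \<and>
          (\<forall>x \<in> points S. \<phi> (dyn S x) = dyn T (\<phi> x)))"

definition tree_rel :: "nat \<Rightarrow> (complex set dyn_tree \<times> complex set dyn_tree) set" where
  "tree_rel d = {(S, T). S \<in> poly_tree ` monic_centered d \<and> T \<in> poly_tree ` monic_centered d \<and>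
                         tree_equiv S T}"

text \<open>Conjugate polynomials have equivalent trees, so the union below is over a single
  equivalence class.\<close>

definition tree_proj :: "nat \<Rightarrow> complex poly set \<Rightarrow> complex set dyn_tree set" where
  "tree_proj d c = (\<Union>f\<in>c. tree_rel d `` {poly_tree f})"

text \<open>Every polynomial of degree \<open>d \<ge> 2\<close> is conjugate to a monic centered one, so
  \<open>tree_proj d\<close> maps onto the set of all equivalence classes of trees of degree \<open>d\<close> polynomials.\<close>

definition tree_space :: "nat \<Rightarrow> complex set dyn_tree set topology" where
  "tree_space d = quotient_topology (moduli_space d) (tree_proj d)"

end

theory Submission
  imports Defs "HOL-Complex_Analysis.Complex_Analysis"
    "HOL-Computational_Algebra.Fundamental_Theorem_Algebra"
begin

text \<open>Collapsing the components of the fibres of one map computes the monotone-light factor of another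
  as soon as each of the two maps is constant on the connected subsets of the fibres of the other.  For
  critical heights and trees this holds for two reasons.

  A critical point at height \<open>v > 0\<close> separates the sublevel set \<open>{G < v}\<close> locally, hence globally by the
  maximum principle, so \<open>v\<close> is a branching height of the tree.  The branching heights of a tree form a
  countable set, so the critical heights, being continuous, are constant on a connected set of
  polynomials with the same tree.

  Conversely, components of sublevel sets merge only at levels \<open>h / d\<^sup>n\<close> with \<open>h\<close> a critical height.  If
  the critical heights are fixed, these levels are fixed and discrete in \<open>(0, \<infinity>)\<close>, so a small
  perturbation does not change the tree above a given positive height.  Hence the truncated tree is
  constant on connected sets of polynomials with fixed critical heights, and a compactness argument
  assembles the equivalences of truncated trees into an equivalence of trees.

  The collapsing map is closed because critical heights are proper: a monic centered polynomial whose
  coefficients are of size \<open>\<rho>\<close> (with the coefficient of \<open>z\<^sup>i\<close> given weight \<open>d - i\<close>) has a critical value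
  of size \<open>\<rho>\<^sup>d\<close>, since \<open>z\<^sup>d\<close> is the only one all of whose critical values vanish.\<close>

section \<open>Collapsing components of fibres\<close>

text \<open>Three obstacles shape the proof. \<open>tree_equiv\<close> knows only distances and
  dynamics, so heights must be recovered from these: height 0 is recognised by bounded orbits, and
  branching heights become half-distances between points at height 0. Next, near height 0 a
  perturbation is out of control, so polynomials are compared at each level s > 0 separately, by
  relations between filled Julia sets; relations invert and compose without choices, and their
  dynamics is required only at level d s because f multiplies heights by d. Relations for different
  s need not be compatible, and the filled Julia sets are uncountable, so the limit of small s is a
  cluster point in a product over all their points. Finally, critical heights are unordered, so they
  enter the topology through symmetric products of n + h. All local information on the escape rate G
  comes from one device: iterating a point of positive height out to where the Boettcher function is
  defined gives a holomorphic P with |P| = exp (a G).\<close>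

lemma factor_through:
  assumes "\<And>x y. \<lbrakk>x \<in> A; y \<in> A; m x = m y\<rbrakk> \<Longrightarrow> p x = p y"
  obtains l where "\<And>x. x \<in> A \<Longrightarrow> l (m x) = p x"
proof (rule that)
  fix x assume "x \<in> A"
  then show "p (inv_into A m (m x)) = p x"
    by (intro assms) (auto intro: inv_into_into f_inv_into_f)
qed

lemma mem_fibre_component:
  assumes "x \<in> topspace X"
  shows "x \<in> fibre_component X c x"
  using assms by (simp add: fibre_component_def connected_component_of_refl)

lemma fibre_component_subset:
  "fibre_component X c x \<subseteq> {y \<in> topspace X. c y = c x}"
  unfolding fibre_component_def
  using connected_component_of_subset_topspace[of "subtopology X {y \<in> topspace X. c y = c x}" x] by auto

lemma connectedin_fibre_component:
  "connectedin X (fibre_component X c x)"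
  unfolding fibre_component_def
  using connectedin_connected_component_of[of "subtopology X {y \<in> topspace X. c y = c x}" x]
  by (simp add: connectedin_subtopology)

lemma fibre_component_maximal:
  assumes "connectedin X S" "x \<in> S" "\<And>y. y \<in> S \<Longrightarrow> c y = c x"
  shows "S \<subseteq> fibre_component X c x"
proof -
  have "S \<subseteq> topspace X" using assms(1) by (rule connectedin_subset_topspace)
  then have "S \<subseteq> {y \<in> topspace X. c y = c x}" using assms(3) by blast
  then have "connectedin (subtopology X {y \<in> topspace X. c y = c x}) S"
    using assms(1) by (simp add: connectedin_subtopology)
  then show ?thesis
    unfolding fibre_component_def using assms(2) by (rule connected_component_of_maximal)
qed

lemma fibre_component_eq:
  assumes "y \<in> fibre_component X c x"
  shows "fibre_component X c y = fibre_component X c x"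
proof -
  have "c y = c x" using assms fibre_component_subset[of X c x] by blast
  then have "{z \<in> topspace X. c z = c y} = {z \<in> topspace X. c z = c x}" by simp
  moreover have "connected_component_of (subtopology X {z \<in> topspace X. c z = c x}) x y"
    using assms by (simp add: fibre_component_def)
  ultimately show ?thesis
    unfolding fibre_component_def by (simp only: connected_component_of_equiv simp_thms)
qed

lemma fibre_component_eq_iff:
  assumes "x \<in> topspace X" "y \<in> topspace X"
  shows "fibre_component X c y = fibre_component X c x \<longleftrightarrow> y \<in> fibre_component X c x"
proof
  assume "fibre_component X c y = fibre_component X c x"
  then show "y \<in> fibre_component X c x"
    using mem_fibre_component[OF assms(2), of c] by simp
qed (rule fibre_component_eq)

lemma quotient_map_fibre_component:
  "quotient_map X (collapse_fibre_components X c) (fibre_component X c)"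
  unfolding collapse_fibre_components_def by (rule quotient_map_quotient_topology)

lemma fibre_of_fibre_component:
  assumes "x \<in> topspace X"
  shows "{y \<in> topspace X. fibre_component X c y = fibre_component X c x} = fibre_component X c x"
  using assms fibre_component_eq_iff[of x X] fibre_component_subset[of X c x] by blast

lemma monotone_map_fibre_component:
  "monotone_map X (collapse_fibre_components X c) (fibre_component X c)"
proof -
  have im: "fibre_component X c ` topspace X = topspace (collapse_fibre_components X c)"
    by (rule quotient_imp_surjective_map[OF quotient_map_fibre_component])
  have "connectedin X {y \<in> topspace X. fibre_component X c y = fibre_component X c x}"
    if "x \<in> topspace X" for x
    unfolding fibre_of_fibre_component[OF that] by (rule connectedin_fibre_component)
  then show ?thesis
    unfolding monotone_map_def im[symmetric] by simp
qed

text \<open>Everything is governed by the connected sets on which \<open>p\<close> is constant: by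
  \<open>pc\<close> each lies in one fibre component of \<open>c\<close>, and by \<open>cp\<close>
  each fibre component is such a set. Hence \<open>p\<close> descends to \<open>l\<close>, connected
  subsets of fibres of \<open>l\<close> are points, and a competing \<open>m'\<close> has the same
  fibres as the collapsing map.\<close>

theorem collapse_fibre_components_monotone_light:
  fixes X :: "'a topology" and c :: "'a \<Rightarrow> 'b" and p :: "'a \<Rightarrow> 'c"
  assumes cp: "\<And>S x y. \<lbrakk>connectedin X S; \<And>u v. \<lbrakk>u \<in> S; v \<in> S\<rbrakk> \<Longrightarrow> c u = c v; x \<in> S; y \<in> S\<rbrakk> \<Longrightarrow> p x = p y"
    and pc: "\<And>S x y. \<lbrakk>connectedin X S; \<And>u v. \<lbrakk>u \<in> S; v \<in> S\<rbrakk> \<Longrightarrow> p u = p v; x \<in> S; y \<in> S\<rbrakk> \<Longrightarrow> c x = c y"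
    and cl: "closed_map X (collapse_fibre_components X c) (fibre_component X c)"
  shows "\<exists>l. monotone_light_factorization X (quotient_topology X p) p
               (collapse_fibre_components X c) (fibre_component X c) l \<and>
             (\<forall>(Z :: 'z topology) m' l'.
                monotone_light_factorization X (quotient_topology X p) p Z m' l' \<longrightarrow>
                (\<exists>h. homeomorphic_map (collapse_fibre_components X c) Z h \<and>
                     (\<forall>x \<in> topspace X. h (fibre_component X c x) = m' x) \<and>
                     (\<forall>t \<in> topspace (collapse_fibre_components X c). l' (h t) = l t)))"
proof -
  define m where "m = fibre_component X c"
  define T where "T = collapse_fibre_components X c"
  define Y where "Y = quotient_topology X p"
  have qm: "quotient_map X T m" unfolding m_def T_def by (rule quotient_map_fibre_component)
  have contm: "continuous_map X T m" using qm by (rule quotient_imp_continuous_map)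
  have surjm: "m ` topspace X = topspace T" using qm by (rule quotient_imp_surjective_map)
  have monom: "monotone_map X T m" unfolding m_def T_def by (rule monotone_map_fibre_component)
  have clm: "closed_map X T m" using cl by (simp add: m_def T_def)
  have m_const: "m x = m y" if "connectedin X S" "\<And>u v. \<lbrakk>u \<in> S; v \<in> S\<rbrakk> \<Longrightarrow> p u = p v" "x \<in> S" "y \<in> S" for S x y
  proof -
    have "c u = c y" if "u \<in> S" for u
      by (rule pc[OF \<open>connectedin X S\<close> _ that \<open>y \<in> S\<close>])
         (rule \<open>\<And>u v. \<lbrakk>u \<in> S; v \<in> S\<rbrakk> \<Longrightarrow> p u = p v\<close>)
    then have "S \<subseteq> fibre_component X c y"
      by (rule fibre_component_maximal[OF \<open>connectedin X S\<close> \<open>y \<in> S\<close>])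
    then have "x \<in> fibre_component X c y" using \<open>x \<in> S\<close> by blast
    then show ?thesis unfolding m_def by (rule fibre_component_eq)
  qed
  have p_const: "p x = p y" if "x \<in> topspace X" "y \<in> topspace X" "m x = m y" for x y
  proof (rule cp)
    show "connectedin X (fibre_component X c x)" by (rule connectedin_fibre_component)
    show "c u = c v" if "u \<in> fibre_component X c x" "v \<in> fibre_component X c x" for u v
    proof -
      have "c u = c x" "c v = c x" using that fibre_component_subset[of X c x] by blast+
      then show ?thesis by simp
    qed
    show "x \<in> fibre_component X c x" "y \<in> fibre_component X c x"
      using that mem_fibre_component m_def by metis+
  qed
  obtain l where l: "\<And>x. x \<in> topspace X \<Longrightarrow> l (m x) = p x"
    using factor_through[of "topspace X" m p] p_const by blast
  have contp: "continuous_map X Y p"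
    unfolding Y_def by (rule quotient_imp_continuous_map[OF quotient_map_quotient_topology])
  have contl: "continuous_map T Y l"
  proof -
    have "continuous_map X Y (l \<circ> m)"
      by (rule continuous_map_eq[OF contp]) (simp add: l)
    then show ?thesis using qm continuous_compose_quotient_map by blast
  qed
  have light: "light_map T Y l"
    unfolding light_map_def totally_disconnectedin_def
  proof (intro conjI contl ballI allI impI)
    fix y C assume "C \<subseteq> {x \<in> topspace T. l x = y} \<and> connectedin T C"
    then have C: "C \<subseteq> topspace T" "\<And>t. t \<in> C \<Longrightarrow> l t = y" "connectedin T C" by auto
    let ?S = "{x \<in> topspace X. m x \<in> C}"
    \<comment> \<open>A monotone closed surjection pulls connected sets back to connected sets; for
      this the collapsing map has to be closed.\<close>
    have S: "connectedin X ?S"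
      using monotone_closed_map[OF contm clm surjm] monom C(3) by blast
    have pS: "p u = y" if "u \<in> ?S" for u
      using that C(2)[of "m u"] l[of u] by simp
    have mS: "m u = m v" if "u \<in> ?S" "v \<in> ?S" for u v
      by (rule m_const[OF S _ that]) (simp only: pS)
    have "s = t" if st: "s \<in> C" "t \<in> C" for s t
    proof -
      have "s \<in> m ` topspace X" "t \<in> m ` topspace X"
        using st C(1) unfolding surjm by (auto intro: subsetD)
      then obtain u v where "u \<in> topspace X" "m u = s" "v \<in> topspace X" "m v = t"
        by (metis imageE)
      then show ?thesis using mS[of u v] st by simp
    qed
    then show "\<exists>a. C \<subseteq> {a}" by blast
  qed auto
  have fac: "monotone_light_factorization X Y p T m l"
    unfolding monotone_light_factorization_def using contm clm surjm monom light l by blast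
  have uniq: "\<exists>h. homeomorphic_map T Z h \<and> (\<forall>x \<in> topspace X. h (m x) = m' x) \<and>
                  (\<forall>t \<in> topspace T. l' (h t) = l t)"
    if fac': "monotone_light_factorization X Y p Z m' l'" for Z :: "'z topology" and m' l'
  proof -
    have cm: "continuous_map X Z m'" and clm': "closed_map X Z m'" and sm: "m' ` topspace X = topspace Z"
      and mm: "monotone_map X Z m'" and li: "light_map Z Y l'"
      and lm: "\<And>x. x \<in> topspace X \<Longrightarrow> l' (m' x) = p x"
      using fac' unfolding monotone_light_factorization_def by auto
    have qm': "quotient_map X Z m'"
      using cm clm' sm by (rule continuous_closed_imp_quotient_map)
    \<comment> \<open>A fibre of \<open>m'\<close> is connected by monotonicity, and
      \<open>p\<close> is constant on it.\<close>
    have 1: "m x = m y" if xy: "x \<in> topspace X" "y \<in> topspace X" "m' x = m' y" for x y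
    proof (rule m_const)
      let ?S = "{u \<in> topspace X. m' u = m' x}"
      have "m' x \<in> topspace Z" using sm xy by blast
      then show "connectedin X ?S" using mm by (simp add: monotone_map_def)
      show "p u = p v" if "u \<in> ?S" "v \<in> ?S" for u v
        using that lm[of u] lm[of v] by simp
      show "x \<in> ?S" "y \<in> ?S" using xy by auto
    qed
    \<comment> \<open>Conversely \<open>m'\<close> sends a fibre component to a connected subset of
      a fibre of the light map \<open>l'\<close>, hence to a point.\<close>
    have 2: "m' x = m' y" if xy: "x \<in> topspace X" "y \<in> topspace X" "m x = m y" for x y
    proof -
      let ?S = "fibre_component X c x"
      have xS: "x \<in> ?S" "y \<in> ?S" using xy mem_fibre_component m_def by metis+
      have con: "connectedin Z (m' ` ?S)"
        using cm connectedin_fibre_component by (rule connectedin_continuous_map_image)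
      have sub: "?S \<subseteq> topspace X" using fibre_component_subset[of X c x] by auto
      have "l' (m' u) = p x" if "u \<in> ?S" for u
      proof -
        have "m u = m x" using that unfolding m_def by (rule fibre_component_eq)
        moreover have "u \<in> topspace X" using that sub by blast
        ultimately show ?thesis using lm p_const xy(1) by metis
      qed
      then have "m' ` ?S \<subseteq> {z \<in> topspace Z. l' z = p x}" using sm sub by blast
      moreover have "p x \<in> topspace Y" using contp xy by (auto simp: continuous_map_def)
      ultimately obtain a where "m' ` ?S \<subseteq> {a}"
        using li con unfolding light_map_def totally_disconnectedin_def by blast
      with xS show ?thesis by blast
    qed
    obtain h where h: "\<And>x. x \<in> topspace X \<Longrightarrow> h (m x) = m' x"
      using factor_through[of "topspace X" m m'] 2 by blast
    obtain k where k: "\<And>x. x \<in> topspace X \<Longrightarrow> k (m' x) = m x"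
      using factor_through[of "topspace X" m' m] 1 by blast
    have "continuous_map T Z h"
    proof -
      have "continuous_map X Z (h \<circ> m)" by (rule continuous_map_eq[OF cm]) (simp add: h)
      then show ?thesis using qm continuous_compose_quotient_map by blast
    qed
    moreover have "continuous_map Z T k"
    proof -
      have "continuous_map X T (k \<circ> m')" by (rule continuous_map_eq[OF contm]) (simp add: k)
      then show ?thesis using qm' continuous_compose_quotient_map by blast
    qed
    moreover have "\<forall>t \<in> topspace T. k (h t) = t" "\<forall>z \<in> topspace Z. h (k z) = z"
      using h k surjm sm by (metis imageE)+
    ultimately have "homeomorphic_map T Z h"
      unfolding homeomorphic_map_maps homeomorphic_maps_def by blast
    moreover have "\<forall>t \<in> topspace T. l' (h t) = l t"
      using h l lm surjm by (metis imageE)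
    ultimately show ?thesis using h by blast
  qed
  show ?thesis
    using fac uniq unfolding m_def T_def Y_def by blast
qed

text \<open>\<open>D\<close> has the fibres of \<open>c\<close> but is continuous into a Hausdorff
  space, and \<open>proper\<close> makes its fibres compact. In the compact fibre of x the component
  of x is cut off from \<open>A\<close> by a clopen set; the cut is thickened to disjoint open sets
  of X, and all sufficiently near fibres stay in their union, so components near that of x miss
  \<open>A\<close> as well.\<close>

lemma closed_map_fibre_component:
  fixes X :: "'a topology" and c :: "'a \<Rightarrow> 'b" and D :: "'a \<Rightarrow> 'e"
  assumes X: "Hausdorff_space X" and Y: "Hausdorff_space Y" and D: "continuous_map X Y D"
    and cD: "\<And>x y. \<lbrakk>x \<in> topspace X; y \<in> topspace X\<rbrakk> \<Longrightarrow> c x = c y \<longleftrightarrow> D x = D y"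
    and proper: "\<And>x. x \<in> topspace X \<Longrightarrow> \<exists>N K. openin Y N \<and> D x \<in> N \<and> compactin X K \<and> {y \<in> topspace X. D y \<in> N} \<subseteq> K"
  shows "closed_map X (collapse_fibre_components X c) (fibre_component X c)"
proof -
  define m where "m = fibre_component X c"
  have nbd: "\<exists>U. openin X U \<and> x \<in> U \<and> U \<inter> {u \<in> topspace X. m u \<in> m ` A} = {}"
    if A: "closedin X A" and x: "x \<in> topspace X" and xA: "m x \<notin> m ` A" for A x
  proof -
    obtain N K where NK: "openin Y N" "D x \<in> N" "compactin X K" "{y \<in> topspace X. D y \<in> N} \<subseteq> K"
      using proper[OF x] by blast
    define F where "F = {y \<in> topspace X. c y = c x}"
    have F_eq: "F = {y \<in> topspace X. D y \<in> {D x}}" using cD[OF _ x] unfolding F_def by blast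
    have "D x \<in> topspace Y" using D x by (auto simp: continuous_map_def)
    then have "closedin Y {D x}" using Y by (simp add: closedin_Hausdorff_singleton)
    then have "closedin X F" unfolding F_eq using D by (rule closedin_continuous_map_preimage[rotated])
    moreover have "F \<subseteq> K" using NK F_eq by auto
    ultimately have compF: "compactin X F" using NK(3) closed_compactin by blast
    define X' where "X' = subtopology X F"
    have tX': "topspace X' = F" by (auto simp: X'_def F_def)
    have cX': "compact_space X'" using compF by (simp add: X'_def compact_space_subtopology)
    have hX': "Hausdorff_space X'" using X by (simp add: X'_def Hausdorff_space_subtopology)
    have "closedin X' (A \<inter> F)" using A by (auto simp: X'_def closedin_subtopology)
    have mx: "m x = connected_component_of_set X' x" by (simp add: m_def fibre_component_def X'_def F_def)
    have xC: "m x \<in> connected_components_of X'"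
      unfolding mx using x by (auto simp: connected_components_of_def tX' F_def)
    have "disjnt (A \<inter> F) (m x)"
    proof -
      have "m a = m x" if "a \<in> m x" for a using that unfolding m_def by (rule fibre_component_eq)
      then show ?thesis using xA by (auto simp: disjnt_iff image_iff)
    qed
    \<comment> \<open>Clopen sets separate quasi-components, and in a compact Hausdorff space these
      are the components.\<close>
    have "m x \<in> quasi_components_of X'"
      using quasi_eq_connected_components_of[of X'] cX' hX' xC by auto
    moreover have "compactin X' (A \<inter> F)" using \<open>closedin X' (A \<inter> F)\<close> cX' closedin_compact_space by blast
    ultimately have "separated_between X' (A \<inter> F) (m x)"
      using separated_between_compact_quasi_component \<open>disjnt (A \<inter> F) (m x)\<close> by blast
    then obtain V where V: "closedin X' V" "openin X' V" "A \<inter> F \<subseteq> V" "m x \<subseteq> topspace X' - V"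
      unfolding separated_between by blast
    have comp: "compactin X V" "compactin X (F - V)"
    proof -
      have "compactin X' V" "compactin X' (F - V)"
        using V cX' closedin_compact_space tX' openin_closedin_eq by (metis closedin_diff closedin_topspace)+
      then show "compactin X V" "compactin X (F - V)" by (auto simp: X'_def compactin_subtopology)
    qed
    obtain V2 V1 where O: "openin X V2" "openin X V1" "V \<subseteq> V2" "F - V \<subseteq> V1" "disjnt V2 V1"
      using Hausdorff_space_compact_separation[OF X comp] by (auto simp: disjnt_def)
    \<comment> \<open>Removing \<open>A\<close> uncovers nothing of \<open>F - V\<close>, since
      \<open>A\<close> meets \<open>F\<close> only inside \<open>V\<close>.\<close>
    define V1' where "V1' = V1 - A"
    have V1': "openin X V1'" unfolding V1'_def using O A by (simp add: openin_diff)
    have FV1: "F - V \<subseteq> V1'" using O V by (auto simp: V1'_def)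
    let ?K = "K - (V1' \<union> V2)"
    have "compactin X ?K"
    proof -
      have "closedin X (topspace X - (V1' \<union> V2))"
        using V1' O(1) by (simp add: closedin_diff openin_Un)
      moreover have "?K = K \<inter> (topspace X - (V1' \<union> V2))"
        using compactin_subset_topspace[OF NK(3)] by blast
      ultimately show ?thesis using compact_Int_closedin[OF NK(3)] by metis
    qed
    then have "compactin Y (D ` ?K)" using D image_compactin by blast
    then have cK: "closedin Y (D ` ?K)" using Y compactin_imp_closedin by blast
    \<comment> \<open>The values taken on the part of \<open>K\<close> outside both open sets are
      excluded, so every fibre over \<open>N'\<close> lies in their union.\<close>
    define N' where "N' = N - D ` ?K"
    have N': "openin Y N'" unfolding N'_def using NK cK by (simp add: openin_diff)
    have DxN': "D x \<in> N'"
    proof -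
      have "D y \<noteq> D x" if "y \<in> ?K" for y
      proof
        assume "D y = D x"
        moreover have "y \<in> topspace X" using that NK(3) compactin_subset_topspace by blast
        ultimately have "y \<in> F" by (simp add: F_eq)
        then show False using that FV1 O(3) by blast
      qed
      then have "D x \<notin> D ` ?K" by (metis imageE)
      then show ?thesis using NK(2) by (simp add: N'_def)
    qed
    define U where "U = V1' \<inter> {y \<in> topspace X. D y \<in> N'}"
    have "openin X U" unfolding U_def using V1' openin_continuous_map_preimage[OF D N'] by blast
    moreover have "x \<in> U"
    proof -
      have "x \<in> m x" unfolding m_def using x by (rule mem_fibre_component)
      then have "x \<in> V1'" using V(4) tX' FV1 by blast
      then show ?thesis using DxN' x by (simp add: U_def)
    qed
    moreover have "m u \<notin> m ` A" if u: "u \<in> U" for u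
    proof
      assume "m u \<in> m ` A"
      then obtain a where a: "a \<in> A" "m u = m a" by blast
      have ut: "u \<in> topspace X" using u by (auto simp: U_def)
      have aX: "a \<in> topspace X" using a A closedin_subset by blast
      have sub: "m u \<subseteq> V1' \<union> V2"
      proof
        fix w assume "w \<in> m u"
        then have w: "w \<in> topspace X" "c w = c u"
          using fibre_component_subset[of X c u] unfolding m_def by blast+
        then have "D w = D u" using cD[of w u] ut by simp
        then have "D w \<in> N'" using u by (simp add: U_def)
        then have "D w \<in> N" "w \<notin> ?K" by (auto simp: N'_def)
        then show "w \<in> V1' \<union> V2" using w NK(4) by blast
      qed
      have "u \<in> m u" "a \<in> m u" using mem_fibre_component[OF ut, of c] mem_fibre_component[OF aX, of c] a(2) unfolding m_def by simp_all
      have con: "connectedin X (m u)" unfolding m_def by (rule connectedin_fibre_component)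
      have "m u \<inter> V2 = {}"
      proof (rule ccontr)
        assume "m u \<inter> V2 \<noteq> {}"
        moreover have "m u \<inter> V1' \<noteq> {}" using \<open>u \<in> m u\<close> u by (auto simp: U_def)
        moreover have "V1' \<inter> V2 \<inter> m u = {}" using O(5) by (auto simp: V1'_def disjnt_iff)
        ultimately show False using con V1' O(1) sub unfolding connectedin by blast
      qed
      then show False using \<open>a \<in> m u\<close> sub a(1) by (auto simp: V1'_def)
    qed
    ultimately show ?thesis by blast
  qed
  have "closedin (collapse_fibre_components X c) (m ` A)" if A: "closedin X A" for A
  proof -
    have AX: "A \<subseteq> topspace X" using A by (rule closedin_subset)
    have q: "quotient_map X (collapse_fibre_components X c) m"
      unfolding m_def by (rule quotient_map_fibre_component)
    let ?S = "{u \<in> topspace X. m u \<in> m ` A}"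
    have "openin X (topspace X - ?S)"
    proof (subst openin_subopen, intro ballI)
      fix x assume "x \<in> topspace X - ?S"
      then have "x \<in> topspace X" "m x \<notin> m ` A" by auto
      from nbd[OF A this] obtain U where U: "openin X U" "x \<in> U" "U \<inter> ?S = {}" by (elim exE conjE)
      have "U \<subseteq> topspace X - ?S" using U(3) openin_subset[OF U(1)] by auto
      then show "\<exists>T. openin X T \<and> x \<in> T \<and> T \<subseteq> topspace X - ?S" using U by auto
    qed
    then have "closedin X ?S" by (simp add: closedin_def)
    moreover have "m ` A \<subseteq> topspace (collapse_fibre_components X c)"
      using quotient_imp_surjective_map[OF q] AX by auto
    ultimately show ?thesis using q unfolding quotient_map_closedin by simp
  qed
  then show ?thesis unfolding closed_map_def m_def by simp
qed

section \<open>The escape rate\<close>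

definition logp :: "complex \<Rightarrow> real" where
  "logp w = ln (max 1 (norm w))"

lemma logp_nonneg: "0 \<le> logp w"
  by (simp add: logp_def)

lemma continuous_on_logp [continuous_intros]:
  "continuous_on S g \<Longrightarrow> continuous_on S (\<lambda>x. logp (g x))"
  unfolding logp_def by (intro continuous_intros) auto

lemma ln_le_iff_le_exp: "0 < x \<Longrightarrow> ln x \<le> y \<longleftrightarrow> x \<le> exp y" for x y :: real
  by (metis exp_le_cancel_iff exp_ln)

text \<open>The estimates depend on the polynomial only through its degree and an upper bound for
  this number, hence are uniform on bounded sets of coefficients.\<close>

definition coeff_sum :: "complex poly \<Rightarrow> real" where
  "coeff_sum f = (\<Sum>i\<le>degree f. norm (coeff f i))"

locale monic_poly =
  fixes f :: "complex poly"
  assumes deg2: "degree f \<ge> 2" and monic: "lead_coeff f = 1"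
begin

abbreviation d where "d \<equiv> degree f"

abbreviation G where "G \<equiv> escape_rate f"

section \<open>Growth of a monic polynomial\<close>

lemma coeff_sum_ge1: "coeff_sum f \<ge> 1"
proof -
  have "norm (coeff f d) \<le> coeff_sum f"
    unfolding coeff_sum_def by (rule member_le_sum) auto
  then show ?thesis using monic by simp
qed

lemma norm_poly_le:
  assumes "coeff_sum f \<le> B"
  shows "norm (poly f w) \<le> B * max 1 (norm w) ^ d"
proof -
  have "norm (poly f w) \<le> (\<Sum>i\<le>d. norm (coeff f i) * norm w ^ i)"
    unfolding poly_altdef by (rule order_trans[OF norm_sum]) (simp add: norm_mult norm_power)
  also have "\<dots> \<le> (\<Sum>i\<le>d. norm (coeff f i) * max 1 (norm w) ^ d)"
  proof (rule sum_mono)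
    fix i assume "i \<in> {..d}"
    have "norm w ^ i \<le> max 1 (norm w) ^ i" by (rule power_mono) auto
    also have "\<dots> \<le> max 1 (norm w) ^ d" using \<open>i \<in> {..d}\<close> by (intro power_increasing) auto
    finally show "norm (coeff f i) * norm w ^ i \<le> norm (coeff f i) * max 1 (norm w) ^ d"
      by (intro mult_left_mono) auto
  qed
  also have "\<dots> = coeff_sum f * max 1 (norm w) ^ d"
    by (simp add: coeff_sum_def sum_distrib_right)
  also have "\<dots> \<le> B * max 1 (norm w) ^ d" using assms by (intro mult_right_mono) auto
  finally show ?thesis .
qed

lemma norm_poly_minus_power_le:
  assumes "coeff_sum f \<le> B" "norm w \<ge> 1"
  shows "norm (poly f w - w ^ d) \<le> B * norm w ^ (d - 1)"
proof -
  have eq: "poly f w - w ^ d = (\<Sum>i<d. coeff f i * w ^ i)"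
    using monic by (simp add: poly_altdef lessThan_Suc_atMost[symmetric])
  have "norm (poly f w - w ^ d) \<le> (\<Sum>i<d. norm (coeff f i) * norm w ^ i)"
    unfolding eq by (rule order_trans[OF norm_sum]) (simp add: norm_mult norm_power)
  also have "\<dots> \<le> (\<Sum>i<d. norm (coeff f i) * norm w ^ (d - 1))"
    using assms by (intro sum_mono mult_left_mono power_increasing) auto
  also have "\<dots> = (\<Sum>i<d. norm (coeff f i)) * norm w ^ (d - 1)"
    by (simp add: sum_distrib_right)
  also have "\<dots> \<le> coeff_sum f * norm w ^ (d - 1)"
    unfolding coeff_sum_def by (intro mult_right_mono sum_mono2) auto
  also have "\<dots> \<le> B * norm w ^ (d - 1)" using assms by (intro mult_right_mono) auto
  finally show ?thesis .
qed

lemma norm_poly_ge: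
  assumes "coeff_sum f \<le> B" "norm w \<ge> 2 * B"
  shows "norm (poly f w) \<ge> norm w ^ d / 2"
proof -
  have B: "B \<ge> 1" using coeff_sum_ge1 assms by simp
  have pw: "norm w ^ d = norm w * norm w ^ (d - 1)"
    using deg2 by (simp add: power_eq_if)
  have "norm (poly f w - w ^ d) \<le> B * norm w ^ (d - 1)"
    using assms B by (intro norm_poly_minus_power_le) auto
  also have "\<dots> \<le> norm w / 2 * norm w ^ (d - 1)"
    using assms by (intro mult_right_mono) auto
  finally have "norm (poly f w - w ^ d) \<le> norm w ^ d / 2" by (simp add: pw)
  moreover have "norm (w ^ d) \<le> norm (poly f w) + norm (poly f w - w ^ d)"
    by (metis norm_minus_commute norm_triangle_sub)
  ultimately show ?thesis by (simp add: norm_power)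
qed

text \<open>Beyond radius 2 B the leading term dominates up to a factor 2; within that radius the
  allowed error is already at least d times \<open>logp w\<close>.\<close>

lemma logp_poly:
  assumes "coeff_sum f \<le> B"
  shows "\<bar>logp (poly f w) - d * logp w\<bar> \<le> d * ln (2 * B)"
proof -
  have B: "B \<ge> 1" using coeff_sum_ge1 assms by simp
  have l2B: "ln B \<le> ln (2 * B)" "ln 2 \<le> ln (2 * B)" "0 \<le> ln B" using B by auto
  have dl: "ln (2 * B) \<le> d * ln (2 * B)" using deg2 l2B B
    by (metis le_trans mult_le_cancel_right1 of_nat_1 of_nat_le_iff one_le_numeral order_trans not_le)
  have "logp (poly f w) \<le> d * logp w + ln B"
  proof -
    have "1 * 1 \<le> B * max 1 (norm w) ^ d" using B by (intro mult_mono one_le_power) auto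
    then have "max 1 (norm (poly f w)) \<le> B * max 1 (norm w) ^ d"
      using norm_poly_le[OF assms, of w] by simp
    then have "logp (poly f w) \<le> ln (B * max 1 (norm w) ^ d)"
      unfolding logp_def by (subst ln_le_cancel_iff) (use B in \<open>auto intro!: mult_pos_pos\<close>)
    also have "\<dots> = ln B + d * logp w"
      using B unfolding logp_def by (subst ln_mult_pos) (auto simp: ln_realpow)
    finally show ?thesis by simp
  qed
  moreover have "logp (poly f w) \<ge> d * logp w - d * ln (2 * B)"
  proof (cases "norm w \<ge> 2 * B")
    case True
    have w1: "norm w > 1" using True B by simp
    have "norm w ^ d / 2 \<le> max 1 (norm (poly f w))" using norm_poly_ge[OF assms True] by simp
    moreover have "norm w ^ d / 2 > 0" using w1 by (metis half_gt_zero less_trans zero_less_one zero_less_power)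
    ultimately have "ln (norm w ^ d / 2) \<le> logp (poly f w)"
      unfolding logp_def by (simp add: ln_le_cancel_iff)
    moreover have "ln (norm w ^ d / 2) = d * logp w - ln 2"
    proof -
      have "norm w ^ d > 0" using w1 by (intro zero_less_power) linarith
      moreover have "max 1 (norm w) = norm w" "w \<noteq> 0" using w1 by auto
      ultimately show ?thesis using w1 by (simp add: logp_def ln_div ln_realpow)
    qed
    ultimately show ?thesis using l2B dl by linarith
  next
    case False
    then have "logp w \<le> ln (2 * B)" using B unfolding logp_def by (subst ln_le_cancel_iff) auto
    then have "d * logp w \<le> d * ln (2 * B)" by (intro mult_left_mono) auto
    then show ?thesis using logp_nonneg[of "poly f w"] by linarith
  qed
  ultimately show ?thesis using l2B dl by linarith
qed

abbreviation Gn :: "nat \<Rightarrow> complex \<Rightarrow> real" where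
  "Gn n z \<equiv> logp ((poly f ^^ n) z) / d ^ n"

text \<open>Telescoping, where the increment from n to n + 1 is at most K / d^(n+1). The factor 1 -
  1/d^k is the form that survives the induction, because 1/d^(k+1) \<le> 1/d^k - 1/d^(k+1) for d
  \<ge> 2.\<close>

lemma Gn_diff:
  assumes "coeff_sum f \<le> B"
  shows "\<bar>Gn (n + k) z - Gn n z\<bar> \<le> d * ln (2 * B) / d ^ n * (1 - 1 / d ^ k)"
proof (induction k)
  case (Suc k)
  define K where "K = d * ln (2 * B)"
  have K: "K \<ge> 0" unfolding K_def using coeff_sum_ge1 assms by auto
  have d0: "real d \<ge> 2" "real d > 0" using deg2 by auto
  have "\<bar>logp (poly f ((poly f ^^ (n + k)) z)) - d * logp ((poly f ^^ (n + k)) z)\<bar> \<le> K"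
    unfolding K_def by (rule logp_poly[OF assms])
  then have "\<bar>logp (poly f ((poly f ^^ (n + k)) z)) - d * logp ((poly f ^^ (n + k)) z)\<bar> / d ^ (Suc (n + k)) \<le> K / d ^ Suc (n + k)"
    using d0 by (intro divide_right_mono) auto
  moreover have "Gn (n + Suc k) z - Gn (n + k) z =
      (logp (poly f ((poly f ^^ (n + k)) z)) - d * logp ((poly f ^^ (n + k)) z)) / d ^ Suc (n + k)"
    using d0 by (simp add: diff_divide_distrib)
  ultimately have 1: "\<bar>Gn (n + Suc k) z - Gn (n + k) z\<bar> \<le> K / d ^ Suc (n + k)"
    using d0 by (simp add: abs_divide)
  have "K / d ^ Suc (n + k) = K / d ^ n * (1 / d ^ Suc k)" by (simp add: power_add)
  also have "\<dots> \<le> K / d ^ n * (1 / d ^ k - 1 / d ^ Suc k)"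
  proof (rule mult_left_mono)
    have "1 / d ^ k = d * (1 / d ^ Suc k)" using d0 by simp
    moreover have "2 * (1 / d ^ Suc k) \<le> d * (1 / d ^ Suc k)"
      using d0 by (intro mult_right_mono) auto
    ultimately show "1 / d ^ Suc k \<le> 1 / d ^ k - 1 / d ^ Suc k" by linarith
  qed (use K d0 in auto)
  finally have 2: "K / d ^ Suc (n + k) \<le> K / d ^ n * (1 / d ^ k - 1 / d ^ Suc k)" .
  have "\<bar>Gn (n + Suc k) z - Gn n z\<bar> \<le> K / d ^ n * (1 / d ^ k - 1 / d ^ Suc k) + K / d ^ n * (1 - 1 / d ^ k)"
    using 1 2 Suc.IH unfolding K_def[symmetric] by linarith
  also have "\<dots> = K / d ^ n * (1 - 1 / d ^ Suc k)"
    by (simp only: distrib_left[symmetric]) simp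
  finally show ?case unfolding K_def .
qed simp

lemma Gn_diff_le:
  assumes "coeff_sum f \<le> B"
  shows "\<bar>Gn (n + k) z - Gn n z\<bar> \<le> d * ln (2 * B) / d ^ n"
proof -
  have "d * ln (2 * B) / d ^ n * (1 - 1 / d ^ k) \<le> d * ln (2 * B) / d ^ n * 1"
    using coeff_sum_ge1 assms by (intro mult_left_mono) auto
  then show ?thesis using Gn_diff[OF assms, where n = n and k = k and z = z] by linarith
qed

lemma bound_tendsto_0: "(\<lambda>n. c / d ^ n) \<longlonglongrightarrow> 0"
proof -
  have "(\<lambda>n. c * inverse (real d ^ n)) \<longlonglongrightarrow> c * 0"
    using deg2 by (intro tendsto_intros LIMSEQ_inverse_realpow_zero) auto
  then show ?thesis by (simp add: divide_inverse)
qed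

lemma Gn_LIMSEQ: "(\<lambda>n. Gn n z) \<longlonglongrightarrow> G z"
proof -
  have "Cauchy (\<lambda>n. Gn n z)"
  proof (rule CauchyI)
    fix e :: real assume "e > 0"
    let ?K = "d * ln (2 * coeff_sum f)"
    from bound_tendsto_0[of ?K] obtain N where N: "\<And>n. n \<ge> N \<Longrightarrow> norm (?K / d ^ n - 0) < e / 2"
      using \<open>e > 0\<close> LIMSEQ_D[of _ 0 "e / 2"] by (metis half_gt_zero)
    show "\<exists>M. \<forall>m\<ge>M. \<forall>n\<ge>M. norm (Gn m z - Gn n z) < e"
    proof (intro exI allI impI)
      fix m n assume mn: "m \<ge> N" "n \<ge> N"
      have *: "\<bar>Gn k z - Gn N z\<bar> < e / 2" if "k \<ge> N" for k
      proof -
        have "\<bar>Gn k z - Gn N z\<bar> \<le> ?K / d ^ N"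
          using Gn_diff_le[OF order_refl, where n = N and k = "k - N" and z = z] that by simp
        moreover have "?K / d ^ N < e / 2" using N[OF order_refl] unfolding real_norm_def by linarith
        ultimately show ?thesis by linarith
      qed
      show "norm (Gn m z - Gn n z) < e"
        unfolding real_norm_def using *[OF mn(1)] *[OF mn(2)] by linarith
    qed
  qed
  then have "convergent (\<lambda>n. Gn n z)" by (rule Cauchy_convergent)
  then show ?thesis
    unfolding escape_rate_def logp_def[symmetric] by (simp add: convergent_LIMSEQ_iff)
qed

text \<open>The error is uniform in z and over all f of the same degree with
  \<open>coeff_sum\<close> at most B. The case n = 0 compares G with \<open>logp\<close> and serves
  throughout as a size estimate.\<close>

lemma G_approx:
  assumes "coeff_sum f \<le> B"
  shows "\<bar>G z - Gn n z\<bar> \<le> d * ln (2 * B) / d ^ n"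
proof (rule tendsto_le[OF sequentially_bot])
  have "(\<lambda>k. Gn (n + k) z) \<longlonglongrightarrow> G z"
    using LIMSEQ_ignore_initial_segment[OF Gn_LIMSEQ, where k = n] by (simp add: add.commute)
  then show "(\<lambda>k. \<bar>Gn (n + k) z - Gn n z\<bar>) \<longlonglongrightarrow> \<bar>G z - Gn n z\<bar>" by (intro tendsto_intros)
  show "(\<lambda>_. d * ln (2 * B) / d ^ n) \<longlonglongrightarrow> d * ln (2 * B) / d ^ n" by simp
  show "\<forall>\<^sub>F k in sequentially. \<bar>Gn (n + k) z - Gn n z\<bar> \<le> d * ln (2 * B) / d ^ n"
    by (intro always_eventually allI Gn_diff_le[OF assms])
qed

lemma G_nonneg: "0 \<le> G z"
  by (rule LIMSEQ_le_const[OF Gn_LIMSEQ]) (auto simp: logp_nonneg)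

lemma G_poly: "G (poly f z) = d * G z"
proof (rule LIMSEQ_unique[OF Gn_LIMSEQ])
  have "(\<lambda>n. d * Gn (Suc n) z) \<longlonglongrightarrow> d * G z"
    by (intro tendsto_intros LIMSEQ_Suc Gn_LIMSEQ)
  moreover have "d * Gn (Suc n) z = Gn n (poly f z)" for n
    using deg2 by (simp add: funpow_swap1)
  ultimately show "(\<lambda>n. Gn n (poly f z)) \<longlonglongrightarrow> d * G z" by simp
qed

lemma G_funpow: "G ((poly f ^^ n) z) = d ^ n * G z"
  by (induction n) (simp_all add: G_poly)

lemma G_ge: "logp z - d * ln (2 * coeff_sum f) \<le> G z"
  using G_approx[OF order_refl, where z = z and n = 0] by simp

section \<open>Continuity, compact sublevel sets and the maximum principle\<close>

lemma continuous_on_funpow: "continuous_on S (poly f ^^ n)"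
  by (induction n) (auto intro!: continuous_intros simp: o_def id_def)

lemma continuous_on_G: "continuous_on S G"
proof (rule uniform_limit_theorem)
  show "\<forall>\<^sub>F n in sequentially. continuous_on S (Gn n)"
    using deg2 by (intro always_eventually allI continuous_intros continuous_on_funpow) auto
  show "uniform_limit S Gn G sequentially"
  proof (rule uniform_limitI)
    fix e :: real assume "e > 0"
    let ?K = "d * ln (2 * coeff_sum f)"
    have "\<forall>\<^sub>F n in sequentially. ?K / d ^ n < e"
      using bound_tendsto_0[of ?K] \<open>e > 0\<close> by (rule order_tendstoD(2))
    then show "\<forall>\<^sub>F n in sequentially. \<forall>x\<in>S. dist (Gn n x) (G x) < e"
    proof eventually_elim
      case (elim n)
      then show ?case using G_approx[OF order_refl, where n = n] by (auto simp: dist_real_def abs_minus_commute intro: le_less_trans)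
    qed
  qed
qed simp

lemma open_lt: "open {z. G z < t}"
  using continuous_on_G[of UNIV] by (intro open_Collect_less continuous_intros) auto

lemma closed_le: "closed {z. G z \<le> t}"
  using continuous_on_G[of UNIV] by (intro closed_Collect_le continuous_intros) auto

lemma bounded_le: "bounded {z. G z \<le> t}"
proof (rule boundedI)
  fix z assume "z \<in> {z. G z \<le> t}"
  then have "logp z \<le> t + d * ln (2 * coeff_sum f)" using G_ge[of z] by simp
  then have "max 1 (norm z) \<le> exp (t + d * ln (2 * coeff_sum f))"
    unfolding logp_def by (subst (asm) ln_le_iff_le_exp) auto
  then show "norm z \<le> exp (t + d * ln (2 * coeff_sum f))" by simp
qed

lemma compact_le: "compact {z. G z \<le> t}"
  using closed_le bounded_le by (simp add: compact_eq_bounded_closed)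

lemma holomorphic_funpow: "(poly f ^^ n) holomorphic_on S"
proof (induction n)
  case (Suc n)
  then show ?case by (auto intro!: holomorphic_intros simp: o_def)
qed (auto simp: id_def intro!: holomorphic_intros)

text \<open>The maximum modulus principle is applied to every iterate of f, for which the boundary
  bound holds up to the error K / d^n of \<open>G_approx\<close>; the error vanishes in the
  limit.\<close>

lemma maximum_principle:
  assumes S: "bounded S" and le: "\<And>z. z \<in> frontier S \<Longrightarrow> G z \<le> v" and x: "x \<in> S"
  shows "G x \<le> v"
proof (rule LIMSEQ_le[OF Gn_LIMSEQ])
  let ?K = "d * ln (2 * coeff_sum f)"
  have "(\<lambda>n. v + ?K / d ^ n) \<longlonglongrightarrow> v + 0" by (intro tendsto_intros bound_tendsto_0)
  then show "(\<lambda>n. v + ?K / d ^ n) \<longlonglongrightarrow> v" by simp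
  \<comment> \<open>Nonnegativity of v absorbs the maximum with 1 inside
    \<open>logp\<close>.\<close>
  have v: "v \<ge> 0"
  proof -
    have "frontier S \<noteq> {}" using S x
      by (metis empty_iff frontier_eq_empty not_bounded_UNIV)
    then show ?thesis using le G_nonneg order_trans by blast
  qed
  have "Gn n x \<le> v + ?K / d ^ n" for n
  proof -
    have dn: "real d ^ n > 0" using deg2 by simp
    have iff: "Gn n z \<le> v + ?K / d ^ n \<longleftrightarrow> max 1 (norm ((poly f ^^ n) z)) \<le> exp (d ^ n * (v + ?K / d ^ n))" for z
    proof -
      have "Gn n z \<le> v + ?K / d ^ n \<longleftrightarrow> logp ((poly f ^^ n) z) \<le> d ^ n * (v + ?K / d ^ n)"
        using dn by (simp add: pos_divide_le_eq mult.commute)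
      also have "\<dots> \<longleftrightarrow> max 1 (norm ((poly f ^^ n) z)) \<le> exp (d ^ n * (v + ?K / d ^ n))"
        unfolding logp_def by (rule ln_le_iff_le_exp) auto
      finally show ?thesis .
    qed
    have nn: "0 \<le> d ^ n * (v + ?K / d ^ n)" using v coeff_sum_ge1 by auto
    have "norm ((poly f ^^ n) x) \<le> exp (d ^ n * (v + ?K / d ^ n))"
    proof (rule maximum_modulus_frontier[of "poly f ^^ n" S])
      show "(poly f ^^ n) holomorphic_on interior S" by (rule holomorphic_funpow)
      show "continuous_on (closure S) (poly f ^^ n)" by (rule continuous_on_funpow)
      show "norm ((poly f ^^ n) z) \<le> exp (d ^ n * (v + ?K / d ^ n))" if "z \<in> frontier S" for z
      proof -
        have "Gn n z \<le> v + ?K / d ^ n" using G_approx[OF order_refl, where z = z and n = n] le[OF that] by linarith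
        then show ?thesis using iff[of z] by simp
      qed
    qed (use S x in auto)
    then show ?thesis unfolding iff using nn by simp
  qed
  then show "\<exists>N. \<forall>n\<ge>N. Gn n x \<le> v + ?K / d ^ n" by blast
qed

end

section \<open>Boettcher coordinates\<close>

context monic_poly
begin

text \<open>The factor 8 puts f(w) / w^d within 1/8 of 1 beyond this radius, so that its principal
  logarithm is holomorphic with norm at most 1/4; moreover the region |w| > R is mapped into
  itself.\<close>

definition R :: real where "R = 8 * coeff_sum f"

lemma R_ge: "R \<ge> 8" using coeff_sum_ge1 by (simp add: R_def)

lemma ratio_near_1:
  assumes "norm w > R"
  shows "norm (poly f w / w ^ d - 1) \<le> 1 / 8"
proof -
  have w: "norm w > 8" "w \<noteq> 0" using assms R_ge by auto
  have pw: "norm w ^ d = norm w * norm w ^ (d - 1)" using deg2 by (simp add: power_eq_if)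
  have "norm (poly f w / w ^ d - 1) = norm (poly f w - w ^ d) / norm w ^ d"
    using w by (simp add: divide_simps norm_divide norm_power flip: norm_mult)
  also have "\<dots> \<le> coeff_sum f * norm w ^ (d - 1) / norm w ^ d"
    using w by (intro divide_right_mono norm_poly_minus_power_le) auto
  also have "\<dots> = coeff_sum f / norm w" using w by (simp add: pw)
  also have "\<dots> \<le> 1 / 8" using assms w by (simp add: R_def divide_simps)
  finally show ?thesis .
qed

lemma ratio_not_nonpos:
  assumes "norm w > R"
  shows "poly f w / w ^ d \<notin> \<real>\<^sub>\<le>\<^sub>0"
proof
  assume "poly f w / w ^ d \<in> \<real>\<^sub>\<le>\<^sub>0"
  then have "Re (poly f w / w ^ d - 1) \<le> -1" by (auto simp: complex_nonpos_Reals_iff)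
  moreover have "\<bar>Re (poly f w / w ^ d - 1)\<bar> \<le> 1 / 8"
    using abs_Re_le_cmod ratio_near_1[OF assms] order_trans by blast
  ultimately show False by linarith
qed

lemma norm_Ln_ratio:
  assumes "norm w > R"
  shows "norm (Ln (poly f w / w ^ d)) \<le> 1 / 4"
  using norm_Ln_le[of "poly f w / w ^ d - 1"] ratio_near_1[OF assms] by simp

lemma norm_poly_ge_norm:
  assumes "norm w > R"
  shows "norm (poly f w) \<ge> norm w"
proof -
  have w: "norm w > 8" using assms R_ge by simp
  have "norm w ^ d / 2 \<le> norm (poly f w)"
    using assms coeff_sum_ge1 by (intro norm_poly_ge[OF order_refl]) (auto simp: R_def)
  moreover have "norm w ^ 2 \<le> norm w ^ d" using w deg2 by (intro power_increasing) auto
  moreover have "8 * norm w \<le> norm w ^ 2" using w by (simp add: power2_eq_square mult_right_mono)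
  ultimately show ?thesis using w by linarith
qed

lemma norm_orbit:
  assumes "norm z > R"
  shows "norm ((poly f ^^ n) z) > R"
  using assms
proof (induction n)
  case (Suc n)
  then show ?case using norm_poly_ge_norm[of "(poly f ^^ n) z"] by simp
qed simp

text \<open>Logarithms of the factors (f^(j+1)(z) / f^j(z)^d)^(1/d^(j+1)) in the classical product
  for the Boettcher function. For |z| > R the ratios are near 1, so the principal branch defines all
  the roots.\<close>

definition log_ratio :: "nat \<Rightarrow> complex \<Rightarrow> complex" where
  "log_ratio j z = Ln (poly f ((poly f ^^ j) z) / ((poly f ^^ j) z) ^ d) / of_nat d ^ Suc j"

definition boettcher_exponent :: "complex \<Rightarrow> complex" where
  "boettcher_exponent z = (\<Sum>j. log_ratio j z)"

lemma norm_log_ratio: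
  assumes "norm z > R"
  shows "norm (log_ratio j z) \<le> 1 / 4 * (1 / 2) ^ Suc j"
proof -
  have "norm (log_ratio j z) = norm (Ln (poly f ((poly f ^^ j) z) / ((poly f ^^ j) z) ^ d)) / d ^ Suc j"
    by (simp add: log_ratio_def norm_divide norm_power norm_mult)
  also have "\<dots> \<le> (1 / 4) / 2 ^ Suc j"
  proof (rule frac_le)
    show "norm (Ln (poly f ((poly f ^^ j) z) / (poly f ^^ j) z ^ d)) \<le> 1 / 4"
      by (rule norm_Ln_ratio[OF norm_orbit[OF assms]])
    have "(2::real) ^ Suc j \<le> real d ^ Suc j" using deg2 by (intro power_mono) auto
    then show "(2::real) ^ Suc j \<le> real (d ^ Suc j)" by simp
  qed auto
  finally show ?thesis by (simp add: power_one_over)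
qed

lemma summable_log_ratio_bound: "summable (\<lambda>j. 1 / 4 * (1 / 2 :: real) ^ Suc j)"
  using sums_mult[OF power_half_series, of "1/4"] by (rule sums_summable)

lemma uniform_limit_exponent:
  "uniform_limit {z. norm z > R} (\<lambda>n z. \<Sum>j<n. log_ratio j z) boettcher_exponent sequentially"
  unfolding boettcher_exponent_def
  by (rule Weierstrass_m_test[OF _ summable_log_ratio_bound]) (rule norm_log_ratio, simp)

lemma norm_exponent:
  assumes "norm z > R"
  shows "norm (boettcher_exponent z) \<le> 1 / 4"
proof -
  have "norm (boettcher_exponent z) \<le> (\<Sum>j. 1 / 4 * (1 / 2 :: real) ^ Suc j)"
    unfolding boettcher_exponent_def
    using norm_log_ratio[OF assms] summable_log_ratio_bound by (rule norm_suminf_le)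
  also have "\<dots> = 1 / 4 * 1"
    using sums_mult[OF power_half_series, of "1/4"] by (rule sums_unique[symmetric])
  finally show ?thesis by simp
qed

lemma open_norm_gt: "open {z :: complex. norm z > c}"
  by (intro open_Collect_less continuous_intros)

lemma holomorphic_exponent: "boettcher_exponent holomorphic_on {z. norm z > R}"
proof (rule holomorphic_uniform_sequence[OF open_norm_gt])
  have "log_ratio j holomorphic_on {z. norm z > R}" for j
  proof -
    have nz: "(poly f ^^ j) z \<noteq> 0" if "norm z > R" for z
      using norm_orbit[OF that, of j] R_ge by auto
    have hol: "(\<lambda>z. (poly f ^^ j) z) holomorphic_on {z. norm z > R}"
      by (rule holomorphic_funpow)
    have hol2: "(\<lambda>z. poly f ((poly f ^^ j) z)) holomorphic_on {z. norm z > R}"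
      using holomorphic_funpow[of "Suc j"] by (simp add: o_def)
    show ?thesis
      unfolding log_ratio_def using nz ratio_not_nonpos norm_orbit deg2
      by (intro holomorphic_intros hol hol2) auto
  qed
  then show "(\<lambda>z. \<Sum>j<n. log_ratio j z) holomorphic_on {z. norm z > R}" for n
    by (intro holomorphic_intros)
  fix x :: complex assume "x \<in> {z. norm z > R}"
  then obtain e where e: "e > 0" "cball x e \<subseteq> {z. norm z > R}"
    using open_contains_cball_eq[OF open_norm_gt[of R]] by metis
  then show "\<exists>e>0. cball x e \<subseteq> {z. norm z > R} \<and>
      uniform_limit (cball x e) (\<lambda>n z. \<Sum>j<n. log_ratio j z) boettcher_exponent sequentially"
    using uniform_limit_on_subset[OF uniform_limit_exponent e(2)] by auto
qed

text \<open>The real parts telescope: |f^(j+1)(z)| has exponent 1/d^(j+1) in one factor and the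
  opposite exponent in the next.\<close>

lemma Gn_eq_log_ratio:
  assumes "norm z > R"
  shows "Gn n z = ln (norm z) + Re (\<Sum>j<n. log_ratio j z)"
proof (induction n)
  case 0
  show ?case using assms R_ge by (simp add: logp_def)
next
  case (Suc n)
  define w where "w = (poly f ^^ n) z"
  have w: "norm w > R" unfolding w_def by (rule norm_orbit[OF assms])
  have w8: "norm w > 8" "norm (poly f w) > 8" using w R_ge norm_poly_ge_norm[OF w] by auto
  then have nz: "w \<noteq> 0" "poly f w \<noteq> 0" by auto
  have "Re (log_ratio n z) = Re (Ln (poly f w / w ^ d)) / d ^ Suc n"
  proof -
    have "log_ratio n z = Ln (poly f w / w ^ d) / complex_of_real (real (d ^ Suc n))"
      by (simp add: log_ratio_def w_def)
    then show ?thesis by (metis Re_divide_of_real)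
  qed
  also have "Re (Ln (poly f w / w ^ d)) = ln (norm (poly f w)) - d * ln (norm w)"
    using nz by (simp add: norm_divide norm_power ln_div ln_realpow)
  finally have 1: "Re (log_ratio n z) = (ln (norm (poly f w)) - d * ln (norm w)) / d ^ Suc n" .
  have "Gn (Suc n) z - Gn n z = ln (norm (poly f w)) / d ^ Suc n - ln (norm w) / d ^ n"
    using w8 by (simp add: logp_def w_def[symmetric])
  also have "\<dots> = (ln (norm (poly f w)) - d * ln (norm w)) / d ^ Suc n"
    using deg2 by (simp add: diff_divide_distrib)
  finally have "Gn (Suc n) z = Gn n z + Re (log_ratio n z)" using 1 by simp
  then show ?case using Suc.IH by simp
qed

lemma G_eq_exponent:
  assumes "norm z > R"
  shows "G z = ln (norm z) + Re (boettcher_exponent z)"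
proof (rule LIMSEQ_unique[OF Gn_LIMSEQ])
  have "(\<lambda>n. \<Sum>j<n. log_ratio j z) \<longlonglongrightarrow> boettcher_exponent z"
    using tendsto_uniform_limitI[OF uniform_limit_exponent] assms by auto
  then have "(\<lambda>n. ln (norm z) + Re (\<Sum>j<n. log_ratio j z)) \<longlonglongrightarrow> ln (norm z) + Re (boettcher_exponent z)"
    by (intro tendsto_intros)
  then show "(\<lambda>n. Gn n z) \<longlonglongrightarrow> ln (norm z) + Re (boettcher_exponent z)"
    by (simp only: Gn_eq_log_ratio[OF assms])
qed

definition boettcher :: "complex \<Rightarrow> complex" where
  "boettcher z = z * exp (boettcher_exponent z)"

lemma holomorphic_boettcher: "boettcher holomorphic_on {z. norm z > R}"
  unfolding boettcher_def by (intro holomorphic_intros holomorphic_exponent)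

lemma norm_boettcher:
  assumes "norm z > R"
  shows "norm (boettcher z) = exp (G z)"
proof -
  have "norm z > 0" using assms R_ge by linarith
  then show ?thesis
    by (simp add: boettcher_def G_eq_exponent[OF assms] norm_mult exp_add)
qed

text \<open>The derivative of z exp(E) is exp(E) (1 + z E'). For |z| > 2 R the disc of radius |z|/3
  about z stays beyond R, where |E| \<le> 1/4, so Cauchy's estimate gives |z E'| \<le> 3/4.\<close>

lemma deriv_boettcher_nonzero:
  assumes "norm z > 2 * R"
  shows "deriv boettcher z \<noteq> 0"
proof -
  have z: "norm z > R" "norm z > 0" using assms R_ge by auto
  define r where "r = norm z / 3"
  have r: "r > 0" using z by (simp add: r_def)
  have sub: "cball z r \<subseteq> {z. norm z > R}"
  proof
    fix w assume "w \<in> cball z r"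
    then have "norm z - norm w \<le> norm z / 3"
      using norm_triangle_ineq2[of z w] by (simp add: dist_norm r_def)
    then show "w \<in> {z. norm z > R}" using assms R_ge by simp
  qed
  have "norm ((deriv ^^ 1) boettcher_exponent z) \<le> fact 1 * (1 / 4) / r ^ 1"
  proof (rule Cauchy_inequality[OF _ _ r])
    show "boettcher_exponent holomorphic_on ball z r"
      using holomorphic_exponent by (rule holomorphic_on_subset) (use sub ball_subset_cball in blast)
    show "continuous_on (cball z r) boettcher_exponent"
      using holomorphic_on_imp_continuous_on[OF holomorphic_exponent] sub by (rule continuous_on_subset)
    show "norm (boettcher_exponent x) \<le> 1 / 4" if "norm (z - x) = r" for x
    proof -
      have "x \<in> cball z r" using that by (simp add: dist_norm)
      then show ?thesis using sub norm_exponent by blast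
    qed
  qed
  then have "norm (deriv boettcher_exponent z) \<le> 3 / (4 * norm z)"
    by (simp add: r_def)
  then have "norm z * norm (deriv boettcher_exponent z) \<le> norm z * (3 / (4 * norm z))"
    by (intro mult_left_mono) auto
  then have lt: "norm (z * deriv boettcher_exponent z) < 1" using z by (simp add: norm_mult)
  have "boettcher_exponent field_differentiable at z"
    using holomorphic_exponent open_norm_gt z by (intro holomorphic_on_imp_differentiable_at) auto
  then have "(boettcher_exponent has_field_derivative deriv boettcher_exponent z) (at z)"
    by (simp add: field_differentiable_derivI)
  then have "(boettcher has_field_derivative
      exp (boettcher_exponent z) * (1 + z * deriv boettcher_exponent z)) (at z)"
    unfolding boettcher_def by (auto intro!: derivative_eq_intros simp: algebra_simps)
  then have "deriv boettcher z = exp (boettcher_exponent z) * (1 + z * deriv boettcher_exponent z)"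
    by (rule DERIV_imp_deriv)
  moreover have "1 + z * deriv boettcher_exponent z \<noteq> 0"
    using lt by (metis add_eq_0_iff norm_minus_cancel norm_one less_irrefl)
  ultimately show ?thesis by simp
qed

section \<open>Critical points of iterates and local coordinates for the escape rate\<close>

definition iter_poly :: "nat \<Rightarrow> complex poly" where
  "iter_poly n = ((\<lambda>g. pcompose f g) ^^ n) [:0, 1:]"

lemma poly_iter_poly: "poly (iter_poly n) = poly f ^^ n"
  by (induction n) (auto simp: iter_poly_def poly_pcompose fun_eq_iff)

lemma degree_iter_poly: "degree (iter_poly n) = d ^ n"
  by (induction n) (auto simp: iter_poly_def degree_pcompose)

lemma pderiv_iter_poly_Suc:
  "poly (pderiv (iter_poly (Suc n))) z = poly (pderiv f) ((poly f ^^ n) z) * poly (pderiv (iter_poly n)) z"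
proof -
  have "iter_poly (Suc n) = pcompose f (iter_poly n)" by (simp add: iter_poly_def)
  then show ?thesis by (simp add: pderiv_pcompose poly_pcompose poly_iter_poly)
qed

lemma pderiv_iter_poly_zero:
  assumes "poly (pderiv (iter_poly n)) z = 0"
  shows "\<exists>j<n. poly (pderiv f) ((poly f ^^ j) z) = 0"
  using assms
proof (induction n)
  case 0
  then show ?case by (simp add: iter_poly_def pderiv_pCons)
next
  case (Suc n)
  then show ?case using pderiv_iter_poly_Suc[of n z] less_Suc_eq by auto
qed

lemma pderiv_iter_poly_critical:
  assumes "poly (pderiv f) z = 0"
  shows "poly (pderiv (iter_poly (Suc n))) z = 0"
proof (induction n)
  case 0
  then show ?case using pderiv_iter_poly_Suc[of 0 z] assms by simp
next
  case (Suc n)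
  then show ?case using pderiv_iter_poly_Suc[of "Suc n" z] by simp
qed

lemma pderiv_iter_poly_nonzero: "pderiv (iter_poly n) \<noteq> 0"
proof
  assume "pderiv (iter_poly n) = 0"
  then have "degree (iter_poly n) = 0" by (simp add: pderiv_eq_0_iff)
  then show False using deg2 by (simp add: degree_iter_poly)
qed

lemma orbit_escapes:
  assumes "G p > 0"
  obtains m where "norm ((poly f ^^ Suc m) p) > c"
proof -
  let ?K = "d * ln (2 * coeff_sum f)"
  obtain m where m: "(ln (max 1 c) + ?K) / G p < 2 ^ m"
    using real_arch_pow[of 2] by auto
  have "(2::real) ^ m \<le> 2 ^ Suc m" by simp
  also have "\<dots> \<le> real d ^ Suc m" using deg2 by (intro power_mono) auto
  finally have "(ln (max 1 c) + ?K) / G p < real d ^ Suc m" using m by linarith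
  then have "ln (max 1 c) + ?K < real d ^ Suc m * G p" using assms by (simp add: pos_divide_less_eq)
  also have "real d ^ Suc m * G p = G ((poly f ^^ Suc m) p)" using G_funpow[of "Suc m" p] by simp
  also have "\<dots> \<le> logp ((poly f ^^ Suc m) p) + ?K"
    using G_approx[OF order_refl, where z = "(poly f ^^ Suc m) p" and n = 0] by simp
  finally have "ln (max 1 c) < ln (max 1 (norm ((poly f ^^ Suc m) p)))" unfolding logp_def by linarith
  then have "max 1 c < max 1 (norm ((poly f ^^ Suc m) p))" by (subst (asm) ln_less_cancel_iff) auto
  then show ?thesis using that[of m] by linarith
qed

text \<open>P is the Boettcher function composed with an iterate f^(m+1) that carries p beyond
  radius 2 R, and a = d^(m+1). The Boettcher function has nonzero derivative there, so P is critical
  exactly where the iterate is, and such points are precritical. Taking at least one iterate puts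
  the critical points of f among them.\<close>

lemma local_coordinate:
  assumes "G p > 0"
  obtains P r a where "r > 0" "a > 0" "P holomorphic_on ball p r"
    "\<And>z. z \<in> ball p r \<Longrightarrow> norm (P z) = exp (a * G z)"
    "\<not> P constant_on ball p r"
    "deriv P p = 0 \<Longrightarrow> \<exists>j. poly (pderiv f) ((poly f ^^ j) p) = 0"
    "poly (pderiv f) p = 0 \<Longrightarrow> deriv P p = 0"
proof -
  obtain m where m: "norm ((poly f ^^ Suc m) p) > 2 * R" by (rule orbit_escapes[OF assms])
  define g where "g = iter_poly (Suc m)"
  have pg: "poly g = poly f ^^ Suc m" by (simp only: g_def poly_iter_poly)
  have "open {z. norm (poly g z) > 2 * R}" by (intro open_Collect_less continuous_intros)
  moreover have "p \<in> {z. norm (poly g z) > 2 * R}" using m by (simp only: pg mem_Collect_eq)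
  ultimately obtain r where r: "r > 0" "ball p r \<subseteq> {z. norm (poly g z) > 2 * R}"
    by (meson openE)
  define P where "P = boettcher \<circ> poly g"
  have R0: "R > 0" using R_ge by simp
  have big: "norm (poly g z) > 2 * R" "norm (poly g z) > R" if "z \<in> ball p r" for z
  proof -
    show "norm (poly g z) > 2 * R" using r that by blast
    then show "norm (poly g z) > R" using R0 by linarith
  qed
  have hol: "P holomorphic_on ball p r"
    unfolding P_def
    by (rule holomorphic_on_compose_gen[OF _ holomorphic_boettcher]) (use big in \<open>auto intro!: holomorphic_intros\<close>)
  have dP: "deriv P z = deriv boettcher (poly g z) * poly (pderiv g) z" if z: "z \<in> ball p r" for z
  proof -
    have "boettcher field_differentiable at (poly g z)"
      using holomorphic_boettcher open_norm_gt big[OF z] by (intro holomorphic_on_imp_differentiable_at) auto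
    moreover have "poly g field_differentiable at z"
      using poly_DERIV field_differentiable_def by blast
    ultimately have "deriv P z = deriv boettcher (poly g z) * deriv (poly g) z"
      unfolding P_def by (intro deriv_chain)
    moreover have "deriv (poly g) z = poly (pderiv g) z" by (rule DERIV_imp_deriv[OF poly_DERIV])
    ultimately show ?thesis by simp
  qed
  have iff: "deriv P z = 0 \<longleftrightarrow> poly (pderiv g) z = 0" if z: "z \<in> ball p r" for z
    using dP[OF z] deriv_boettcher_nonzero[OF big(1)[OF z]] by simp
  have pb: "p \<in> ball p r" using r by simp
  show ?thesis
  proof (rule that[of r "real (d ^ Suc m)" P])
    show "norm (P z) = exp (real (d ^ Suc m) * G z)" if "z \<in> ball p r" for z
      using norm_boettcher[OF big(2)[OF that]] G_funpow[of "Suc m" z] by (simp add: P_def pg del: funpow.simps)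
    show "\<not> P constant_on ball p r"
    proof
      assume "P constant_on ball p r"
      then obtain k where k: "\<And>z. z \<in> ball p r \<Longrightarrow> P z = k" by (auto simp: constant_on_def)
      have "poly (pderiv g) z = 0" if z: "z \<in> ball p r" for z
      proof -
        have "(P has_field_derivative 0) (at z)"
          by (rule has_field_derivative_transform_within_open[of "\<lambda>_. k" 0 z "ball p r"])
             (use z k in auto)
        then show ?thesis using iff[OF z] DERIV_imp_deriv by blast
      qed
      then have "ball p r \<subseteq> {z. poly (pderiv g) z = 0}" by blast
      moreover have "finite {z. poly (pderiv g) z = 0}"
        unfolding g_def by (rule poly_roots_finite[OF pderiv_iter_poly_nonzero])
      ultimately have "finite (ball p r)" by (rule finite_subset)
      then show False using pb finite_imp_not_open[of "ball p r"] by auto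
    qed
    show "\<exists>j. poly (pderiv f) ((poly f ^^ j) p) = 0" if "deriv P p = 0"
      using pderiv_iter_poly_zero[of "Suc m" p] that iff[OF pb] unfolding g_def by blast
    show "deriv P p = 0" if "poly (pderiv f) p = 0"
      using pderiv_iter_poly_critical[OF that, of m] iff[OF pb] unfolding g_def by blast
  qed (use r deg2 hol in auto)
qed

end

section \<open>Sublevel sets of the escape rate\<close>

text \<open>Points of the tree at height t turn out to be classes of this relation
  (\<open>node_eq_iff\<close>). Closed sublevel sets have compact components, so that points joined
  at all levels above t are joined at t.\<close>

definition joined :: "complex poly \<Rightarrow> real \<Rightarrow> complex \<Rightarrow> complex \<Rightarrow> bool" where
  "joined f t = connected_component {z. escape_rate f z \<le> t}"

lemma joined_sym: "joined f t x y \<Longrightarrow> joined f t y x"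
  unfolding joined_def by (rule connected_component_sym)

lemma joined_trans: "joined f t x y \<Longrightarrow> joined f t y z \<Longrightarrow> joined f t x z"
  unfolding joined_def by (rule connected_component_trans)

lemma joined_mono: "joined f s x y \<Longrightarrow> s \<le> t \<Longrightarrow> joined f t x y"
  unfolding joined_def by (rule connected_component_of_subset) auto

lemma joined_refl: "joined f t x x \<longleftrightarrow> escape_rate f x \<le> t"
  unfolding joined_def by simp

lemma joined_le: "joined f t x y \<Longrightarrow> escape_rate f x \<le> t \<and> escape_rate f y \<le> t"
  unfolding joined_def using connected_component_in by fastforce

lemma joinedI:
  "connected T \<Longrightarrow> x \<in> T \<Longrightarrow> y \<in> T \<Longrightarrow> (\<And>z. z \<in> T \<Longrightarrow> escape_rate f z \<le> t) \<Longrightarrow> joined f t x y"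
  unfolding joined_def connected_component_def by blast

lemma joined_set: "{y. joined f t x y} = connected_component_set {z. escape_rate f z \<le> t} x"
  by (simp add: joined_def)

context monic_poly
begin

lemma joined_poly:
  fixes t :: real
  assumes "joined f t x y"
  shows "joined f (d * t) (poly f x) (poly f y)"
proof -
  obtain T where T: "connected T" "T \<subseteq> {z. G z \<le> t}" "x \<in> T" "y \<in> T"
    using assms unfolding joined_def connected_component_def by blast
  show ?thesis
  proof (rule joinedI)
    show "connected (poly f ` T)" using T by (intro connected_continuous_image continuous_intros)
    show "G z \<le> d * t" if "z \<in> poly f ` T" for z
      using that T deg2 by (auto simp: G_poly intro!: mult_left_mono)
  qed (use T in auto)
qed

lemma compact_joined: "compact {y. joined f t x y}"
  unfolding joined_set
  using closed_connected_component[OF closed_le] bounded_subset[OF bounded_le connected_component_subset]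
  by (simp add: compact_eq_bounded_closed)

lemma connected_joined: "connected {y. joined f t x y}"
  unfolding joined_set by (rule connected_connected_component)

text \<open>A decreasing intersection of compact connected sets is connected.\<close>

lemma joined_Inf:
  assumes "\<And>t'. t < t' \<Longrightarrow> joined f t' x y"
  shows "joined f t x y"
proof -
  define S where "S n = {z. joined f (t + 1 / real (Suc n)) x z}" for n
  have conn: "connected (\<Inter> (range S))"
  proof (rule connected_nest)
    show "compact (S n)" "connected (S n)" for n
      unfolding S_def by (rule compact_joined connected_joined)+
    show "S n \<subseteq> S m" if "m \<le> n" for m n
    proof -
      have "t + 1 / real (Suc n) \<le> t + 1 / real (Suc m)" using that by (simp add: frac_le)
      then show ?thesis unfolding S_def using joined_mono by blast
    qed
  qed
  show ?thesis
  proof (rule joinedI[OF conn])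
    have "joined f (t + 1 / real (Suc n)) x y" for n by (rule assms) simp
    then have "y \<in> S n \<and> x \<in> S n" for n
      unfolding S_def mem_Collect_eq using joined_le joined_refl by blast
    then show "y \<in> \<Inter> (range S)" "x \<in> \<Inter> (range S)" by blast+
    fix z assume "z \<in> \<Inter> (range S)"
    then have "joined f (t + 1 / real (Suc n)) x z" for n unfolding S_def by blast
    then have *: "G z \<le> t + 1 / real (Suc n)" for n using joined_le by blast
    show "G z \<le> t"
    proof (rule LIMSEQ_le_const)
      have "(\<lambda>n. t + 1 / real (Suc n)) \<longlonglongrightarrow> t + 0"
        by (intro tendsto_intros) (rule LIMSEQ_Suc[OF lim_1_over_n])
      then show "(\<lambda>n. t + 1 / real (Suc n)) \<longlonglongrightarrow> t" by simp
    qed (use * in blast)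
  qed
qed

text \<open>A path in the open sublevel set has compact image, on which G attains its
  maximum.\<close>

lemma joined_below:
  assumes "connected_component {z. G z < v} x y"
  obtains t where "t < v" "joined f t x y"
proof -
  have "path_component {z. G z < v} x y"
    using assms open_path_connected_component[OF open_lt] by simp
  then obtain g where g: "path g" "path_image g \<subseteq> {z. G z < v}" "pathstart g = x" "pathfinish g = y"
    unfolding path_component_def by blast
  obtain m where m: "m \<in> path_image g" "\<And>z. z \<in> path_image g \<Longrightarrow> G z \<le> G m"
    using continuous_attains_sup[OF compact_path_image[OF g(1)] path_image_nonempty continuous_on_G] by blast
  have "joined f (G m) x y"
  proof (rule joinedI[OF connected_path_image[OF g(1)]])
    show "x \<in> path_image g" "y \<in> path_image g" using g(3,4) pathstart_in_path_image pathfinish_in_path_image by auto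
  qed (rule m(2))
  moreover have "G m < v" using g m by auto
  ultimately show ?thesis using that by blast
qed

text \<open>|P| is an increasing function of G and P is an open map, so values of slightly smaller
  and slightly larger modulus than P p occur near p.\<close>

lemma no_local_extremum:
  assumes p: "G p > 0" and U: "open U" "p \<in> U"
  shows "\<exists>z\<in>U. G z < G p" "\<exists>z\<in>U. G z > G p"
proof -
  obtain P r a where P: "r > 0" "a > 0" "P holomorphic_on ball p r"
    "\<And>z. z \<in> ball p r \<Longrightarrow> norm (P z) = exp (a * G z)" "\<not> P constant_on ball p r"
    by (rule local_coordinate[OF p]) (rule that)
  have "open (P ` (U \<inter> ball p r))"
    using U by (intro open_mapping_thm[OF P(3) open_ball connected_ball _ _ P(5)]) auto
  moreover have "P p \<in> P ` (U \<inter> ball p r)" using U P by auto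
  ultimately obtain e where e: "e > 0" "ball (P p) e \<subseteq> P ` (U \<inter> ball p r)"
    by (meson openE)
  have nP: "norm (P p) = exp (a * G p)" "norm (P p) > 0" using P(1) P(4)[of p] by auto
  \<comment> \<open>Moving P p radially by a factor 1 + s with |s| = \<delta> stays within distance
    e, and the factor stays positive.\<close>
  define \<delta> where "\<delta> = min (1/2) (e / (2 * norm (P p)))"
  have \<delta>: "\<delta> > 0" "\<delta> < 1" "\<delta> * norm (P p) < e"
  proof -
    show "\<delta> > 0" "\<delta> < 1" using e nP by (auto simp: \<delta>_def)
    have "\<delta> * norm (P p) \<le> e / (2 * norm (P p)) * norm (P p)"
      by (intro mult_right_mono) (auto simp: \<delta>_def)
    also have "\<dots> < e" using e nP by simp
    finally show "\<delta> * norm (P p) < e" .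
  qed
  have ex: "\<exists>z\<in>U. norm (P z) = (1 + s) * norm (P p) \<and> norm (P z) = exp (a * G z)" if s: "\<bar>s\<bar> = \<delta>" for s :: real
  proof -
    have "dist (P p) (of_real (1 + s) * P p) = \<delta> * norm (P p)"
    proof -
      have "P p - of_real (1 + s) * P p = of_real (- s) * P p" by (simp add: algebra_simps)
      then show ?thesis using s by (simp add: dist_norm norm_mult)
    qed
    then have "of_real (1 + s) * P p \<in> P ` (U \<inter> ball p r)" using e(2) \<delta>(3) by auto
    then obtain z where z: "z \<in> U" "z \<in> ball p r" "P z = of_real (1 + s) * P p" by auto
    have "norm (P z) = \<bar>1 + s\<bar> * norm (P p)" by (simp only: z(3) norm_mult norm_of_real)
    moreover have "\<bar>1 + s\<bar> = 1 + s" using s \<delta> by linarith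
    ultimately have "norm (P z) = (1 + s) * norm (P p)" by simp
    then show ?thesis using z(1) P(4)[OF z(2)] by (intro bexI[of _ z] conjI)
  qed
  show "\<exists>z\<in>U. G z < G p"
  proof -
    obtain z where z: "z \<in> U" "norm (P z) = (1 + - \<delta>) * norm (P p)" "norm (P z) = exp (a * G z)"
      using ex[of "- \<delta>"] \<delta> by auto
    have "(1 + - \<delta>) * norm (P p) < 1 * norm (P p)" using \<delta> nP by (intro mult_strict_right_mono) auto
    then have "exp (a * G z) < exp (a * G p)" using z nP by simp
    then show ?thesis using P(2) z(1) by auto
  qed
  show "\<exists>z\<in>U. G z > G p"
  proof -
    obtain z where z: "z \<in> U" "norm (P z) = (1 + \<delta>) * norm (P p)" "norm (P z) = exp (a * G z)"
      using ex[of "\<delta>"] \<delta> by auto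
    have "(1 + \<delta>) * norm (P p) > 1 * norm (P p)" using \<delta> nP by (intro mult_strict_right_mono) auto
    then have "exp (a * G z) > exp (a * G p)" using z nP by simp
    then show ?thesis using P(2) z(1) by auto
  qed
qed

text \<open>On the compact component of z the minimum of G is attained, and
  \<open>no_local_extremum\<close> rules out a positive one. Descending from the minimum point needs
  room in the sublevel set, so this is done at levels above t; compactness then gives the level t
  itself.\<close>

lemma joined_zero:
  assumes "G z \<le> t"
  obtains x where "G x = 0" "joined f t z x"
proof -
  have 1: "\<exists>x. G x = 0 \<and> joined f t' z x" if "t < t'" for t'
  proof -
    let ?C = "{y. joined f t' z y}"
    have "z \<in> ?C" using assms that by (simp add: joined_refl)
    then obtain z0 where z0: "joined f t' z z0" "\<And>y. joined f t' z y \<Longrightarrow> G z0 \<le> G y"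
      using continuous_attains_inf[OF compact_joined[of t' z] _ continuous_on_G] by blast
    have "G z0 \<le> t" using z0(2)[of z] assms that by (simp add: joined_refl)
    have "G z0 = 0"
    proof (rule ccontr)
      assume "G z0 \<noteq> 0"
      then have pos: "G z0 > 0" using G_nonneg[of z0] by linarith
      have "z0 \<in> {w. G w < t'}" using \<open>G z0 \<le> t\<close> that by simp
      then obtain e where e: "e > 0" "ball z0 e \<subseteq> {w. G w < t'}" using open_lt by (meson openE)
      then obtain w where w: "w \<in> ball z0 e" "G w < G z0"
        using no_local_extremum(1)[OF pos open_ball, of z0 e] by auto
      have "joined f t' z0 w"
      proof (rule joinedI[OF connected_ball])
        show "G u \<le> t'" if "u \<in> ball z0 e" for u using e(2) that by auto
      qed (use e w in auto)
      then have "joined f t' z w" using z0(1) joined_trans by blast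
      then show False using z0(2) w(2) by force
    qed
    then show ?thesis using z0(1) by blast
  qed
  define S where "S n = {y. joined f (t + 1 / real (Suc n)) z y} \<inter> {y. G y \<le> 0}" for n
  have "\<Inter> (range S) \<noteq> {}"
  proof (rule compact_nest)
    show "compact (S n)" for n
      unfolding S_def by (intro compact_Int_closed compact_joined closed_le)
    show "S n \<noteq> {}" for n
      unfolding S_def using 1[of "t + 1 / real (Suc n)"] by fastforce
    show "S n \<subseteq> S m" if "m \<le> n" for m n
    proof -
      have "t + 1 / real (Suc n) \<le> t + 1 / real (Suc m)" using that by (simp add: frac_le)
      then show ?thesis unfolding S_def using joined_mono by blast
    qed
  qed
  then obtain x where x: "x \<in> S n" for n by blast
  have "joined f t z x"
  proof (rule joined_Inf)
    fix t' assume "t < t'"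
    then obtain n where "inverse (real (Suc n)) < t' - t" using reals_Archimedean[of "t' - t"] by auto
    then have "t + 1 / real (Suc n) \<le> t'" by (simp add: inverse_eq_divide)
    then show "joined f t' z x" using x[of n] unfolding S_def by (auto intro: joined_mono)
  qed
  moreover have "G x = 0" using x[of 0] G_nonneg[of x] by (simp add: S_def)
  ultimately show ?thesis using that by blast
qed

lemma frontier_joined: "frontier {y. joined f t x y} \<subseteq> {y. joined f t x y \<and> G y = t}"
proof
  let ?C = "{y. joined f t x y}"
  fix u assume u: "u \<in> frontier ?C"
  have "closed ?C" using compact_joined compact_imp_closed by blast
  then have uC: "joined f t x u" using u frontier_subset_closed by blast
  have "\<not> G u < t"
  proof
    assume "G u < t"
    then obtain e where e: "e > 0" "ball u e \<subseteq> {w. G w < t}" using open_lt by (metis mem_Collect_eq openE)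
    have "joined f t u w" if "w \<in> ball u e" for w
    proof (rule joinedI[OF connected_ball])
      show "G w \<le> t" if "w \<in> ball u e" for w using e(2) that by auto
    qed (use e that in auto)
    then have "ball u e \<subseteq> ?C" using uC joined_trans by blast
    then have "u \<in> interior ?C" using e(1) mem_interior by blast
    then show False using u by (simp add: frontier_def)
  qed
  then show "u \<in> {y. joined f t x y \<and> G y = t}" using uC joined_le[OF uC] by simp
qed

text \<open>The component has no holes: on a bounded complementary component the maximum principle
  would give G \<le> t, so it would have been part of the component. A connected set in the plane
  with connected complement has connected frontier.\<close>

lemma connected_frontier_joined: "connected (frontier {y. joined f t x y})"
proof (cases "G x \<le> t")
  case False
  then have "{y. joined f t x y} = {}" using joined_le by auto
  then show ?thesis by simp
next
  case True
  let ?C = "{y. joined f t x y}"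
  have cC: "closed ?C" "bounded ?C" using compact_joined compact_imp_closed compact_imp_bounded by blast+
  have fC: "frontier ?C \<subseteq> ?C" using cC frontier_subset_closed by blast
  have unb: "\<not> bounded (connected_component_set (- ?C) a)" if a: "a \<in> - ?C" for a
  proof
    let ?W = "connected_component_set (- ?C) a"
    assume bW: "bounded ?W"
    have aW: "a \<in> ?W" using a by (simp add: connected_component_refl)
    have fW: "frontier ?W \<subseteq> ?C"
      using frontier_of_connected_component_subset[of "- ?C" a] fC by (metis frontier_complement order_trans)
    have leW: "G w \<le> t" if "w \<in> ?W" for w
    proof (rule maximum_principle[OF bW _ that])
      show "G z \<le> t" if "z \<in> frontier ?W" for z using fW that joined_le by blast
    qed
    have "frontier ?W \<noteq> {}" using bW aW by (metis empty_iff frontier_eq_empty not_bounded_UNIV)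
    then obtain b where b: "b \<in> frontier ?W" by blast
    have "joined f t b a"
    proof (rule joinedI)
      show "connected (closure ?W)" by (intro connected_imp_connected_closure connected_connected_component)
      show "b \<in> closure ?W" using b by (simp add: frontier_def)
      show "a \<in> closure ?W" using aW closure_subset by blast
      show "G z \<le> t" if "z \<in> closure ?W" for z
      proof -
        have "closure ?W \<subseteq> {z. G z \<le> t}" using leW closed_le by (intro closure_minimal) auto
        then show ?thesis using that by auto
      qed
    qed
    moreover have "joined f t x b" using b fW by blast
    ultimately show False using a joined_trans by blast
  qed
  have "connected (- ?C)"
    unfolding connected_iff_connected_component
  proof (intro ballI)
    fix a b assume ab: "a \<in> - ?C" "b \<in> - ?C"
    have "connected_component_set (- ?C) a = connected_component_set (- ?C) b"
      using unb ab cC by (intro cobounded_unique_unbounded_component) auto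
    moreover have "b \<in> connected_component_set (- ?C) b"
      using connected_component_refl[OF ab(2)] by simp
    ultimately have "b \<in> connected_component_set (- ?C) a" by (simp only:)
    then show "connected_component (- ?C) a b" by (simp only: mem_Collect_eq)
  qed
  then show ?thesis by (intro connected_frontier_simple connected_joined)
qed

text \<open>A point at height t in the interior would be a local maximum of G. At level 0 the
  argument breaks down, as the filled Julia set may have interior.\<close>

lemma frontier_joined_eq:
  assumes "t > 0"
  shows "frontier {y. joined f t x y} = {y. joined f t x y \<and> G y = t}"
proof (intro equalityI frontier_joined subsetI)
  let ?C = "{y. joined f t x y}"
  fix u assume u: "u \<in> {y. joined f t x y \<and> G y = t}"
  have "u \<notin> interior ?C"
  proof
    assume "u \<in> interior ?C"
    then obtain z where "z \<in> interior ?C" "G z > G u"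
      using no_local_extremum(2)[of u "interior ?C"] u assms by auto
    then show False using u joined_le[of f t x z] interior_subset by force
  qed
  then show "u \<in> frontier ?C" using u closure_subset[of ?C] unfolding frontier_def by blast
qed

text \<open>For t > 0 the part of a sublevel component at height t is its frontier, which is
  connected; at t = 0 the level set and the sublevel set coincide. Thus the tree can be read off
  from sublevel sets alone.\<close>

lemma joined_level:
  assumes "joined f t z w" "G z = t" "G w = t"
  shows "connected_component {u. G u = t} z w"
proof (cases "t > 0")
  case True
  have "connected {y. joined f t z y \<and> G y = t}"
    using connected_frontier_joined[of t z] frontier_joined_eq[OF True] by simp
  moreover have "joined f t z z" using assms by (simp add: joined_refl)
  ultimately show ?thesis using assms unfolding connected_component_def
    by (intro exI[of _ "{y. joined f t z y \<and> G y = t}"]) auto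
next
  case False
  then have "t = 0" using assms(2) G_nonneg[of z] by linarith
  moreover have "{u. G u \<le> 0} = {u. G u = 0}" using G_nonneg by (auto intro: antisym)
  ultimately show ?thesis using assms(1) by (simp add: joined_def)
qed

lemma joined_to_level:
  assumes "G x \<le> t"
  obtains w where "G w = t" "joined f t x w"
proof -
  let ?C = "{y. joined f t x y}"
  have "x \<in> ?C" using assms by (simp add: joined_refl)
  moreover have "bounded ?C" using compact_joined compact_imp_bounded by blast
  ultimately have "frontier ?C \<noteq> {}"
    by (metis empty_iff frontier_eq_empty not_bounded_UNIV)
  then show ?thesis using frontier_joined[of t x] that by blast
qed

text \<open>Away from precritical points P is a local homeomorphism taking {G < G p} to the disc |w|
  < |P p|, and the intersection of this disc with a small disc about P p is convex.\<close>

lemma noncritical_nbhd: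
  assumes p: "G p > 0" and nc: "\<And>j. poly (pderiv f) ((poly f ^^ j) p) \<noteq> 0"
  obtains N where "open N" "p \<in> N" "connected (N \<inter> {z. G z < G p})"
proof -
  obtain P r a where P: "r > 0" "a > 0" "P holomorphic_on ball p r"
    "\<And>z. z \<in> ball p r \<Longrightarrow> norm (P z) = exp (a * G z)"
    "deriv P p = 0 \<Longrightarrow> \<exists>j. poly (pderiv f) ((poly f ^^ j) p) = 0"
    by (rule local_coordinate[OF p]) (rule that)
  have "deriv P p \<noteq> 0" using P(5) nc by blast
  then obtain s where s: "s > 0" "ball p s \<subseteq> ball p r" "inj_on P (ball p s)"
    using has_complex_derivative_locally_injective[OF P(3) _ open_ball, of p] P(1) by auto
  have hs: "P holomorphic_on ball p s" using P(3) s(2) holomorphic_on_subset by blast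
  obtain h where h: "h holomorphic_on (P ` ball p s)" "\<And>z. z \<in> ball p s \<Longrightarrow> h (P z) = z"
    using holomorphic_has_inverse[OF hs open_ball s(3)] by metis
  have "open (P ` ball p s)" by (rule open_mapping_thm3[OF hs open_ball s(3)])
  then obtain e where e: "e > 0" "ball (P p) e \<subseteq> P ` ball p s" using s(1) by (meson openE centre_in_ball imageI)
  define N where "N = {z \<in> ball p s. P z \<in> ball (P p) e}"
  show ?thesis
  proof (rule that[of N])
    show "open N"
      unfolding N_def using continuous_open_preimage[OF holomorphic_on_imp_continuous_on[OF hs] open_ball open_ball, of "P p" e]
      by (simp add: vimage_def Int_def)
    show "p \<in> N" using s e by (simp add: N_def)
    have lt: "G z < G p \<longleftrightarrow> P z \<in> ball 0 (norm (P p))" if "z \<in> ball p s" for z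
      using P(4)[of z] P(4)[of p] that s P(1,2) by auto
    have "N \<inter> {z. G z < G p} = h ` (ball (P p) e \<inter> ball 0 (norm (P p)))"
    proof (intro equalityI subsetI)
      fix z assume z: "z \<in> N \<inter> {z. G z < G p}"
      then have "P z \<in> ball (P p) e \<inter> ball 0 (norm (P p))" "h (P z) = z"
        using lt[of z] h(2)[of z] by (auto simp: N_def)
      then show "z \<in> h ` (ball (P p) e \<inter> ball 0 (norm (P p)))" by (metis imageI)
    next
      fix z assume "z \<in> h ` (ball (P p) e \<inter> ball 0 (norm (P p)))"
      then obtain w where w: "w \<in> ball (P p) e" "w \<in> ball 0 (norm (P p))" "z = h w" by blast
      then obtain z' where z': "z' \<in> ball p s" "w = P z'" using e(2) by blast
      then have "z = z'" using h(2) w(3) by simp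
      then show "z \<in> N \<inter> {z. G z < G p}" using z' w lt[of z'] by (simp add: N_def)
    qed
    moreover have "connected (h ` (ball (P p) e \<inter> ball 0 (norm (P p))))"
    proof (rule connected_continuous_image)
      show "continuous_on (ball (P p) e \<inter> ball 0 (norm (P p))) h"
        using holomorphic_on_imp_continuous_on[OF h(1)] by (rule continuous_on_subset) (use e(2) in blast)
      show "connected (ball (P p) e \<inter> ball 0 (norm (P p)))"
        by (intro convex_connected convex_Int convex_ball)
    qed
    ultimately show "connected (N \<inter> {z. G z < G p})" by simp
  qed
qed

text \<open>Components of \<open>{G < v}\<close> can only merge at a level carrying a precritical point: near any
  other point of the level set, \<open>{G < v}\<close> is locally connected, so the closure of a component of
  \<open>{G < v}\<close> is open in \<open>{G \<le> v}\<close>.\<close>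

lemma joined_noncritical:
  assumes j: "joined f v x y" and lt: "G x < v" "G y < v"
    and nc: "\<And>p j. G p = v \<Longrightarrow> poly (pderiv f) ((poly f ^^ j) p) \<noteq> 0"
  shows "connected_component {z. G z < v} x y"
proof -
  define U where "U = connected_component_set {z. G z < v} x"
  define S where "S = {z. G z \<le> v}"
  have v: "v > 0" using lt(1) G_nonneg[of x] by linarith
  have US: "closure U \<subseteq> S"
    unfolding S_def U_def using connected_component_subset[of "{z. G z < v}" x]
    by (intro closure_minimal closed_le) auto
  have memU: "p \<in> U" if p: "p \<in> closure U" "G p < v" for p
  proof -
    obtain e where e: "e > 0" "ball p e \<subseteq> {z. G z < v}"
      using open_lt p(2) by (metis mem_Collect_eq openE)
    obtain u where u: "u \<in> U" "u \<in> ball p e"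
      using p(1) e(1) by (metis closure_approachable dist_commute mem_ball)
    have "connected_component {z. G z < v} u p"
      unfolding connected_component_def using e u by (intro exI[of _ "ball p e"]) auto
    then show ?thesis using u(1) unfolding U_def by (metis connected_component_trans mem_Collect_eq)
  qed
  have "openin (top_of_set S) (closure U)"
    unfolding openin_euclidean_subtopology_iff
  proof (intro conjI US ballI)
    fix p assume p: "p \<in> closure U"
    have "\<exists>N. open N \<and> p \<in> N \<and> N \<inter> S \<subseteq> closure U"
    proof (cases "G p < v")
      case True
      have "open U" unfolding U_def by (rule open_connected_component[OF open_lt])
      then show ?thesis using memU[OF p True] closure_subset by blast
    next
      case False
      then have Gp: "G p = v" using p US by (auto simp: S_def)
      obtain N where N: "open N" "p \<in> N" "connected (N \<inter> {z. G z < G p})"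
        using noncritical_nbhd[of p] nc[OF Gp] Gp v by metis
      have "N \<inter> U \<noteq> {}" using p N(1,2) by (metis closure_iff_nhds_not_empty inf_commute order_refl)
      then obtain u where u: "u \<in> N" "u \<in> U" by blast
      have uG: "G u < v" using u(2) connected_component_subset unfolding U_def by blast
      have NU: "N \<inter> {z. G z < v} \<subseteq> U"
      proof
        fix w assume "w \<in> N \<inter> {z. G z < v}"
        then have "connected_component {z. G z < v} u w"
          unfolding connected_component_def using N(3) u uG Gp
          by (intro exI[of _ "N \<inter> {z. G z < v}"]) auto
        then show "w \<in> U" using u(2) unfolding U_def by (metis connected_component_trans mem_Collect_eq)
      qed
      have "N \<inter> S \<subseteq> closure U"
      proof
        fix w assume w: "w \<in> N \<inter> S"
        show "w \<in> closure U"
        proof (cases "G w < v")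
          case True
          then show ?thesis using w NU closure_subset by blast
        next
          case False
          then have Gw: "G w = v" using w by (simp add: S_def)
          \<comment> \<open>G has no local minimum at w, so points of \<open>N\<close> below v, all
            of which lie in \<open>U\<close>, approach w.\<close>
          show ?thesis
            unfolding closure_iff_nhds_not_empty
          proof (intro allI impI)
            fix A V assume AV: "V \<subseteq> A" "open V" "w \<in> V"
            have "open (V \<inter> N)" "w \<in> V \<inter> N" using AV w N(1) by auto
            then obtain z where "z \<in> V \<inter> N" "G z < v"
              using no_local_extremum(1)[of w "V \<inter> N"] Gw v by auto
            then show "U \<inter> A \<noteq> {}" using NU AV by blast
          qed
        qed
      qed
      then show ?thesis using N by blast
    qed
    then obtain N where N: "open N" "p \<in> N" "N \<inter> S \<subseteq> closure U" by blast
    then obtain e where "e > 0" "ball p e \<subseteq> N" by (meson openE)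
    then show "\<exists>e>0. \<forall>x'\<in>S. dist x' p < e \<longrightarrow> x' \<in> closure U"
      using N(3) by (intro exI[of _ e]) (auto simp: dist_commute subset_iff)
  qed
  then have op: "openin (top_of_set S) (S \<inter> closure U)" using US by (simp add: inf.absorb2)
  obtain T where T: "connected T" "T \<subseteq> S" "x \<in> T" "y \<in> T"
    using j unfolding joined_def connected_component_def S_def by blast
  have "openin (top_of_set T) (T \<inter> closure U)"
    using op T(2) by (rule openin_subtopology_Int_subset)
  moreover have "closedin (top_of_set T) (T \<inter> closure U)"
    by (intro closedin_closed_Int closed_closure)
  moreover have "x \<in> T \<inter> closure U"
    using T(3) lt(1) closure_subset unfolding U_def by (metis IntI connected_component_refl mem_Collect_eq subsetD)
  ultimately have "T \<subseteq> closure U"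
    using T(1) unfolding connected_clopen by blast
  then have "y \<in> U" using memU T(4) lt(2) by blast
  then show ?thesis by (simp add: U_def)
qed

end

section \<open>Branching at critical levels\<close>

lemma cis_eq_imp_eq:
  assumes "cis a = cis b" "\<bar>a - b\<bar> < 2 * pi"
  shows "a = b"
proof -
  have "cis (a - b) = 1" using assms(1) by (simp add: cis_divide[symmetric])
  then have "cos (a - b) = 1" by (metis cis.sel(1) one_complex.sel(1))
  then obtain n :: int where n: "a - b = real_of_int n * 2 * pi" using cos_one_2pi_int by blast
  have "\<bar>real_of_int n\<bar> * (2 * pi) < 1 * (2 * pi)" using assms(2) n by (simp add: abs_mult)
  then have "\<bar>real_of_int n\<bar> < 1" by (simp only: mult_less_cancel_right_disj) auto
  then have "n = 0" by linarith
  then show ?thesis using n by simp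
qed

lemma of_real_cis_eq:
  assumes "of_real s * cis a = of_real t * cis b" "s > 0" "t \<ge> 0" "\<bar>a - b\<bar> < 2 * pi"
  shows "s = t \<and> a = b"
proof -
  have "norm (of_real s * cis a) = norm (of_real t * cis b)" using assms(1) by (rule arg_cong)
  then have st: "s = t" using assms(2,3) by (simp add: norm_mult)
  then have "cis a = cis b" using assms(1,2) by simp
  then show ?thesis using cis_eq_imp_eq assms(4) st by blast
qed

lemma connected_sector:
  "connected ((\<lambda>(s, \<theta>). of_real s * cis \<theta>) ` ({0<..<e} \<times> {\<alpha><..<\<beta>}))"
  by (intro connected_continuous_image connected_Times connected_Ioo)
     (auto intro!: continuous_intros simp: case_prod_unfold)

lemma polar_in_range:
  assumes "u \<noteq> 0"
  obtains \<theta> where "\<alpha> \<le> \<theta>" "\<theta> < \<alpha> + 2 * pi" "u = of_real (norm u) * cis \<theta>"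
proof -
  define k where "k = \<lceil>(\<alpha> - Arg u) / (2 * pi)\<rceil>"
  define \<theta> where "\<theta> = Arg u + 2 * pi * k"
  have "(\<alpha> - Arg u) / (2 * pi) \<le> k" "k < (\<alpha> - Arg u) / (2 * pi) + 1"
    unfolding k_def by linarith+
  then have "\<alpha> - Arg u \<le> k * (2 * pi)" "k * (2 * pi) < (\<alpha> - Arg u) + 2 * pi"
    by (simp_all add: field_simps)
  then have "\<alpha> \<le> \<theta>" "\<theta> < \<alpha> + 2 * pi" by (simp_all add: \<theta>_def algebra_simps)
  moreover have "u = of_real (norm u) * cis \<theta>"
  proof -
    have "cis \<theta> = cis (Arg u) * cis (2 * pi * k)" by (simp only: \<theta>_def cis_mult)
    also have "cis (2 * pi * k) = 1" by (rule cis_multiple_2pi) simp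
    finally have "cis \<theta> = sgn u" using assms by (simp add: cis_Arg)
    then show ?thesis using assms by (simp add: sgn_div_norm scaleR_conv_of_real)
  qed
  ultimately show ?thesis using that by blast
qed

context monic_poly
begin

text \<open>P / P p = 1 + \<psi>^n, where \<psi> is a local coordinate vanishing at p and n is the
  order of vanishing of P - P p, at least 2 at a critical point. In the coordinate u = \<psi> the
  sign of G - G p is that of |1 + u^n| - 1.\<close>

lemma critical_normal_form:
  assumes p: "G p > 0" and crit: "poly (pderiv f) p = 0"
  obtains n :: nat and e :: real and h :: "complex \<Rightarrow> complex" where "n \<ge> 2" "0 < e" "e < 1" "h 0 = p" "inj_on h (ball 0 e)"
    "continuous_on (ball 0 e) h" "\<And>U. open U \<Longrightarrow> U \<subseteq> ball 0 e \<Longrightarrow> open (h ` U)"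
    "\<And>u. u \<in> ball 0 e \<Longrightarrow> G (h u) < G p \<longleftrightarrow> norm (1 + u ^ n) < 1"
    "\<And>u. u \<in> ball 0 e \<Longrightarrow> G (h u) > G p \<longleftrightarrow> norm (1 + u ^ n) > 1"
proof -
  obtain P r a where P: "r > 0" "a > 0" "P holomorphic_on ball p r"
    "\<And>z. z \<in> ball p r \<Longrightarrow> norm (P z) = exp (a * G z)" "\<not> P constant_on ball p r"
    "poly (pderiv f) p = 0 \<Longrightarrow> deriv P p = 0"
    by (rule local_coordinate[OF p]) (rule that)
  have pr: "p \<in> ball p r" using P(1) by simp
  have Pp: "norm (P p) = exp (a * G p)" using P(4)[OF pr] .
  then have Pp0: "P p \<noteq> 0" by auto
  define Q where "Q z = P z / P p" for z
  have holQ: "Q holomorphic_on ball p r" unfolding Q_def using Pp0 by (intro holomorphic_intros P(3)) auto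
  have Qp: "Q p = 1" using Pp0 by (simp add: Q_def)
  have dQ: "deriv Q p = 0"
  proof -
    have "P field_differentiable at p"
      using P(3) open_ball pr by (rule holomorphic_on_imp_differentiable_at)
    then have "(P has_field_derivative 0) (at p)" using P(6)[OF crit] by (metis field_differentiable_derivI)
    then have "(Q has_field_derivative 0 / P p) (at p)" unfolding Q_def by (rule DERIV_cdivide)
    then show ?thesis using DERIV_imp_deriv by simp
  qed
  have "\<exists>k. 0 < k \<and> (deriv ^^ k) Q p \<noteq> 0"
  proof (rule ccontr)
    assume "\<not> ?thesis"
    then have "Q w = Q p" if "w \<in> ball p r" for w
      using holomorphic_fun_eq_const_on_connected[OF holQ open_ball connected_ball _ pr that] by blast
    then have "P w = P p" if "w \<in> ball p r" for w using that Qp Pp0 by (simp add: Q_def divide_simps)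
    then show False using P(5) unfolding constant_on_def by blast
  qed
  then obtain n where n: "0 < n" "(deriv ^^ n) Q p \<noteq> 0" "\<And>i. \<lbrakk>0 < i; i < n\<rbrakk> \<Longrightarrow> (deriv ^^ i) Q p = 0"
    using exists_least_iff[of "\<lambda>k. 0 < k \<and> (deriv ^^ k) Q p \<noteq> 0"] by blast
  have "n \<noteq> 1" using n(2) dQ by auto
  then have n2: "n \<ge> 2" using n(1) by simp
  obtain g \<rho> where g: "0 < \<rho>" "g holomorphic_on ball p \<rho>"
      "\<And>w. w \<in> ball p \<rho> \<Longrightarrow> Q w - Q p = ((w - p) * g w) ^ n" "\<And>w. w \<in> ball p \<rho> \<Longrightarrow> g w \<noteq> 0"
    by (rule holomorphic_factor_order_of_zero_strong[OF holQ open_ball pr n(1,2)]) (erule (1) n(3), rule that)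
  define \<psi> where "\<psi> w = (w - p) * g w" for w
  have hol\<psi>: "\<psi> holomorphic_on ball p \<rho>" unfolding \<psi>_def by (intro holomorphic_intros g(2))
  have p\<rho>: "p \<in> ball p \<rho>" using g(1) by simp
  have "(g has_field_derivative deriv g p) (at p)"
    using holomorphic_on_imp_differentiable_at[OF g(2) open_ball p\<rho>] by (rule field_differentiable_derivI)
  then have "(\<psi> has_field_derivative g p) (at p)"
    unfolding \<psi>_def by (auto intro!: derivative_eq_intros)
  then have "deriv \<psi> p \<noteq> 0" using DERIV_imp_deriv g(4)[OF p\<rho>] by metis
  then obtain s0 where s0: "s0 > 0" "ball p s0 \<subseteq> ball p \<rho>" "inj_on \<psi> (ball p s0)"
    using has_complex_derivative_locally_injective[OF hol\<psi> p\<rho> open_ball] by blast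
  define s where "s = min s0 r"
  have s: "s > 0" "ball p s \<subseteq> ball p \<rho>" "ball p s \<subseteq> ball p r" "inj_on \<psi> (ball p s)"
  proof -
    show "s > 0" "ball p s \<subseteq> ball p r" using s0 P(1) by (auto simp: s_def)
    have "ball p s \<subseteq> ball p s0" by (auto simp: s_def)
    then show "ball p s \<subseteq> ball p \<rho>" "inj_on \<psi> (ball p s)" using s0 inj_on_subset by blast+
  qed
  have hs: "\<psi> holomorphic_on ball p s" using hol\<psi> s(2) holomorphic_on_subset by blast
  obtain h where h: "h holomorphic_on (\<psi> ` ball p s)" "\<And>z. z \<in> ball p s \<Longrightarrow> h (\<psi> z) = z"
    using holomorphic_has_inverse[OF hs open_ball s(4)] by metis
  have "open (\<psi> ` ball p s)" by (rule open_mapping_thm3[OF hs open_ball s(4)])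
  moreover have "0 \<in> \<psi> ` ball p s" using s(1) by (intro image_eqI[of _ _ p]) (auto simp: \<psi>_def)
  ultimately obtain e0 where e0: "e0 > 0" "ball 0 e0 \<subseteq> \<psi> ` ball p s" by (meson openE)
  \<comment> \<open>Radius below 1 keeps 1 - t^n between 0 and 1 on the rays where u^n =
    -t^n.\<close>
  define e where "e = min e0 (1/2)"
  have e: "0 < e" "e < 1" "ball 0 e \<subseteq> \<psi> ` ball p s" using e0 by (auto simp: e_def)
  have hball: "h u \<in> ball p s \<and> \<psi> (h u) = u" if "u \<in> ball 0 e" for u
  proof -
    have "u \<in> \<psi> ` ball p s" using e(3) that by blast
    then obtain z where "z \<in> ball p s" "u = \<psi> z" by blast
    then show ?thesis using h(2) by simp
  qed
  have val: "exp (a * G (h u)) = norm (1 + u ^ n) * exp (a * G p)" if u: "u \<in> ball 0 e" for u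
  proof -
    have hu: "h u \<in> ball p r" "h u \<in> ball p \<rho>" using hball[OF u] s by blast+
    have "Q (h u) = 1 + u ^ n" using g(3)[OF hu(2)] hball[OF u] Qp by (simp add: \<psi>_def algebra_simps)
    then have "P (h u) = (1 + u ^ n) * P p" using Pp0 by (simp add: Q_def divide_simps)
    then show ?thesis using P(4)[OF hu(1)] Pp by (simp add: norm_mult)
  qed
  show ?thesis
  proof (rule that[of n e h])
    show "h 0 = p" using h(2)[of p] s(1) by (simp add: \<psi>_def)
    show inj: "inj_on h (ball 0 e)" using hball by (metis inj_onI)
    have he: "h holomorphic_on ball 0 e" using h(1) e(3) by (rule holomorphic_on_subset)
    then show "continuous_on (ball 0 e) h" by (rule holomorphic_on_imp_continuous_on)
    show "open (h ` U)" if "open U" "U \<subseteq> ball 0 e" for U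
      using open_mapping_thm3[OF holomorphic_on_subset[OF he that(2)] that(1)] inj inj_on_subset that(2) by blast
    fix u :: complex assume u: "u \<in> ball 0 e"
    have "G (h u) < G p \<longleftrightarrow> exp (a * G (h u)) < 1 * exp (a * G p)" using P(2) by simp
    also have "\<dots> \<longleftrightarrow> norm (1 + u ^ n) < 1" unfolding val[OF u] by (subst mult_less_cancel_right_pos) auto
    finally show "G (h u) < G p \<longleftrightarrow> norm (1 + u ^ n) < 1" .
    have "G (h u) > G p \<longleftrightarrow> exp (a * G (h u)) > 1 * exp (a * G p)" using P(2) by simp
    also have "\<dots> \<longleftrightarrow> norm (1 + u ^ n) > 1" unfolding val[OF u] by (subst mult_less_cancel_right_pos) auto
    finally show "G (h u) > G p \<longleftrightarrow> norm (1 + u ^ n) > 1" .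
  qed (use n2 e in auto)
qed

text \<open>In the coordinate \<open>h\<close> the set \<open>{G < v}\<close> contains two rays ending at the critical point that
  are separated by rays of \<open>{G > v}\<close> on both sides.  If the two rays could be joined inside
  \<open>{G < v}\<close>, they would close up to a Jordan curve in \<open>{G < v} \<union> {p}\<close>, whose interior meets one of the
  two sides, against the maximum principle.\<close>

lemma critical_branching:
  assumes p: "G p > 0" and crit: "poly (pderiv f) p = 0"
  obtains x y where "G x < G p" "G y < G p" "joined f (G p) x y"
    "\<not> connected_component {z. G z < G p} x y"
proof -
  define v where "v = G p"
  obtain n :: nat and e :: real and h :: "complex \<Rightarrow> complex" where n: "n \<ge> 2" and e: "0 < e" "e < 1" and h0: "h 0 = p" and inj: "inj_on h (ball 0 e)"
    and cont: "continuous_on (ball 0 e) h" and op: "\<And>U. open U \<Longrightarrow> U \<subseteq> ball 0 e \<Longrightarrow> open (h ` U)"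
    and lt0: "\<And>u. u \<in> ball 0 e \<Longrightarrow> G (h u) < G p \<longleftrightarrow> norm (1 + u ^ n) < 1"
    and gt0: "\<And>u. u \<in> ball 0 e \<Longrightarrow> G (h u) > G p \<longleftrightarrow> norm (1 + u ^ n) > 1"
    by (rule critical_normal_form[OF p crit]) (rule that)
  note lt = lt0[folded v_def] and gt = gt0[folded v_def]
  \<comment> \<open>In the directions \<pi>/n and 3\<pi>/n the power u^n is negative, so G < v; in
    the direction 2\<pi>/n between them and in the direction 2\<pi> on the other side it is
    positive, so G > v. The four directions are distinct modulo 2\<pi> because n \<ge> 2.\<close>
  define a1 where "a1 = pi / n"
  define a2 where "a2 = 3 * pi / n"
  have n0: "real n \<ge> 2" using n by simp
  have a12: "0 < a1" "a1 < a2" "a2 < 2 * pi" "a2 - a1 \<le> pi" "2 * pi / n = a2 - a1" "2 * pi - a2 > 0"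
    "a1 < 2 * pi / n" "2 * pi / n < a2"
    unfolding a1_def a2_def using n0 by (auto simp: field_simps)
  have ray_lt: "norm (1 + (of_real t * cis a) ^ n) < 1" if "a = a1 \<or> a = a2" "0 < t" "t < 1" for t a
  proof -
    have "cis (real n * a) = -1"
    proof -
      have "real n * a = pi \<or> real n * a = pi + 2 * pi" using that(1) n0 by (auto simp: a1_def a2_def)
      moreover have "cis (pi + 2 * pi) = -1" by (simp add: cis.code complex_eq_iff)
      ultimately show ?thesis by auto
    qed
    moreover have "(of_real t * cis a) ^ n = of_real t ^ n * cis (real n * a)"
      by (simp only: power_mult_distrib Complex.DeMoivre)
    ultimately have "(of_real t * cis a) ^ n = of_real t ^ n * (-1)" by (simp only:)
    then have "(of_real t * cis a) ^ n = - of_real (t ^ n)" by simp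
    then have "norm (1 + (of_real t * cis a) ^ n) = \<bar>1 - t ^ n\<bar>"
      by (metis (no_types, opaque_lifting) norm_of_real of_real_1 of_real_diff uminus_add_conv_diff add.commute diff_conv_add_uminus)
    moreover have "0 < t ^ n" "t ^ n \<le> 1" using that by (auto intro: power_le_one)
    ultimately show ?thesis by simp
  qed
  have ray_gt: "norm (1 + (of_real t * cis a) ^ n) > 1" if "a = 2 * pi / n \<or> a = 2 * pi" "0 < t" for t a
  proof -
    have "cis (real n * a) = 1"
    proof -
      have "real n * a = 2 * pi * 1 \<or> real n * a = 2 * pi * real n" using that(1) n0 by auto
      then show ?thesis using cis_multiple_2pi[of 1] cis_multiple_2pi[of "real n"] by (metis Ints_1 Ints_of_nat)
    qed
    moreover have "(of_real t * cis a) ^ n = of_real t ^ n * cis (real n * a)"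
      by (simp only: power_mult_distrib Complex.DeMoivre)
    ultimately have "(of_real t * cis a) ^ n = of_real t ^ n * 1" by (simp only:)
    then have "(of_real t * cis a) ^ n = of_real (t ^ n)" by simp
    then have "norm (1 + (of_real t * cis a) ^ n) = \<bar>1 + t ^ n\<bar>"
      by (metis norm_of_real of_real_1 of_real_add)
    moreover have "0 < t ^ n" using that by simp
    ultimately show ?thesis by simp
  qed
  have inball: "of_real t * cis a \<in> ball 0 e \<longleftrightarrow> \<bar>t\<bar> < e" for t a
    by (simp add: norm_mult)
  define \<delta> where "\<delta> = e / 2"
  have \<delta>: "0 < \<delta>" "\<delta> < e" using e by (auto simp: \<delta>_def)
  define ray where "ray a t = h (of_real t * cis a)" for a t
  have ray0: "ray a 0 = p" for a by (simp add: ray_def h0)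
  have ray_lt': "G (ray a t) < v" if "a = a1 \<or> a = a2" "0 < t" "t < e" for a t
    unfolding ray_def using lt[of "of_real t * cis a"] inball[of t a] ray_lt[of a t] that e by simp
  have ray_inj: "s = t \<and> a = b" if "ray a s = ray b t" "0 < s" "s < e" "0 \<le> t" "t < e" "\<bar>a - b\<bar> < 2 * pi" for a b s t
  proof -
    have "of_real s * cis a = of_real t * cis b"
      using that(1) inj_onD[OF inj] inball[of s a] inball[of t b] that unfolding ray_def by auto
    then show ?thesis using of_real_cis_eq that by blast
  qed
  have ray_inj_same: "s = t" if "ray a s = ray a t" "0 \<le> s" "s < e" "0 \<le> t" "t < e" for a s t
  proof (cases "s = 0")
    case True
    then show ?thesis using ray_inj[of a t a s] that pi_gt_zero by (cases "t = 0") auto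
  next
    case False
    then show ?thesis using ray_inj[of a s a t] that pi_gt_zero by auto
  qed
  have cont_ray: "continuous_on {0..c} (ray a)" if "c < e" for a c
  proof -
    have "continuous_on {0..c} (h \<circ> (\<lambda>t. of_real t * cis a))"
    proof (rule continuous_on_compose)
      show "continuous_on {0..c} (\<lambda>t. of_real t * cis a)" by (intro continuous_intros)
      show "continuous_on ((\<lambda>t. of_real t * cis a) ` {0..c}) h"
        using cont by (rule continuous_on_subset) (use that in \<open>auto simp: norm_mult\<close>)
    qed
    then show ?thesis by (simp add: ray_def o_def)
  qed
  define x where "x = ray a1 \<delta>"
  define y where "y = ray a2 \<delta>"
  have xy: "G x < v" "G y < v" unfolding x_def y_def using ray_lt' \<delta> by auto
  have jp: "joined f v p (ray a \<delta>)" if "a = a1 \<or> a = a2" for a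
  proof (rule joinedI)
    show "connected (ray a ` {0..\<delta>})" using cont_ray[OF \<delta>(2)] by (intro connected_continuous_image) auto
    show "p \<in> ray a ` {0..\<delta>}" using ray0[of a] \<delta> by (intro image_eqI[of _ _ 0]) auto
    show "ray a \<delta> \<in> ray a ` {0..\<delta>}" using \<delta> by auto
    fix z assume "z \<in> ray a ` {0..\<delta>}"
    then obtain t where t: "0 \<le> t" "t \<le> \<delta>" "z = ray a t" by auto
    then show "G z \<le> v" using ray_lt'[OF that, of t] \<delta> ray0[of a] by (cases "t = 0") (auto simp: v_def)
  qed
  have jxy: "joined f v x y"
    using joined_trans[OF joined_sym[OF jp[of a1]] jp[of a2]] by (simp add: x_def y_def)
  have "\<not> connected_component {z. G z < v} x y"
  proof
    assume "connected_component {z. G z < v} x y"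
    then have "path_component {z. G z < v} x y"
      using open_path_connected_component[OF open_lt] by simp
    then obtain g0 where g0: "path g0" "path_image g0 \<subseteq> {z. G z < v}" "pathstart g0 = x" "pathfinish g0 = y"
      unfolding path_component_def by blast
    have "x \<noteq> y"
    proof
      assume "x = y"
      then have "a1 = a2" using ray_inj[of a1 \<delta> a2 \<delta>] \<delta> a12 by (simp add: x_def y_def)
      then show False using a12 by simp
    qed
    then obtain \<gamma> where \<gamma>: "arc \<gamma>" "path_image \<gamma> \<subseteq> path_image g0" "pathstart \<gamma> = x" "pathfinish \<gamma> = y"
      using path_contains_arc[OF g0(1,3,4)] by blast
    define A where "A = path_image \<gamma>"
    have A: "compact A" "A \<subseteq> {z. G z < v}" "x \<in> A" "y \<in> A"
      using \<gamma> g0 compact_arc_image unfolding A_def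
      by (auto simp: compact_arc_image intro: pathstart_in_path_image pathfinish_in_path_image)
    have pA: "p \<notin> A" using A(2) by (auto simp: v_def)
    \<comment> \<open>The arc may cross the rays. Each ray is cut at its first point on the arc,
      counted from p, so that the two cut rays and the piece of arc between the cuts form a curve
      without self-intersections.\<close>
    have first: "\<exists>r. 0 < r \<and> r \<le> \<delta> \<and> ray a r \<in> A \<and> (\<forall>t. 0 \<le> t \<and> t < r \<longrightarrow> ray a t \<notin> A)"
      if "ray a \<delta> \<in> A" for a
    proof -
      let ?T = "{0..\<delta>} \<inter> ray a -` A"
      have "closed ?T"
        using continuous_closed_preimage[OF cont_ray[OF \<delta>(2)] closed_atLeastAtMost compact_imp_closed[OF A(1)]] .
      then have "compact ?T"
        by (metis bounded_Int bounded_closed_interval compact_eq_bounded_closed)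
      moreover have "\<delta> \<in> ?T" using that \<delta> by simp
      then have "?T \<noteq> {}" by blast
      ultimately obtain r where r: "r \<in> ?T" "\<And>t. t \<in> ?T \<Longrightarrow> r \<le> t"
        using compact_attains_inf[of ?T] by blast
      have "r \<noteq> 0" using r(1) pA ray0[of a] by auto
      moreover have "ray a t \<notin> A" if "0 \<le> t" "t < r" for t
        using r(2)[of t] that r(1) by auto
      ultimately show ?thesis using r(1) by (intro exI[of _ r]) auto
    qed
    obtain r1 where r1: "0 < r1" "r1 \<le> \<delta>" "ray a1 r1 \<in> A" "\<And>t. \<lbrakk>0 \<le> t; t < r1\<rbrakk> \<Longrightarrow> ray a1 t \<notin> A"
      using first[of a1] A(3) unfolding x_def by blast
    obtain r2 where r2: "0 < r2" "r2 \<le> \<delta>" "ray a2 r2 \<in> A" "\<And>t. \<lbrakk>0 \<le> t; t < r2\<rbrakk> \<Longrightarrow> ray a2 t \<notin> A"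
      using first[of a2] A(4) unfolding y_def by blast
    obtain \<tau>1 \<tau>2 where \<tau>: "\<tau>1 \<in> {0..1}" "\<gamma> \<tau>1 = ray a1 r1" "\<tau>2 \<in> {0..1}" "\<gamma> \<tau>2 = ray a2 r2"
      using r1(3) r2(3) unfolding A_def path_image_def by (metis imageE)
    have ne: "ray a1 r1 \<noteq> ray a2 r2"
      using ray_inj[of a1 r1 a2 r2] r1 r2 \<delta> a12 by auto
    define \<beta> where "\<beta> = subpath \<tau>1 \<tau>2 \<gamma>"
    have \<beta>: "arc \<beta>" "pathstart \<beta> = ray a1 r1" "pathfinish \<beta> = ray a2 r2" "path_image \<beta> \<subseteq> A"
    proof -
      have "\<tau>1 \<noteq> \<tau>2" using \<tau> ne by auto
      then show "arc \<beta>" unfolding \<beta>_def using \<gamma>(1) \<tau> by (intro arc_subpath_arc)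
      show "pathstart \<beta> = ray a1 r1" "pathfinish \<beta> = ray a2 r2" using \<tau> by (auto simp: \<beta>_def)
      show "path_image \<beta> \<subseteq> A" unfolding \<beta>_def A_def using \<tau> by (intro path_image_subpath_subset) auto
    qed
    define \<alpha> where "\<alpha> a r s = ray a (s * r)" for a r s
    have \<alpha>: "arc (\<alpha> a r)" "path_image (\<alpha> a r) = ray a ` {0..r}" if r: "0 < r" "r \<le> \<delta>" for a r
    proof -
      have im: "(\<lambda>s. s * r) ` {0..1} = {0..r}"
      proof (intro equalityI subsetI)
        fix t assume "t \<in> {0..r}"
        then show "t \<in> (\<lambda>s. s * r) ` {0..1}" using r by (intro image_eqI[of _ _ "t / r"]) auto
      qed (use r in \<open>auto simp: mult_left_le_one_le\<close>)
      show "path_image (\<alpha> a r) = ray a ` {0..r}"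
        unfolding path_image_def im[symmetric] by (simp add: \<alpha>_def image_image)
      have "continuous_on {0..1} (ray a \<circ> (\<lambda>s. s * r))"
        using cont_ray[of r a] r \<delta> by (intro continuous_on_compose continuous_intros) (simp add: im)
      then have "path (\<alpha> a r)" by (simp add: path_def \<alpha>_def o_def)
      moreover have "inj_on (\<alpha> a r) {0..1}"
      proof (rule inj_onI)
        fix s t assume st: "s \<in> {0..1}" "t \<in> {0..1}" "\<alpha> a r s = \<alpha> a r t"
        have "s * r \<le> 1 * r" "t * r \<le> 1 * r" using st r by (auto intro!: mult_right_mono)
        moreover have "0 \<le> s * r" "0 \<le> t * r" using st r by auto
        ultimately have b: "0 \<le> s * r" "s * r < e" "0 \<le> t * r" "t * r < e" using r \<delta> by linarith+
        have "s * r = t * r"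
          using ray_inj_same[of a "s * r" "t * r"] st(3) b unfolding \<alpha>_def by blast
        then show "s = t" using r by simp
      qed
      ultimately show "arc (\<alpha> a r)" by (simp add: arc_def)
    qed
    have \<alpha>_ends: "pathstart (\<alpha> a r) = p" "pathfinish (\<alpha> a r) = ray a r" for a r
      by (auto simp: pathstart_def pathfinish_def \<alpha>_def ray0)
    define J where "J = \<beta> +++ (reversepath (\<alpha> a2 r2) +++ \<alpha> a1 r1)"
    have arc2: "arc (reversepath (\<alpha> a2 r2) +++ \<alpha> a1 r1)"
    proof (rule arc_join)
      show "arc (reversepath (\<alpha> a2 r2))" "arc (\<alpha> a1 r1)" using \<alpha> r1 r2 by (auto simp: arc_reversepath)
      show "path_image (reversepath (\<alpha> a2 r2)) \<inter> path_image (\<alpha> a1 r1) \<subseteq> {pathstart (\<alpha> a1 r1)}"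
      proof
        fix z assume "z \<in> path_image (reversepath (\<alpha> a2 r2)) \<inter> path_image (\<alpha> a1 r1)"
        then have "z \<in> ray a2 ` {0..r2}" "z \<in> ray a1 ` {0..r1}" using \<alpha>(2) r1 r2 by auto
        then obtain s t where st: "0 \<le> s" "s \<le> r2" "z = ray a2 s" "0 \<le> t" "t \<le> r1" "z = ray a1 t" by auto
        have "\<not> 0 < t"
        proof
          assume "0 < t"
          moreover have "t < e" "s < e" "\<bar>a1 - a2\<bar> < 2 * pi" using st r1(2) r2(2) \<delta> a12 by linarith+
          ultimately have "a1 = a2" using ray_inj[of a1 t a2 s] st by simp
          then show False using a12 by simp
        qed
        then have "t = 0" using st by simp
        then have "z = p" using st(6) ray0[of a1] by simp
        then show "z \<in> {pathstart (\<alpha> a1 r1)}" by (simp add: \<alpha>_ends)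
      qed
    qed (simp add: \<alpha>_ends)
    have pi2: "path_image (reversepath (\<alpha> a2 r2) +++ \<alpha> a1 r1) = ray a2 ` {0..r2} \<union> ray a1 ` {0..r1}"
      using \<alpha>(2) r1 r2 by (simp add: path_image_join \<alpha>_ends)
    have simpJ: "simple_path J"
      unfolding J_def
    proof (rule simple_path_join_loop[OF \<beta>(1) arc2])
      show "path_image \<beta> \<inter> path_image (reversepath (\<alpha> a2 r2) +++ \<alpha> a1 r1)
        \<subseteq> {pathstart \<beta>, pathstart (reversepath (\<alpha> a2 r2) +++ \<alpha> a1 r1)}"
      proof
        fix z assume z: "z \<in> path_image \<beta> \<inter> path_image (reversepath (\<alpha> a2 r2) +++ \<alpha> a1 r1)"
        then have zA: "z \<in> A" using \<beta>(4) by blast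
        have "z \<in> ray a2 ` {0..r2} \<or> z \<in> ray a1 ` {0..r1}" using z unfolding pi2 by blast
        then have "z = ray a2 r2 \<or> z = ray a1 r1"
        proof
          assume "z \<in> ray a2 ` {0..r2}"
          then obtain t where "0 \<le> t" "t \<le> r2" "z = ray a2 t" by auto
          then show ?thesis using r2(4)[of t] zA by force
        next
          assume "z \<in> ray a1 ` {0..r1}"
          then obtain t where "0 \<le> t" "t \<le> r1" "z = ray a1 t" by auto
          then show ?thesis using r1(4)[of t] zA by force
        qed
        then show "z \<in> {pathstart \<beta>, pathstart (reversepath (\<alpha> a2 r2) +++ \<alpha> a1 r1)}"
          by (auto simp: \<beta>(2) \<alpha>_ends)
      qed
    qed (auto simp: \<beta> \<alpha>_ends)
    have piJ: "path_image J = path_image \<beta> \<union> ray a2 ` {0..r2} \<union> ray a1 ` {0..r1}"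
      unfolding J_def by (subst path_image_join) (auto simp: \<beta> \<alpha>_ends pi2)
    have loop: "pathfinish J = pathstart J" by (simp add: J_def \<beta> \<alpha>_ends)
    define I where "I = inside (path_image J)"
    have I: "open I" "bounded I" "frontier I = path_image J"
      using Jordan_inside_outside[OF simpJ loop] by (auto simp: I_def)
    have IJ: "I \<inter> path_image J = {}" unfolding I_def by (rule inside_no_overlap)
    \<comment> \<open>On the curve G \<le> v, with equality only at p, so the maximum principle
      bounds G inside.\<close>
    have GI: "G z \<le> v" if "z \<in> I" for z
    proof (rule maximum_principle[OF I(2) _ that])
      fix w assume "w \<in> frontier I"
      then have "w \<in> A \<or> w \<in> ray a2 ` {0..r2} \<or> w \<in> ray a1 ` {0..r1}" using I(3) piJ \<beta>(4) by blast
      moreover have "G w \<le> v" if w: "w \<in> ray a ` {0..r}" and a: "a = a1 \<or> a = a2" and r: "r \<le> \<delta>" for a r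
      proof -
        obtain t where t: "0 \<le> t" "t \<le> r" "w = ray a t" using w by auto
        show ?thesis
        proof (cases "t = 0")
          case True
          then show ?thesis using t ray0[of a] by (simp add: v_def)
        next
          case False
          then show ?thesis using ray_lt'[OF a, of t] t r \<delta> by auto
        qed
      qed
      moreover have "G w \<le> v" if "w \<in> A" using A(2) that by auto
      ultimately show "G w \<le> v" using r1(2) r2(2) by blast
    qed
    \<comment> \<open>As p is not on the compact arc, only the two rays of the curve are visible
      near p.\<close>
    have "open (ball 0 e \<inter> h -` (- A))"
      using continuous_open_preimage[OF cont open_ball] compact_imp_closed[OF A(1)] by (simp add: open_Compl)
    moreover have "0 \<in> ball 0 e \<inter> h -` (- A)" using e pA h0 by simp
    ultimately obtain \<eta>0 where \<eta>0: "\<eta>0 > 0" "ball 0 \<eta>0 \<subseteq> ball 0 e \<inter> h -` (- A)" by (meson openE)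
    define \<eta> where "\<eta> = min \<eta>0 e"
    have \<eta>: "\<eta> > 0" "\<eta> \<le> e" "\<And>u. u \<in> ball 0 \<eta> \<Longrightarrow> h u \<notin> A"
      using \<eta>0 e by (auto simp: \<eta>_def)
    have sub\<eta>: "ball 0 \<eta> \<subseteq> ball (0 :: complex) e" using \<eta>(2) by auto
    have "open (h ` ball 0 \<eta>)" using op[OF open_ball sub\<eta>] .
    moreover have "p \<in> h ` ball 0 \<eta>" using h0 \<eta>(1) by (intro image_eqI[of _ _ 0]) auto
    \<comment> \<open>The curve is the whole frontier of its interior and passes through p, so
      interior points occur arbitrarily close to p.\<close>
    moreover have "p \<in> closure I"
    proof -
      have "p \<in> ray a1 ` {0..r1}" using ray0[of a1] r1 by (intro image_eqI[of _ _ 0]) auto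
      then have "p \<in> frontier I" using I(3) piJ by blast
      then show ?thesis by (simp add: frontier_def)
    qed
    ultimately have "I \<inter> h ` ball 0 \<eta> \<noteq> {}" by (metis closure_iff_nhds_not_empty order_refl)
    then obtain u where u: "u \<in> ball 0 \<eta>" "h u \<in> I" by blast
    have "u \<noteq> 0"
    proof
      assume "u = 0"
      then have "h u \<in> path_image J" using piJ r1 ray0[of a1] h0 by (auto intro!: image_eqI[of _ _ 0])
      then show False using IJ u by blast
    qed
    then obtain \<theta> where \<theta>: "a1 \<le> \<theta>" "\<theta> < a1 + 2 * pi" "u = of_real (norm u) * cis \<theta>"
      by (rule polar_in_range)
    have nu: "0 < norm u" "norm u < \<eta>" using u \<open>u \<noteq> 0\<close> by auto
    have hu: "h u = ray \<theta> (norm u)" unfolding ray_def using \<theta>(3) by simp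
    have not_ray: "ray \<theta>' t \<notin> path_image J"
      if t: "0 < t" "t < \<eta>" and ang: "a1 < \<theta>'" "\<theta>' < a1 + 2 * pi" "\<theta>' \<noteq> a2" for \<theta>' t
    proof
      assume "ray \<theta>' t \<in> path_image J"
      moreover have "ray \<theta>' t \<notin> A"
        using \<eta>(3)[of "of_real t * cis \<theta>'"] t unfolding ray_def by (simp add: norm_mult)
      ultimately have "ray \<theta>' t \<in> ray a2 ` {0..r2} \<or> ray \<theta>' t \<in> ray a1 ` {0..r1}"
        using piJ \<beta>(4) by blast
      moreover have ex: "\<exists>s. 0 \<le> s \<and> s \<le> \<delta> \<and> ray \<theta>' t = ray a s"
        if "ray \<theta>' t \<in> ray a ` {0..r}" "r \<le> \<delta>" for a r
        using that by force
      ultimately obtain a s where s: "a = a1 \<or> a = a2" "0 \<le> s" "s \<le> \<delta>" "ray \<theta>' t = ray a s"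
        using ex[OF _ r1(2), of a1] ex[OF _ r2(2), of a2] by metis
      have "\<bar>\<theta>' - a\<bar> < 2 * pi" using s(1) ang a12 by auto
      moreover have "t < e" "s < e" using s t \<eta>(2) \<delta> by linarith+
      ultimately have "\<theta>' = a" using ray_inj[of \<theta>' t a s] s t by blast
      then show False using s(1) ang by auto
    qed
    \<comment> \<open>An open sector between the two rays misses the curve, so it lies inside as
      soon as one of its points does; but it contains the direction \<open>c\<close>, along which G
      > v.\<close>
    have side: False if ang: "lo < \<theta>" "\<theta> < hi" "a1 \<le> lo" "hi \<le> a1 + 2 * pi" "hi \<le> a2 \<or> a2 \<le> lo"
      and peak: "lo < c" "c < hi" "c = 2 * pi / n \<or> c = 2 * pi" for lo hi c
    proof -
      define \<Sigma> where "\<Sigma> = h ` ((\<lambda>(s, \<theta>). of_real s * cis \<theta>) ` ({0<..<\<eta>} \<times> {lo<..<hi}))"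
      have "connected \<Sigma>"
        unfolding \<Sigma>_def
      proof (rule connected_continuous_image[OF _ connected_sector])
        show "continuous_on ((\<lambda>(s, \<theta>). of_real s * cis \<theta>) ` ({0<..<\<eta>} \<times> {lo<..<hi})) h"
          using cont by (rule continuous_on_subset) (use \<eta>(2) in \<open>auto simp: norm_mult\<close>)
      qed
      have mem: "ray \<theta>' t \<in> \<Sigma>" if "0 < t" "t < \<eta>" "lo < \<theta>'" "\<theta>' < hi" for \<theta>' t
        unfolding \<Sigma>_def ray_def using that by (intro imageI image_eqI[of _ _ "(t, \<theta>')"]) auto
      have disj: "\<Sigma> \<inter> path_image J = {}"
      proof -
        have "z \<notin> path_image J" if z: "z \<in> \<Sigma>" for z
        proof -
          obtain t \<theta>' where t: "0 < t" "t < \<eta>" "lo < \<theta>'" "\<theta>' < hi" "z = ray \<theta>' t"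
            using z unfolding \<Sigma>_def ray_def by auto
          then show ?thesis using not_ray[of t \<theta>'] ang(3-5) by auto
        qed
        then show ?thesis by blast
      qed
      have "\<Sigma> \<subseteq> I"
      proof (rule ccontr)
        assume "\<not> \<Sigma> \<subseteq> I"
        then have "\<Sigma> - I \<noteq> {}" by blast
        moreover have "\<Sigma> \<inter> I \<noteq> {}" using mem[of "norm u" \<theta>] nu ang u(2) hu by auto
        ultimately have "\<Sigma> \<inter> frontier I \<noteq> {}" using \<open>connected \<Sigma>\<close> by (intro connected_Int_frontier)
        then show False using disj I(3) by simp
      qed
      moreover have "ray c (\<eta> / 2) \<in> \<Sigma>" using mem[of "\<eta> / 2" c] \<eta>(1) peak by auto
      ultimately have "G (ray c (\<eta> / 2)) \<le> v" using GI by blast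
      moreover have "G (ray c (\<eta> / 2)) > v"
        unfolding ray_def
        using gt[of "of_real (\<eta> / 2) * cis c"] inball[of "\<eta> / 2" c] ray_gt[OF peak(3), of "\<eta> / 2"] \<eta>(1,2) by simp
      ultimately show False by linarith
    qed
    consider "a1 < \<theta>" "\<theta> < a2" | "a2 < \<theta>" "\<theta> < a1 + 2 * pi" | "\<theta> = a1" | "\<theta> = a2"
      using \<theta> by linarith
    then show False
    proof cases
      case 1
      then show False using side[of a1 a2 "2 * pi / n"] a12 by linarith
    next
      case 2
      then show False using side[of a2 "a1 + 2 * pi" "2 * pi"] a12 by linarith
    next
      \<comment> \<open>In this direction the point is on the curve itself: otherwise the cut at
        \<open>r1\<close> would be nearer to p than \<eta>, where the ray avoids the arc.\<close>
      case 3
      then have "ray a1 (norm u) \<in> I" using hu u(2) by simp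
      moreover have "ray a1 (norm u) \<in> path_image J"
      proof (cases "norm u \<le> r1")
        case True
        then show ?thesis using piJ nu by auto
      next
        case False
        then have "r1 < \<eta>" using nu by simp
        then have "ray a1 r1 \<notin> A" using \<eta>(3)[of "of_real r1 * cis a1"] r1(1) unfolding ray_def by (simp add: norm_mult)
        then show ?thesis using r1(3) by simp
      qed
      ultimately show False using IJ by blast
    next
      case 4
      then have "ray a2 (norm u) \<in> I" using hu u(2) by simp
      moreover have "ray a2 (norm u) \<in> path_image J"
      proof (cases "norm u \<le> r2")
        case True
        then show ?thesis using piJ nu by auto
      next
        case False
        then have "r2 < \<eta>" using nu by simp
        then have "ray a2 r2 \<notin> A" using \<eta>(3)[of "of_real r2 * cis a2"] r2(1) unfolding ray_def by (simp add: norm_mult)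
        then show ?thesis using r2(3) by simp
      qed
      ultimately show False using IJ by blast
    qed
  qed
  then show ?thesis using that[of x y] xy jxy unfolding v_def by blast
qed

end

section \<open>Trees\<close>

text \<open>A tree point of height t is addressed by a point x of the filled Julia set below it; the
  address is unique up to being joined at level t.\<close>

definition node :: "complex poly \<Rightarrow> real \<Rightarrow> complex \<Rightarrow> complex set" where
  "node f t x = {z. escape_rate f z = t \<and> joined f t x z}"

text \<open>In terms of the tree these are the positive halves of distances between points at height
  0 (\<open>branch_heights_eq\<close>); the form chosen here can be tested directly on sublevel
  sets.\<close>

definition branch_heights :: "complex poly \<Rightarrow> real set" where
  "branch_heights f = {v. v > 0 \<and> (\<exists>x y. escape_rate f x = 0 \<and> escape_rate f y = 0 \<and>
      (\<forall>s\<ge>0. joined f s x y \<longleftrightarrow> v \<le> s))}"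

context monic_poly
begin

section \<open>Tree points as pairs of a height and a filled Julia point\<close>

lemma G_poly_0: "G x = 0 \<Longrightarrow> G (poly f x) = 0"
  by (simp add: G_poly)

lemma node_nonempty:
  assumes "G x \<le> t"
  shows "node f t x \<noteq> {}"
  using joined_to_level[OF assms] by (auto simp: node_def)

lemma node_eq_component:
  assumes "w \<in> node f t x"
  shows "node f t x = connected_component_set {z. G z = t} w"
proof (intro equalityI subsetI)
  have w: "G w = t" "joined f t x w" using assms by (auto simp: node_def)
  fix z
  {
    assume "z \<in> node f t x"
    then have z: "G z = t" "joined f t x z" by (auto simp: node_def)
    have "joined f t w z" using joined_trans[OF joined_sym[OF w(2)] z(2)] .
    then show "z \<in> connected_component_set {z. G z = t} w" using joined_level w z by simp
  next
    assume "z \<in> connected_component_set {z. G z = t} w"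
    then have c: "connected_component {z. G z = t} w z" by simp
    then have "G z = t" using connected_component_in by fastforce
    moreover have "joined f t w z"
      unfolding joined_def using c by (rule connected_component_of_subset) auto
    ultimately show "z \<in> node f t x" using joined_trans[OF w(2)] by (simp add: node_def)
  }
qed

text \<open>No tree point is missed because \<open>joined_zero\<close> finds a point of the filled
  Julia set in every component of a sublevel set.\<close>

lemma tree_points_eq: "tree_points f = {node f t x |t x. 0 \<le> t \<and> G x = 0}"
proof (intro equalityI subsetI)
  fix C assume "C \<in> tree_points f"
  then obtain s w where w: "G w = s" "C = connected_component_set {z. G z = s} w"
    by (auto simp: tree_points_def components_def)
  obtain x where x: "G x = 0" "joined f s w x" using joined_zero[of w s] w(1) by auto
  have "w \<in> node f s x" using w(1) joined_sym[OF x(2)] by (simp add: node_def)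
  then have "C = node f s x" using node_eq_component w(2) by simp
  then show "C \<in> {node f t x |t x. 0 \<le> t \<and> G x = 0}" using x(1) w(1) G_nonneg[of w] by blast
next
  fix C assume "C \<in> {node f t x |t x. 0 \<le> t \<and> G x = 0}"
  then obtain t x where tx: "C = node f t x" "0 \<le> t" "G x = 0" by blast
  then obtain w where w: "w \<in> node f t x" using node_nonempty[of x t] by auto
  then have "G w = t" by (simp add: node_def)
  then show "C \<in> tree_points f"
    unfolding tree_points_def components_def using node_eq_component[OF w] tx(1) by auto
qed

lemma node_eq_iff:
  assumes "G x = 0" "0 \<le> s"
  shows "node f s x = node f t y \<longleftrightarrow> s = t \<and> joined f s x y"
proof
  assume eq: "node f s x = node f t y"
  obtain w where "w \<in> node f s x" using node_nonempty[of x s] assms by auto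
  moreover from this have "w \<in> node f t y" using eq by simp
  ultimately show "s = t \<and> joined f s x y"
    unfolding node_def using joined_sym joined_trans by blast
next
  assume *: "s = t \<and> joined f s x y"
  have "joined f t x z \<longleftrightarrow> joined f t y z" for z
    using * joined_sym joined_trans by blast
  then show "node f s x = node f t y" using * by (simp add: node_def)
qed

lemma tree_height_node:
  assumes "G x = 0" "0 \<le> t"
  shows "tree_height f (node f t x) = t"
proof -
  have "G ` node f t x = {t}" using node_nonempty[of x t] assms by (auto simp: node_def)
  then show ?thesis by (simp add: tree_height_def)
qed

lemma tree_map_node:
  fixes t :: real
  assumes "G x = 0" "0 \<le> t"
  shows "tree_map f (node f t x) = node f (d * t) (poly f x)"
  unfolding tree_map_def
proof (rule the_equality)
  have dt: "0 \<le> d * t" using assms by simp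
  have sub: "poly f ` node f t x \<subseteq> node f (d * t) (poly f x)"
    unfolding node_def using joined_poly G_poly by auto
  then show "node f (d * t) (poly f x) \<in> tree_points f \<and> poly f ` node f t x \<subseteq> node f (d * t) (poly f x)"
    using tree_points_eq dt G_poly_0[OF assms(1)] by blast
  fix y assume y: "y \<in> tree_points f \<and> poly f ` node f t x \<subseteq> y"
  then obtain s u where su: "y = node f s u" "0 \<le> s" "G u = 0" using tree_points_eq by auto
  obtain w where "w \<in> node f t x" using node_nonempty[of x t] assms by auto
  then have "poly f w \<in> node f s u" "poly f w \<in> node f (d * t) (poly f x)" using y su(1) sub by blast+
  then have fw: "G (poly f w) = s" "joined f s u (poly f w)" "G (poly f w) = d * t"
      "joined f (d * t) (poly f x) (poly f w)"
    by (simp_all add: node_def)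
  then have "s = d * t" by simp
  moreover from this have "joined f s u (poly f x)"
    using joined_trans[OF fw(2) joined_sym[of f s "poly f x"]] fw(4) by simp
  ultimately show "y = node f (d * t) (poly f x)" using node_eq_iff[OF su(3,2)] su(1) by blast
qed

lemma dyn_tree_points:
  assumes "X \<in> tree_points f"
  shows "tree_map f X \<in> tree_points f"
proof -
  obtain t x where tx: "X = node f t x" "0 \<le> t" "G x = 0" using assms tree_points_eq by auto
  then have "0 \<le> d * t" "G (poly f x) = 0" using G_poly_0 by auto
  then show ?thesis using tree_map_node[OF tx(3,2)] tx(1) tree_points_eq by blast
qed

lemma tree_map_funpow_node:
  fixes t :: real
  assumes "G x = 0" "0 \<le> t"
  shows "(tree_map f ^^ n) (node f t x) = node f (d ^ n * t) ((poly f ^^ n) x)"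
proof (induction n)
  case (Suc n)
  have "G ((poly f ^^ n) x) = 0" using assms by (simp add: G_funpow)
  then show ?case using tree_map_node[of "(poly f ^^ n) x" "d ^ n * t"] Suc assms by (simp add: mult.assoc)
qed simp

lemma node_in_component_iff:
  assumes "G x = 0" "0 \<le> t" "G y = 0" "0 \<le> u"
  shows "(\<exists>C\<in>components {z. G z \<le> s}. node f t x \<subseteq> C \<and> node f u y \<subseteq> C) \<longleftrightarrow>
         max t u \<le> s \<and> joined f s x y"
proof
  assume "\<exists>C\<in>components {z. G z \<le> s}. node f t x \<subseteq> C \<and> node f u y \<subseteq> C"
  then obtain C where C: "C \<in> components {z. G z \<le> s}" "node f t x \<subseteq> C" "node f u y \<subseteq> C" by blast
  obtain v w where vw: "v \<in> node f t x" "w \<in> node f u y"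
    using node_nonempty[of x t] node_nonempty[of y u] assms by auto
  have CS: "connected C" "C \<subseteq> {z. G z \<le> s}"
    using C(1) in_components_connected in_components_subset by blast+
  have "joined f s v w" by (rule joinedI[OF CS(1)]) (use vw C CS in auto)
  have le: "t \<le> s" "u \<le> s" using vw C CS by (auto simp: node_def)
  have "joined f t x v" "joined f u y w" using vw by (auto simp: node_def)
  then have "joined f s x v" "joined f s w y"
    using joined_mono[OF _ le(1)] joined_mono[OF joined_sym le(2)] by blast+
  then have "joined f s x y"
    using joined_trans[OF joined_trans[OF _ \<open>joined f s v w\<close>]] by blast
  then show "max t u \<le> s \<and> joined f s x y" using le by simp
next
  assume *: "max t u \<le> s \<and> joined f s x y"
  let ?C = "connected_component_set {z. G z \<le> s} x"
  have "?C \<in> components {z. G z \<le> s}" using * assms by (auto simp: components_def)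
  moreover have "z \<in> ?C" if "z \<in> node f t x" for z
  proof -
    have "joined f t x z" using that by (simp add: node_def)
    then have "joined f s x z" by (rule joined_mono) (use * in simp)
    then show ?thesis by (simp add: joined_def)
  qed
  moreover have "z \<in> ?C" if "z \<in> node f u y" for z
  proof -
    have "joined f u y z" using that by (simp add: node_def)
    then have "joined f s y z" by (rule joined_mono) (use * in simp)
    then have "joined f s x z" using * joined_trans by blast
    then show ?thesis by (simp add: joined_def)
  qed
  ultimately show "\<exists>C\<in>components {z. G z \<le> s}. node f t x \<subseteq> C \<and> node f u y \<subseteq> C" by blast
qed

lemma joined_filled_bound:
  obtains M where "M \<ge> 0" "\<And>x y. \<lbrakk>G x = 0; G y = 0\<rbrakk> \<Longrightarrow> joined f M x y"
proof -
  obtain B where B: "\<And>z. G z \<le> 0 \<Longrightarrow> norm z \<le> B" using bounded_le[of 0] by (auto simp: bounded_iff)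
  have "\<exists>M\<ge>0. \<forall>z\<in>cball 0 B. G z \<le> M"
  proof (cases "cball (0::complex) B = {}")
    case False
    then obtain m where "m \<in> cball 0 B" "\<forall>z\<in>cball 0 B. G z \<le> G m"
      using continuous_attains_sup[OF compact_cball _ continuous_on_G] by blast
    then show ?thesis using G_nonneg by blast
  qed auto
  then obtain M where M: "M \<ge> 0" "\<And>z. z \<in> cball 0 B \<Longrightarrow> G z \<le> M" by blast
  have "joined f M x y" if "G x = 0" "G y = 0" for x y
  proof (rule joinedI[OF connected_cball])
    show "x \<in> cball 0 B" "y \<in> cball 0 B" using B[of x] B[of y] that by auto
  qed (rule M(2))
  then show ?thesis using that M(1) by blast
qed

text \<open>All of the filled Julia set is joined at some level, and \<open>joined_Inf\<close> makes
  the infimum of the joining levels a joining level. Hence the \<open>LEAST\<close> in the tree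
  distance is attained.\<close>

lemma joined_threshold:
  assumes "G x = 0" "G y = 0" "0 \<le> a"
  obtains m where "a \<le> m" "\<And>s. a \<le> s \<and> joined f s x y \<longleftrightarrow> m \<le> s"
proof -
  define S where "S = {s. a \<le> s \<and> joined f s x y}"
  obtain M where M: "M \<ge> 0" "joined f M x y" using joined_filled_bound assms by metis
  have "joined f (max a M) x y" using M(2) by (rule joined_mono) simp
  then have "max a M \<in> S" by (simp add: S_def)
  have bdd: "bdd_below S" by (auto simp: S_def bdd_below_def)
  have a: "a \<le> Inf S" by (rule cInf_greatest) (use \<open>max a M \<in> S\<close> S_def in blast)+
  have j: "joined f (Inf S) x y"
  proof (rule joined_Inf)
    fix t assume "Inf S < t"
    then obtain s where "s \<in> S" "s < t" using cInf_less_iff[of S t] bdd \<open>max a M \<in> S\<close> by auto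
    then show "joined f t x y" using joined_mono by (auto simp: S_def)
  qed
  have "a \<le> s \<and> joined f s x y \<longleftrightarrow> Inf S \<le> s" for s
  proof
    assume "a \<le> s \<and> joined f s x y"
    then have "s \<in> S" by (simp add: S_def)
    then show "Inf S \<le> s" using bdd by (rule cInf_lower)
  next
    assume "Inf S \<le> s"
    then show "a \<le> s \<and> joined f s x y" using a j joined_mono[of f "Inf S" x y s] by auto
  qed
  then show ?thesis using that a by blast
qed

lemma Least_threshold:
  fixes m :: real
  assumes "\<And>s. P s \<longleftrightarrow> m \<le> s"
  shows "(LEAST s. P s) = m"
  by (rule Least_equality) (use assms in auto)

lemma tree_dist_node:
  assumes "G x = 0" "0 \<le> t" "G y = 0" "0 \<le> u"
  shows "tree_dist f (node f t x) (node f u y) =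
         2 * (LEAST s. max t u \<le> s \<and> joined f s x y) - t - u"
  by (simp add: tree_dist_def tree_join_height_def node_in_component_iff[OF assms] tree_height_node assms)

lemma tree_dist_ge:
  assumes "G x = 0" "0 \<le> t" "G y = 0" "0 \<le> u"
  shows "tree_dist f (node f t x) (node f u y) \<ge> u - t"
proof -
  obtain m where m: "max t u \<le> m" "\<And>s. max t u \<le> s \<and> joined f s x y \<longleftrightarrow> m \<le> s"
  proof -
    have "0 \<le> max t u" using assms by simp
    then show ?thesis using joined_threshold[OF assms(1,3)] that by metis
  qed
  then show ?thesis using tree_dist_node[OF assms] Least_threshold[OF m(2)] by simp
qed

text \<open>This recovers height 0 from distance and dynamics, which are all that
  \<open>tree_equiv\<close> preserves. A point at height t has its n-th image at height d^n t, and
  distances dominate height differences; at height 0 all distances have a common bound by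
  \<open>joined_filled_bound\<close>.\<close>

lemma height_zero_iff:
  assumes "X \<in> tree_points f"
  shows "tree_height f X = 0 \<longleftrightarrow> (\<exists>M. \<forall>n. tree_dist f X ((tree_map f ^^ n) X) \<le> M)"
proof -
  obtain t x where tx: "X = node f t x" "0 \<le> t" "G x = 0" using assms tree_points_eq by auto
  have it: "(tree_map f ^^ n) X = node f (d ^ n * t) ((poly f ^^ n) x)" for n
    using tree_map_funpow_node tx by simp
  have Gn: "G ((poly f ^^ n) x) = 0" for n using tx by (simp add: G_funpow)
  have ht: "tree_height f X = t" using tree_height_node tx by simp
  show ?thesis
  proof
    assume "tree_height f X = 0"
    then have t0: "t = 0" using ht by simp
    obtain M where M: "M \<ge> 0" "\<And>x y. \<lbrakk>G x = 0; G y = 0\<rbrakk> \<Longrightarrow> joined f M x y"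
      using joined_filled_bound by metis
    have "tree_dist f X ((tree_map f ^^ n) X) \<le> 2 * M" for n
    proof -
      obtain m where m: "0 \<le> m" "\<And>s. 0 \<le> s \<and> joined f s x ((poly f ^^ n) x) \<longleftrightarrow> m \<le> s"
        using joined_threshold[OF tx(3) Gn, of 0] by auto
      have e1: "(tree_map f ^^ n) X = node f 0 ((poly f ^^ n) x)" using it[of n] t0 by simp
      have e2: "X = node f 0 x" using tx t0 by simp
      have "tree_dist f X ((tree_map f ^^ n) X) = 2 * m"
        unfolding e1 by (subst e2)
          (use tree_dist_node[OF tx(3) order_refl Gn order_refl, of n] Least_threshold[OF m(2)] in simp)
      moreover have "m \<le> M" using m(2)[of M] M tx(3) Gn by blast
      ultimately show ?thesis by simp
    qed
    then show "\<exists>M. \<forall>n. tree_dist f X ((tree_map f ^^ n) X) \<le> M" by blast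
  next
    assume "\<exists>M. \<forall>n. tree_dist f X ((tree_map f ^^ n) X) \<le> M"
    then obtain M where M: "\<And>n. tree_dist f X ((tree_map f ^^ n) X) \<le> M" by blast
    have "t = 0"
    proof (rule ccontr)
      assume "t \<noteq> 0"
      then have t: "t > 0" using tx by simp
      obtain n where n: "M / t + 1 < 2 ^ n" using real_arch_pow[of 2] by auto
      have "(2::real) ^ n \<le> real d ^ n" using deg2 by (intro power_mono) auto
      then have "M / t + 1 < real d ^ n" using n by linarith
      then have "(M / t + 1) * t < real d ^ n * t" using t by (intro mult_strict_right_mono)
      moreover have "(M / t + 1) * t = M + t" using t by (simp add: field_simps)
      ultimately have "M + t < real d ^ n * t" by linarith
      moreover have "tree_dist f X ((tree_map f ^^ n) X) \<ge> d ^ n * t - t"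
        unfolding it by (subst tx(1)) (use tree_dist_ge[OF tx(3,2) Gn, of "d ^ n * t" n] tx(2) in simp)
      ultimately show False using M[of n] by simp
    qed
    then show "tree_height f X = 0" using ht by simp
  qed
qed

text \<open>Together with \<open>height_zero_iff\<close> this makes branching heights an invariant
  of the tree.\<close>

lemma branch_heights_eq:
  "branch_heights f = {v. v > 0 \<and> (\<exists>X\<in>tree_points f. \<exists>Y\<in>tree_points f.
      tree_height f X = 0 \<and> tree_height f Y = 0 \<and> tree_dist f X Y = 2 * v)}"
proof -
  have dist: "tree_dist f (node f 0 x) (node f 0 y) = 2 * v \<longleftrightarrow> (\<forall>s\<ge>0. joined f s x y \<longleftrightarrow> v \<le> s)"
    if xy: "G x = 0" "G y = 0" and v: "v > 0" for x y v
  proof -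
    obtain m where m: "0 \<le> m" "\<And>s. 0 \<le> s \<and> joined f s x y \<longleftrightarrow> m \<le> s"
      using joined_threshold[OF xy, of 0] by auto
    have "tree_dist f (node f 0 x) (node f 0 y) = 2 * m"
      using tree_dist_node[OF xy(1) order_refl xy(2) order_refl] Least_threshold[OF m(2)] by simp
    moreover have "m = v \<longleftrightarrow> (\<forall>s\<ge>0. joined f s x y \<longleftrightarrow> v \<le> s)"
    proof
      assume "\<forall>s\<ge>0. joined f s x y \<longleftrightarrow> v \<le> s"
      then show "m = v" using m(1) m(2)[of m] m(2)[of v] v by (metis order_antisym order_refl less_imp_le)
    qed (use m in blast)
    ultimately show ?thesis by simp
  qed
  show ?thesis
  proof (intro equalityI subsetI)
    fix v assume "v \<in> branch_heights f"
    then obtain x y where *: "v > 0" "G x = 0" "G y = 0" "\<forall>s\<ge>0. joined f s x y \<longleftrightarrow> v \<le> s"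
      by (auto simp: branch_heights_def)
    have "node f 0 x \<in> tree_points f" "node f 0 y \<in> tree_points f" using * tree_points_eq by blast+
    moreover have "tree_height f (node f 0 x) = 0" "tree_height f (node f 0 y) = 0"
      using tree_height_node * by auto
    ultimately show "v \<in> {v. v > 0 \<and> (\<exists>X\<in>tree_points f. \<exists>Y\<in>tree_points f.
        tree_height f X = 0 \<and> tree_height f Y = 0 \<and> tree_dist f X Y = 2 * v)}"
      using dist * by blast
  next
    fix v assume "v \<in> {v. v > 0 \<and> (\<exists>X\<in>tree_points f. \<exists>Y\<in>tree_points f.
        tree_height f X = 0 \<and> tree_height f Y = 0 \<and> tree_dist f X Y = 2 * v)}"
    then obtain X Y where v: "v > 0" and XY: "X \<in> tree_points f" "Y \<in> tree_points f"
        "tree_height f X = 0" "tree_height f Y = 0" "tree_dist f X Y = 2 * v"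
      by blast
    obtain x where x: "X = node f 0 x" "G x = 0"
      using XY(1,3) tree_points_eq tree_height_node by fastforce
    obtain y where y: "Y = node f 0 y" "G y = 0"
      using XY(2,4) tree_points_eq tree_height_node by fastforce
    show "v \<in> branch_heights f"
      unfolding branch_heights_def using dist[OF x(2) y(2) v] XY(5) x y v by blast
  qed
qed

text \<open>The merging level v of two points does not change when they are replaced by points
  joined to them at level v/2. These can be chosen in a countable dense subset of the filled Julia
  set, and each pair has at most one merging level.\<close>

lemma countable_branch_heights: "countable (branch_heights f)"
proof -
  obtain D where D: "countable D" "D \<subseteq> {z. G z \<le> 0}" "{z. G z \<le> 0} \<subseteq> closure D"
    by (rule separable)
  have near: "\<exists>q\<in>D. joined f (v / 2) x q" if "v > 0" "G x = 0" for v x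
  proof -
    have "x \<in> {z. G z < v / 2}" using that by simp
    then obtain e where e: "e > 0" "ball x e \<subseteq> {z. G z < v / 2}" using open_lt by (meson openE)
    have "x \<in> closure D" using D(3) that(2) by auto
    then obtain q where q: "q \<in> D" "q \<in> ball x e"
      using e(1) by (metis closure_approachable dist_commute mem_ball)
    have "joined f (v / 2) x q"
    proof (rule joinedI[OF connected_ball])
      show "G z \<le> v / 2" if "z \<in> ball x e" for z using e(2) that by auto
    qed (use e q in auto)
    then show ?thesis using q(1) by blast
  qed
  define T where "T q = {v. v > 0 \<and> (\<forall>s\<ge>0. joined f s (fst q) (snd q) \<longleftrightarrow> v \<le> s)}" for q
  have "branch_heights f \<subseteq> (\<Union>q\<in>D \<times> D. T q)"
  proof
    fix v assume "v \<in> branch_heights f"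
    then obtain x y where *: "v > 0" "G x = 0" "G y = 0" "\<And>s. s \<ge> 0 \<Longrightarrow> joined f s x y \<longleftrightarrow> v \<le> s"
      by (auto simp: branch_heights_def)
    obtain p where p: "p \<in> D" "joined f (v / 2) x p" using near[OF *(1,2)] by blast
    obtain q where q: "q \<in> D" "joined f (v / 2) y q" using near[OF *(1,3)] by blast
    have "joined f s p q \<longleftrightarrow> v \<le> s" if s: "s \<ge> 0" for s
    proof
      assume "joined f s p q"
      then have "joined f (max s (v / 2)) p q" by (rule joined_mono) simp
      moreover have "joined f (max s (v / 2)) x p" "joined f (max s (v / 2)) q y"
        using joined_mono[OF p(2)] joined_mono[OF joined_sym[OF q(2)]] by simp_all
      ultimately have "joined f (max s (v / 2)) x y" using joined_trans by blast
      then have "v \<le> max s (v / 2)" using *(4)[of "max s (v / 2)"] s by simp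
      then show "v \<le> s" using *(1) by linarith
    next
      assume "v \<le> s"
      then have "joined f s x y" "v / 2 \<le> s" using *(4)[OF s] *(1) by auto
      moreover have "joined f s p x" "joined f s y q"
        using joined_mono[OF joined_sym[OF p(2)] \<open>v / 2 \<le> s\<close>] joined_mono[OF q(2) \<open>v / 2 \<le> s\<close>] .
      ultimately show "joined f s p q" using joined_trans by blast
    qed
    then have "v \<in> T (p, q)" using *(1) by (simp add: T_def)
    then show "v \<in> (\<Union>q\<in>D \<times> D. T q)" using p(1) q(1) by blast
  qed
  moreover have "countable (T q)" for q
  proof (cases "T q = {}")
    case False
    then obtain v where v: "v \<in> T q" by blast
    have "w = v" if w: "w \<in> T q" for w
    proof -
      have vT: "v > 0" "\<And>s. s \<ge> 0 \<Longrightarrow> joined f s (fst q) (snd q) \<longleftrightarrow> v \<le> s" using v by (auto simp: T_def)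
      have wT: "w > 0" "\<And>s. s \<ge> 0 \<Longrightarrow> joined f s (fst q) (snd q) \<longleftrightarrow> w \<le> s" using w by (auto simp: T_def)
      show ?thesis using vT(2)[of v] vT(2)[of w] wT(2)[of v] wT(2)[of w] vT(1) wT(1) by linarith
    qed
    then have "T q \<subseteq> {v}" by blast
    then show ?thesis using countable_subset by blast
  qed simp
  ultimately show ?thesis using D(1) by (meson countable_SIGMA countable_UN countable_subset)
qed

text \<open>The two points supplied by \<open>critical_branching\<close> are moved to the filled
  Julia set inside components of lower sublevel sets, which does not affect the level at which they
  merge.\<close>

lemma critical_height_branch:
  assumes "poly (pderiv f) c = 0"
  shows "G c \<in> insert 0 (branch_heights f)"
proof (cases "G c > 0")
  case False
  then show ?thesis using G_nonneg[of c] by simp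
next
  case True
  define v where "v = G c"
  obtain x y where xy0: "G x < G c" "G y < G c" "joined f (G c) x y" "\<not> connected_component {z. G z < G c} x y"
    by (rule critical_branching[OF True assms]) (rule that)
  note xy = xy0[folded v_def]
  obtain x' where x': "G x' = 0" "joined f (G x) x x'" using joined_zero[of x "G x"] by auto
  obtain y' where y': "G y' = 0" "joined f (G y) y y'" using joined_zero[of y "G y"] by auto
  have "joined f s x' y' \<longleftrightarrow> v \<le> s" for s
  proof
    assume s: "joined f s x' y'"
    show "v \<le> s"
    proof (rule ccontr)
      assume "\<not> v \<le> s"
      define m where "m = max s (max (G x) (G y))"
      have m: "m < v" "s \<le> m" "G x \<le> m" "G y \<le> m" using \<open>\<not> v \<le> s\<close> xy by (auto simp: m_def)
      have "joined f m x x'" "joined f m x' y'" "joined f m y' y"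
        using joined_mono[OF x'(2) m(3)] joined_mono[OF s m(2)] joined_mono[OF joined_sym[OF y'(2)] m(4)] .
      then have "joined f m x y" using joined_trans by blast
      then have "connected_component {z. G z < v} x y"
        unfolding joined_def by (rule connected_component_of_subset) (use m(1) in auto)
      then show False using xy(4) by blast
    qed
  next
    assume "v \<le> s"
    then have le: "G x \<le> s" "G y \<le> s" using xy by auto
    have "joined f s x' x" "joined f s x y" "joined f s y y'"
      using joined_mono[OF joined_sym[OF x'(2)] le(1)] joined_mono[OF xy(3) \<open>v \<le> s\<close>] joined_mono[OF y'(2) le(2)] .
    then show "joined f s x' y'" using joined_trans by blast
  qed
  then have "v \<in> branch_heights f" unfolding branch_heights_def using x'(1) y'(1) True v_def by blast
  then show ?thesis by (simp add: v_def)
qed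

end

subsection \<open>Equivalence of trees\<close>

lemma tree_equiv_refl: "tree_equiv S S"
  unfolding tree_equiv_def by (rule exI[of _ id]) (auto simp: bij_betw_def)

lemma tree_equiv_trans:
  assumes "tree_equiv S T" "tree_equiv T U"
  shows "tree_equiv S U"
proof -
  obtain \<phi> where \<phi>: "bij_betw \<phi> (points S) (points T)"
    "\<And>x y. \<lbrakk>x \<in> points S; y \<in> points S\<rbrakk> \<Longrightarrow> tdist T (\<phi> x) (\<phi> y) = tdist S x y"
    "\<And>x. x \<in> points S \<Longrightarrow> \<phi> (dyn S x) = dyn T (\<phi> x)"
    using assms(1) unfolding tree_equiv_def by blast
  obtain \<psi> where \<psi>: "bij_betw \<psi> (points T) (points U)"
    "\<And>x y. \<lbrakk>x \<in> points T; y \<in> points T\<rbrakk> \<Longrightarrow> tdist U (\<psi> x) (\<psi> y) = tdist T x y"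
    "\<And>x. x \<in> points T \<Longrightarrow> \<psi> (dyn T x) = dyn U (\<psi> x)"
    using assms(2) unfolding tree_equiv_def by blast
  have mem: "\<phi> x \<in> points T" if "x \<in> points S" for x
    using \<phi>(1) that by (auto simp: bij_betw_def)
  show ?thesis
    unfolding tree_equiv_def
    by (rule exI[of _ "\<psi> \<circ> \<phi>"]) (auto simp: bij_betw_trans[OF \<phi>(1) \<psi>(1)] \<phi> \<psi> mem)
qed

lemma tree_equiv_sym:
  assumes "tree_equiv S T" and dyn: "\<And>x. x \<in> points S \<Longrightarrow> dyn S x \<in> points S"
  shows "tree_equiv T S"
proof -
  obtain \<phi> where \<phi>: "bij_betw \<phi> (points S) (points T)"
    "\<And>x y. \<lbrakk>x \<in> points S; y \<in> points S\<rbrakk> \<Longrightarrow> tdist T (\<phi> x) (\<phi> y) = tdist S x y"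
    "\<And>x. x \<in> points S \<Longrightarrow> \<phi> (dyn S x) = dyn T (\<phi> x)"
    using assms(1) unfolding tree_equiv_def by blast
  define \<psi> where "\<psi> = inv_into (points S) \<phi>"
  have inv: "\<psi> y \<in> points S \<and> \<phi> (\<psi> y) = y" if "y \<in> points T" for y
    using that \<phi>(1) unfolding \<psi>_def by (auto simp: bij_betw_def inv_into_into f_inv_into_f)
  have inv': "\<psi> (\<phi> x) = x" if "x \<in> points S" for x
    using that \<phi>(1) unfolding \<psi>_def by (simp add: bij_betw_inv_into_left)
  have "bij_betw \<psi> (points T) (points S)" unfolding \<psi>_def using \<phi>(1) by (rule bij_betw_inv_into)
  moreover have "tdist S (\<psi> x) (\<psi> y) = tdist T x y" if "x \<in> points T" "y \<in> points T" for x y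
    using \<phi>(2)[of "\<psi> x" "\<psi> y"] inv[OF that(1)] inv[OF that(2)] by simp
  moreover have "\<psi> (dyn T x) = dyn S (\<psi> x)" if "x \<in> points T" for x
  proof -
    have "dyn T x = \<phi> (dyn S (\<psi> x))" using \<phi>(3) inv[OF that] by simp
    then show ?thesis using inv' dyn inv[OF that] by simp
  qed
  ultimately show ?thesis unfolding tree_equiv_def by blast
qed

lemma poly_tree_simps [simp]:
  "points (poly_tree f) = tree_points f" "tdist (poly_tree f) = tree_dist f" "dyn (poly_tree f) = tree_map f"
  by (simp_all add: poly_tree_def)

lemma poly_tree_equiv_sym:
  assumes "monic_poly f" "tree_equiv (poly_tree f) (poly_tree g)"
  shows "tree_equiv (poly_tree g) (poly_tree f)"
  using assms(2) by (rule tree_equiv_sym) (use monic_poly.dyn_tree_points[OF assms(1)] in auto)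

text \<open>An isometry conjugating the dynamics preserves boundedness of orbits measured from their
  starting point, hence height 0, hence half-distances between points at height 0.\<close>

lemma branch_heights_subset:
  assumes f: "monic_poly f" and g: "monic_poly g" and equiv: "tree_equiv (poly_tree f) (poly_tree g)"
  shows "branch_heights f \<subseteq> branch_heights g"
proof
  obtain \<phi> where \<phi>: "bij_betw \<phi> (tree_points f) (tree_points g)"
    "\<And>x y. \<lbrakk>x \<in> tree_points f; y \<in> tree_points f\<rbrakk> \<Longrightarrow> tree_dist g (\<phi> x) (\<phi> y) = tree_dist f x y"
    "\<And>x. x \<in> tree_points f \<Longrightarrow> \<phi> (tree_map f x) = tree_map g (\<phi> x)"
    using equiv unfolding tree_equiv_def poly_tree_simps by blast
  have mem: "\<phi> X \<in> tree_points g" if "X \<in> tree_points f" for X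
    using \<phi>(1) that by (auto simp: bij_betw_def)
  have it: "(tree_map f ^^ n) X \<in> tree_points f \<and> \<phi> ((tree_map f ^^ n) X) = (tree_map g ^^ n) (\<phi> X)"
    if "X \<in> tree_points f" for X n
    by (induction n) (use that \<phi>(3) monic_poly.dyn_tree_points[OF f] in auto)
  have ht: "tree_height g (\<phi> X) = 0 \<longleftrightarrow> tree_height f X = 0" if X: "X \<in> tree_points f" for X
  proof -
    have "tree_dist g (\<phi> X) ((tree_map g ^^ n) (\<phi> X)) = tree_dist f X ((tree_map f ^^ n) X)" for n
      using it[OF X, of n] \<phi>(2)[OF X, of "(tree_map f ^^ n) X"] by simp
    then show ?thesis
      using monic_poly.height_zero_iff[OF f X] monic_poly.height_zero_iff[OF g mem[OF X]] by simp
  qed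
  fix v assume "v \<in> branch_heights f"
  then obtain X Y where v: "v > 0" and XY: "X \<in> tree_points f" "Y \<in> tree_points f"
        "tree_height f X = 0" "tree_height f Y = 0" "tree_dist f X Y = 2 * v"
    unfolding monic_poly.branch_heights_eq[OF f] by blast
  then show "v \<in> branch_heights g"
    unfolding monic_poly.branch_heights_eq[OF g]
  proof (intro CollectI conjI bexI)
    show "tree_dist g (\<phi> X) (\<phi> Y) = 2 * v" using \<phi>(2) XY by simp
    show "tree_height g (\<phi> X) = 0" "tree_height g (\<phi> Y) = 0" using ht XY by blast+
  qed (use v mem XY in auto)
qed

text \<open>\<open>Y\<close> is a bare map of points, with no continuity. A tree point sees x only
  up to being joined, so compatibility with the dynamics and surjectivity are required only up to
  being joined at level 0.\<close>

lemma tree_equivI: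
  assumes f: "monic_poly f" and g: "monic_poly g" and deg: "degree f = degree g"
    and Y: "\<And>x. escape_rate f x = 0 \<Longrightarrow> escape_rate g (Y x) = 0"
    and joined: "\<And>x x' t. \<lbrakk>escape_rate f x = 0; escape_rate f x' = 0; 0 \<le> t\<rbrakk> \<Longrightarrow>
        joined f t x x' \<longleftrightarrow> joined g t (Y x) (Y x')"
    and dyn: "\<And>x. escape_rate f x = 0 \<Longrightarrow> joined g 0 (poly g (Y x)) (Y (poly f x))"
    and onto: "\<And>u. escape_rate g u = 0 \<Longrightarrow> \<exists>x. escape_rate f x = 0 \<and> joined g 0 (Y x) u"
  shows "tree_equiv (poly_tree f) (poly_tree g)"
proof -
  interpret F: monic_poly f by (rule f)
  interpret H: monic_poly g by (rule g)
  \<comment> \<open>Any address of X will do: by the hypothesis \<open>joined\<close> the image does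
    not depend on it.\<close>
  define \<phi> where "\<phi> X = node g (tree_height f X)
      (Y (SOME x. F.G x = 0 \<and> X = node f (tree_height f X) x))" for X
  have \<phi>: "\<phi> (node f t x) = node g t (Y x)" if tx: "0 \<le> t" "F.G x = 0" for t x
  proof -
    have ht: "tree_height f (node f t x) = t" using F.tree_height_node tx by blast
    define x' where "x' = (SOME x'. F.G x' = 0 \<and> node f t x = node f t x')"
    have x': "F.G x' = 0 \<and> node f t x = node f t x'"
      unfolding x'_def by (rule someI[of _ x]) (use tx in simp)
    have "joined f t x x'" using F.node_eq_iff[OF tx(2,1)] x' by blast
    then have "joined g t (Y x) (Y x')" using joined tx x' by blast
    then have "node g t (Y x) = node g t (Y x')" using H.node_eq_iff[OF Y[OF tx(2)] tx(1)] by blast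
    then show ?thesis unfolding \<phi>_def ht x'_def by simp
  qed
  have "bij_betw \<phi> (tree_points f) (tree_points g)"
    unfolding bij_betw_def
  proof
    show "inj_on \<phi> (tree_points f)"
    proof (rule inj_onI)
      fix X X' assume X: "X \<in> tree_points f" "X' \<in> tree_points f" "\<phi> X = \<phi> X'"
      obtain t x where tx: "X = node f t x" "0 \<le> t" "F.G x = 0" using X(1) F.tree_points_eq by auto
      obtain s y where sy: "X' = node f s y" "0 \<le> s" "F.G y = 0" using X(2) F.tree_points_eq by auto
      have "node g t (Y x) = node g s (Y y)" using X(3) \<phi> tx sy by simp
      then have "t = s \<and> joined g t (Y x) (Y y)" using H.node_eq_iff[OF Y[OF tx(3)] tx(2)] by blast
      then have "t = s \<and> joined f t x y" using joined tx sy by blast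
      then show "X = X'" using F.node_eq_iff[OF tx(3,2)] tx(1) sy(1) by blast
    qed
    show "\<phi> ` tree_points f = tree_points g"
    proof (intro equalityI subsetI)
      fix Z assume "Z \<in> \<phi> ` tree_points f"
      then obtain t x where "Z = \<phi> (node f t x)" "0 \<le> t" "F.G x = 0" using F.tree_points_eq by auto
      then have "Z = node g t (Y x)" "0 \<le> t" "H.G (Y x) = 0" using \<phi> Y by auto
      then show "Z \<in> tree_points g" using H.tree_points_eq by blast
    next
      fix Z assume "Z \<in> tree_points g"
      then obtain t u where tu: "Z = node g t u" "0 \<le> t" "H.G u = 0" using H.tree_points_eq by auto
      obtain x where x: "F.G x = 0" "joined g 0 (Y x) u" using onto[OF tu(3)] by blast
      have "joined g t (Y x) u" using joined_mono[OF x(2) tu(2)] .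
      then have "Z = \<phi> (node f t x)"
        using H.node_eq_iff[OF Y[OF x(1)] tu(2)] \<phi>[OF tu(2) x(1)] tu(1) by metis
      moreover have "node f t x \<in> tree_points f" using F.tree_points_eq tu(2) x(1) by blast
      ultimately show "Z \<in> \<phi> ` tree_points f" by blast
    qed
  qed
  moreover have "tree_dist g (\<phi> X) (\<phi> X') = tree_dist f X X'"
    if X: "X \<in> tree_points f" "X' \<in> tree_points f" for X X'
  proof -
    obtain t x where tx: "X = node f t x" "0 \<le> t" "F.G x = 0" using X(1) F.tree_points_eq by auto
    obtain s y where sy: "X' = node f s y" "0 \<le> s" "F.G y = 0" using X(2) F.tree_points_eq by auto
    have "max t s \<le> u \<and> joined g u (Y x) (Y y) \<longleftrightarrow> max t s \<le> u \<and> joined f u x y" for u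
      using joined[OF tx(3) sy(3), of u] tx(2) by auto
    then show ?thesis
      using F.tree_dist_node[OF tx(3,2) sy(3,2)] H.tree_dist_node[OF Y[OF tx(3)] tx(2) Y[OF sy(3)] sy(2)]
        \<phi> tx sy by simp
  qed
  moreover have "\<phi> (tree_map f X) = tree_map g (\<phi> X)" if X: "X \<in> tree_points f" for X
  proof -
    obtain t x where tx: "X = node f t x" "0 \<le> t" "F.G x = 0" using X F.tree_points_eq by auto
    have dt: "0 \<le> F.d * t" using tx(2) by simp
    have gY: "H.G (poly g (Y x)) = 0" using H.G_poly_0 Y[OF tx(3)] by blast
    have "tree_map g (\<phi> X) = node g (F.d * t) (poly g (Y x))"
      using H.tree_map_node[OF Y[OF tx(3)] tx(2)] \<phi> tx deg by simp
    also have "\<dots> = node g (F.d * t) (Y (poly f x))"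
      using H.node_eq_iff[OF gY dt] joined_mono[OF dyn[OF tx(3)] dt] by blast
    also have "\<dots> = \<phi> (tree_map f X)"
      using F.tree_map_node[OF tx(3,2)] tx(1) \<phi>[OF dt F.G_poly_0[OF tx(3)]] by simp
    finally show ?thesis by simp
  qed
  ultimately show ?thesis unfolding tree_equiv_def poly_tree_simps by blast
qed

section \<open>Polynomials with equal truncated trees\<close>

text \<open>The parts of the two trees above height \<open>s\<close> are matched by a correspondence between the filled
  Julia sets; a point of the tree at height \<open>t\<close> is the class of a point of the filled Julia set
  under being joined at level \<open>t\<close>.\<close>

definition level_equiv :: "real \<Rightarrow> complex poly \<Rightarrow> complex poly \<Rightarrow> bool" where
  "level_equiv s f g \<longleftrightarrow> (\<exists>R.
     (\<forall>x y. R x y \<longrightarrow> escape_rate f x = 0 \<and> escape_rate g y = 0) \<and>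
     (\<forall>x. escape_rate f x = 0 \<longrightarrow> (\<exists>y. R x y)) \<and>
     (\<forall>y. escape_rate g y = 0 \<longrightarrow> (\<exists>x. R x y)) \<and>
     (\<forall>x x' y y' t. R x y \<longrightarrow> R x' y' \<longrightarrow> s \<le> t \<longrightarrow> (joined f t x x' \<longleftrightarrow> joined g t y y')) \<and>
     (\<forall>x y y'. R x y \<longrightarrow> R (poly f x) y' \<longrightarrow> joined g (real (degree f) * s) (poly g y) y'))"

lemma level_equivI:
  assumes "\<And>x y. R x y \<Longrightarrow> escape_rate f x = 0 \<and> escape_rate g y = 0"
    "\<And>x. escape_rate f x = 0 \<Longrightarrow> \<exists>y. R x y" "\<And>y. escape_rate g y = 0 \<Longrightarrow> \<exists>x. R x y"
    "\<And>x x' y y' t. \<lbrakk>R x y; R x' y'; s \<le> t\<rbrakk> \<Longrightarrow> joined f t x x' \<longleftrightarrow> joined g t y y'"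
    "\<And>x y y'. \<lbrakk>R x y; R (poly f x) y'\<rbrakk> \<Longrightarrow> joined g (real (degree f) * s) (poly g y) y'"
  shows "level_equiv s f g"
  unfolding level_equiv_def by (rule exI[of _ R]) (use assms in auto)

lemma level_equivE:
  assumes "level_equiv s f g"
  obtains R where "\<And>x y. R x y \<Longrightarrow> escape_rate f x = 0" "\<And>x y. R x y \<Longrightarrow> escape_rate g y = 0"
    "\<And>x. escape_rate f x = 0 \<Longrightarrow> \<exists>y. R x y" "\<And>y. escape_rate g y = 0 \<Longrightarrow> \<exists>x. R x y"
    "\<And>x x' y y' t. \<lbrakk>R x y; R x' y'; s \<le> t\<rbrakk> \<Longrightarrow> joined f t x x' \<longleftrightarrow> joined g t y y'"
    "\<And>x y y'. \<lbrakk>R x y; R (poly f x) y'\<rbrakk> \<Longrightarrow> joined g (real (degree f) * s) (poly g y) y'"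
proof -
  from assms[unfolded level_equiv_def] obtain R where
    "\<forall>x y. R x y \<longrightarrow> escape_rate f x = 0 \<and> escape_rate g y = 0"
    "\<forall>x. escape_rate f x = 0 \<longrightarrow> (\<exists>y. R x y)" "\<forall>y. escape_rate g y = 0 \<longrightarrow> (\<exists>x. R x y)"
    "\<forall>x x' y y' t. R x y \<longrightarrow> R x' y' \<longrightarrow> s \<le> t \<longrightarrow> (joined f t x x' \<longleftrightarrow> joined g t y y')"
    "\<forall>x y y'. R x y \<longrightarrow> R (poly f x) y' \<longrightarrow> joined g (real (degree f) * s) (poly g y) y'"
    by (elim exE conjE)
  then show ?thesis by (intro that[of R]) (blast+)
qed

lemma level_le: "s \<le> real n * s" if "s \<ge> 0" "n \<ge> 2" for s :: real
  using that mult_right_mono[of 1 "real n" s] by simp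

lemma level_equiv_sym:
  assumes f: "monic_poly f" and deg: "degree f = degree g" and s: "s \<ge> 0"
    and eq: "level_equiv s f g"
  shows "level_equiv s g f"
proof -
  interpret F: monic_poly f by (rule f)
  obtain R where R: "\<And>x y. R x y \<Longrightarrow> escape_rate f x = 0" "\<And>x y. R x y \<Longrightarrow> escape_rate g y = 0"
    "\<And>x. escape_rate f x = 0 \<Longrightarrow> \<exists>y. R x y" "\<And>y. escape_rate g y = 0 \<Longrightarrow> \<exists>x. R x y"
    "\<And>x x' y y' t. \<lbrakk>R x y; R x' y'; s \<le> t\<rbrakk> \<Longrightarrow> joined f t x x' \<longleftrightarrow> joined g t y y'"
    "\<And>x y y'. \<lbrakk>R x y; R (poly f x) y'\<rbrakk> \<Longrightarrow> joined g (real (degree f) * s) (poly g y) y'"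
    by (rule level_equivE[OF eq]) (rule that)
  show ?thesis
  proof (rule level_equivI[of "\<lambda>y x. R x y"])
    fix y x x' assume *: "R x y" "R x' (poly g y)"
    obtain y' where y': "R (poly f x) y'" using R(3) F.G_poly_0 R(1)[OF *(1)] by blast
    have "joined g (real (degree f) * s) (poly g y) y'" using R(6)[OF *(1) y'] .
    then have "joined f (real (degree f) * s) x' (poly f x)"
      using R(5)[OF *(2) y' level_le[OF s F.deg2]] by simp
    then show "joined f (real (degree g) * s) (poly f x) x'" using joined_sym deg by simp
  qed (use R in blast)+
qed

lemma level_equiv_trans:
  assumes f: "monic_poly f" and g: "monic_poly g" and h: "monic_poly h"
    and deg: "degree f = degree g" "degree g = degree h" and s: "s \<ge> 0"
    and fg: "level_equiv s f g" and gh: "level_equiv s g h"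
  shows "level_equiv s f h"
proof -
  interpret F: monic_poly f by (rule f)
  interpret H: monic_poly g by (rule g)
  obtain R where R: "\<And>x y. R x y \<Longrightarrow> escape_rate f x = 0" "\<And>x y. R x y \<Longrightarrow> escape_rate g y = 0"
    "\<And>x. escape_rate f x = 0 \<Longrightarrow> \<exists>y. R x y" "\<And>y. escape_rate g y = 0 \<Longrightarrow> \<exists>x. R x y"
    "\<And>x x' y y' t. \<lbrakk>R x y; R x' y'; s \<le> t\<rbrakk> \<Longrightarrow> joined f t x x' \<longleftrightarrow> joined g t y y'"
    "\<And>x y y'. \<lbrakk>R x y; R (poly f x) y'\<rbrakk> \<Longrightarrow> joined g (real (degree f) * s) (poly g y) y'"
    by (rule level_equivE[OF fg]) (rule that)
  obtain S where S: "\<And>x y. S x y \<Longrightarrow> escape_rate g x = 0" "\<And>x y. S x y \<Longrightarrow> escape_rate h y = 0"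
    "\<And>x. escape_rate g x = 0 \<Longrightarrow> \<exists>y. S x y" "\<And>y. escape_rate h y = 0 \<Longrightarrow> \<exists>x. S x y"
    "\<And>x x' y y' t. \<lbrakk>S x y; S x' y'; s \<le> t\<rbrakk> \<Longrightarrow> joined g t x x' \<longleftrightarrow> joined h t y y'"
    "\<And>x y y'. \<lbrakk>S x y; S (poly g x) y'\<rbrakk> \<Longrightarrow> joined h (real (degree g) * s) (poly h y) y'"
    by (rule level_equivE[OF gh]) (rule that)
  show ?thesis
  proof (rule level_equivI[of "\<lambda>x z. \<exists>y. R x y \<and> S y z"])
    fix x z z' assume "\<exists>y. R x y \<and> S y z" "\<exists>y. R (poly f x) y \<and> S y z'"
    then obtain y y' where *: "R x y" "S y z" "R (poly f x) y'" "S y' z'" by blast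
    obtain w where w: "S (poly g y) w" using S(3) H.G_poly_0 S(1)[OF *(2)] by blast
    have 1: "joined h (real (degree g) * s) (poly h z) w" using S(6)[OF *(2) w] .
    have "joined g (real (degree f) * s) (poly g y) y'" using R(6)[OF *(1,3)] .
    then have "joined h (real (degree f) * s) w z'" using S(5)[OF w *(4) level_le[OF s F.deg2]] by simp
    then show "joined h (real (degree f) * s) (poly h z) z'" 
      using joined_trans[of h "real (degree f) * s" "poly h z" w z'] 1 deg(1) by simp
  next
    fix x x' z z' t assume "\<exists>y. R x y \<and> S y z" "\<exists>y. R x' y \<and> S y z'" "s \<le> t"
    then obtain y y' where "R x y" "S y z" "R x' y'" "S y' z'" by blast
    then show "joined f t x x' \<longleftrightarrow> joined h t z z'" using R(5) S(5) \<open>s \<le> t\<close> by simp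
  next
    fix x z assume "\<exists>y. R x y \<and> S y z"
    then show "escape_rate f x = 0 \<and> escape_rate h z = 0" using R(1) S(2) by blast
  next
    fix x assume "escape_rate f x = 0"
    then obtain y where y: "R x y" using R(3) by blast
    obtain z where "S y z" using S(3)[OF R(2)[OF y]] by blast
    with y show "\<exists>z y. R x y \<and> S y z" by blast
  next
    fix z assume "escape_rate h z = 0"
    then obtain y where y: "S y z" using S(4) by blast
    obtain x where "R x y" using R(4)[OF S(1)[OF y]] by blast
    with y show "\<exists>x y. R x y \<and> S y z" by blast
  qed
qed

context monic_poly
begin

section \<open>Merging levels and their stability\<close>

lemma joined_Least:
  assumes "joined f b x y" "a \<le> b"
  obtains m where "a \<le> m" "m \<le> b" "\<And>s. a \<le> s \<and> joined f s x y \<longleftrightarrow> m \<le> s"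
proof -
  define S where "S = {s. a \<le> s \<and> joined f s x y}"
  have b: "b \<in> S" using assms by (simp add: S_def)
  have bdd: "bdd_below S" by (auto simp: S_def bdd_below_def)
  have a: "a \<le> Inf S" by (rule cInf_greatest) (use b S_def in blast)+
  have j: "joined f (Inf S) x y"
  proof (rule joined_Inf)
    fix t assume "Inf S < t"
    then obtain s where s: "s \<in> S" "s < t" using cInf_less_iff[of S t] bdd b by auto
    then have "joined f s x y" by (simp add: S_def)
    then show "joined f t x y" by (rule joined_mono) (use s in simp)
  qed
  have "a \<le> s \<and> joined f s x y \<longleftrightarrow> Inf S \<le> s" for s
  proof
    assume "a \<le> s \<and> joined f s x y"
    then have "s \<in> S" by (simp add: S_def)
    then show "Inf S \<le> s" using bdd by (rule cInf_lower)
  next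
    assume "Inf S \<le> s"
    then show "a \<le> s \<and> joined f s x y" using a j joined_mono[of f "Inf S" x y s] by auto
  qed
  then show ?thesis using that a cInf_lower[OF b bdd] by blast
qed

text \<open>Without a precritical point at height m, \<open>joined_noncritical\<close> would connect
  the two points within {G < m}, hence already at some lower level.\<close>

lemma threshold_precritical:
  assumes m: "\<And>s. a \<le> s \<and> joined f s x y \<longleftrightarrow> m \<le> s" and xy: "G x \<le> a" "G y \<le> a" and "a < m"
  obtains p j where "G p = m" "poly (pderiv f) ((poly f ^^ j) p) = 0"
proof (rule ccontr)
  assume "\<not> thesis"
  then have nc: "\<And>p j. G p = m \<Longrightarrow> poly (pderiv f) ((poly f ^^ j) p) \<noteq> 0" using that by blast
  have "joined f m x y" using m[of m] by simp
  then have "connected_component {z. G z < m} x y"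
    using joined_noncritical[of m x y] nc xy \<open>a < m\<close> by simp
  then obtain t where t: "t < m" "joined f t x y" by (rule joined_below)
  have "joined f (max a t) x y" using t(2) by (rule joined_mono) simp
  then have "m \<le> max a t" using m[of "max a t"] by simp
  then show False using t(1) \<open>a < m\<close> by simp
qed

text \<open>With K = d ln(2 B), \<open>G_approx\<close> places the filled Julia set in the disc of
  radius exp K and gives G \<le> 2 K on that disc. The resulting level is uniform over polynomials
  of the same degree with \<open>coeff_sum\<close> at most B.\<close>

lemma joined_uniform:
  assumes B: "coeff_sum f \<le> B" and xy: "G x \<le> s" "G y \<le> s"
  shows "joined f (max s (2 * (d * ln (2 * B)))) x y"
proof -
  define K where "K = d * ln (2 * B)"
  obtain x' where x': "G x' = 0" "joined f s x x'" using joined_zero[OF xy(1)] by blast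
  obtain y' where y': "G y' = 0" "joined f s y y'" using joined_zero[OF xy(2)] by blast
  have lo: "logp z \<le> G z + K" "G z \<le> logp z + K" for z
    using G_approx[OF B, where z = z and n = 0] unfolding K_def by auto
  have K0: "K \<ge> 0" using lo[of x'] by simp
  have norm_le: "norm z \<le> exp K \<longleftrightarrow> logp z \<le> K" for z
    unfolding logp_def by (subst ln_le_iff_le_exp) (use K0 in auto)
  have "joined f (2 * K) x' y'"
  proof (rule joinedI[OF connected_cball[of 0 "exp K"]])
    show "x' \<in> cball 0 (exp K)" "y' \<in> cball 0 (exp K)"
      using lo(1)[of x'] lo(1)[of y'] x'(1) y'(1) norm_le by auto
    show "G z \<le> 2 * K" if "z \<in> cball 0 (exp K)" for z
      using that lo(2)[of z] norm_le[of z] by auto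
  qed
  then have "joined f (max s (2 * K)) x' y'" by (rule joined_mono) simp
  moreover have "joined f (max s (2 * K)) x x'" using x'(2) by (rule joined_mono) simp
  moreover have "joined f (max s (2 * K)) y' y" using joined_sym[OF y'(2)] by (rule joined_mono) simp
  ultimately show ?thesis unfolding K_def using joined_trans by blast
qed

end

text \<open>The radius in \<open>close\<close> belongs to a disc containing {G \<le> T}, so the
  connected set that joins x and y for f also joins them for g, a little higher.\<close>

lemma joined_near:
  assumes f: "monic_poly f" and B: "coeff_sum f \<le> B"
    and close: "\<And>z. norm z \<le> exp (T + real (degree f) * ln (2 * B)) \<Longrightarrow> escape_rate g z \<le> escape_rate f z + e"
    and j: "joined f t x y" and tT: "0 \<le> t" "t \<le> T"
  shows "joined g (t + e) x y"
proof -
  interpret F: monic_poly f by (rule f)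
  obtain S where S: "connected S" "S \<subseteq> {z. F.G z \<le> t}" "x \<in> S" "y \<in> S"
    using j unfolding joined_def connected_component_def by blast
  show ?thesis
  proof (rule joinedI[OF S(1,3,4)])
    fix z assume "z \<in> S"
    then have Gz: "F.G z \<le> t" using S(2) by blast
    then have "logp z \<le> T + real (degree f) * ln (2 * B)"
      using F.G_approx[OF B, where z = z and n = 0] tT by simp
    then have "max 1 (norm z) \<le> exp (T + real (degree f) * ln (2 * B))"
      unfolding logp_def by (subst (asm) ln_le_iff_le_exp) auto
    then have "escape_rate g z \<le> F.G z + e" using close by simp
    then show "escape_rate g z \<le> t + e" using Gz by simp
  qed
qed

text \<open>The merging level for f is s or in \<open>L\<close>, and closeness puts the merging
  level for g at most e above it. If it were strictly above, it would itself be in \<open>L\<close>,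
  against the gap. Thus an approximate comparison becomes exact.\<close>

lemma joined_transfer:
  assumes f: "monic_poly f" and g: "monic_poly g" and deg: "degree f = degree g"
    and B: "coeff_sum f \<le> B" "coeff_sum g \<le> B"
    and close: "\<And>z. norm z \<le> exp (max s (2 * (real (degree f) * ln (2 * B))) + real (degree f) * ln (2 * B)) \<Longrightarrow>
        escape_rate g z \<le> escape_rate f z + e"
    and Lf: "\<And>p j. poly (pderiv f) ((poly f ^^ j) p) = 0 \<Longrightarrow> escape_rate f p \<in> L"
    and Lg: "\<And>p j. poly (pderiv g) ((poly g ^^ j) p) = 0 \<Longrightarrow> escape_rate g p \<in> L"
    and gap: "\<And>v v'. \<lbrakk>v \<in> insert s L; s \<le> v; v' \<in> L; v < v'\<rbrakk> \<Longrightarrow> v + e < v'"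
    and e: "e > 0" and xy: "escape_rate f x \<le> s" "escape_rate f y \<le> s" "escape_rate g x \<le> s" "escape_rate g y \<le> s"
    and s: "s > 0" and t: "s \<le> t" and j: "joined f t x y"
  shows "joined g t x y"
proof -
  interpret F: monic_poly f by (rule f)
  interpret H: monic_poly g by (rule g)
  \<comment> \<open>Merging levels do not exceed this bound, so closeness on one fixed disc controls
    every level.\<close>
  let ?T = "max s (2 * (real (degree f) * ln (2 * B)))"
  have jT: "joined f ?T x y" by (rule F.joined_uniform[OF B(1) xy(1,2)])
  obtain m where m: "s \<le> m" "m \<le> ?T" "\<And>u. s \<le> u \<and> joined f u x y \<longleftrightarrow> m \<le> u"
    by (rule F.joined_Least[OF jT, of s]) (simp, rule that)
  have mt: "m \<le> t" using m(3)[of t] t j by simp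
  have "joined f m x y" using m(3)[of m] by simp
  have jg: "joined g (m + e) x y"
    by (rule joined_near[OF f B(1) _ \<open>joined f m x y\<close>, where T = ?T]) (use m s close in auto)
  obtain m' where m': "s \<le> m'" "m' \<le> m + e" "\<And>u. s \<le> u \<and> joined g u x y \<longleftrightarrow> m' \<le> u"
    by (rule H.joined_Least[OF jg, of s]) (use m(1) e in simp, rule that)
  have mL: "m \<in> insert s L"
  proof (cases "s < m")
    case True
    obtain p j where "F.G p = m" "poly (pderiv f) ((poly f ^^ j) p) = 0"
      by (rule F.threshold_precritical[OF m(3) xy(1,2) True]) (rule that)
    then show ?thesis using Lf by blast
  qed (use m(1) in auto)
  have "m' \<le> m"
  proof (rule ccontr)
    assume "\<not> m' \<le> m"
    then have lt: "m < m'" "s < m'" using m(1) by auto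
    obtain p j where p: "H.G p = m'" "poly (pderiv g) ((poly g ^^ j) p) = 0"
      by (rule H.threshold_precritical[OF m'(3) xy(3,4) lt(2)]) (rule that)
    have "m' \<in> L" using Lg[OF p(2)] p(1) by simp
    then show False using gap[OF mL m(1) _ lt(1)] m'(2) by simp
  qed
  then show ?thesis using m'(3)[of t] mt by simp
qed

text \<open>Points of the two filled Julia sets correspond when f joins them at level s. Each escape
  rate is at most e on the other filled Julia set, so all these points lie below s for both
  polynomials and \<open>joined_transfer\<close> applies in both directions.\<close>

lemma level_equiv_near:
  assumes f: "monic_poly f" and g: "monic_poly g" and deg: "degree f = degree g"
    and B: "coeff_sum f \<le> B" "coeff_sum g \<le> B"
    and close: "\<And>z. norm z \<le> exp (max s (2 * (real (degree f) * ln (2 * B))) + real (degree f) * ln (2 * B)) \<Longrightarrow>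
        \<bar>escape_rate f z - escape_rate g z\<bar> \<le> e"
    and Lf: "\<And>p j. poly (pderiv f) ((poly f ^^ j) p) = 0 \<Longrightarrow> escape_rate f p \<in> L"
    and Lg: "\<And>p j. poly (pderiv g) ((poly g ^^ j) p) = 0 \<Longrightarrow> escape_rate g p \<in> L"
    and gap: "\<And>v v'. \<lbrakk>v \<in> insert s L; s \<le> v; v' \<in> L; v < v'\<rbrakk> \<Longrightarrow> v + e < v'"
    and e: "e > 0" "2 * e \<le> s"
    and dyn: "\<And>y. escape_rate g y = 0 \<Longrightarrow> joined f s (poly f y) (poly g y)"
  shows "level_equiv s f g"
proof -
  interpret F: monic_poly f by (rule f)
  interpret H: monic_poly g by (rule g)
  let ?K = "real (degree f) * ln (2 * B)"
  let ?T = "max s (2 * ?K)"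
  have s: "s > 0" using e by simp
  have K0: "?K \<ge> 0" using F.coeff_sum_ge1 B(1) by simp
  have cfg: "escape_rate g z \<le> escape_rate f z + e" if "norm z \<le> exp (?T + ?K)" for z
    using close[OF that] by linarith
  have cgf: "escape_rate f z \<le> escape_rate g z + e" if "norm z \<le> exp (?T + real (degree g) * ln (2 * B))" for z
    using close[of z] that deg by simp
  have small: "norm z \<le> exp (?T + ?K)" if "F.G z \<le> 0 \<or> H.G z \<le> 0" for z
  proof -
    have "logp z \<le> ?K"
      using that F.G_approx[OF B(1), where z = z and n = 0] H.G_approx[OF B(2), where z = z and n = 0] deg by auto
    then have "max 1 (norm z) \<le> exp ?K"
      unfolding logp_def by (subst (asm) ln_le_iff_le_exp) auto
    also have "exp ?K \<le> exp (?T + ?K)" using s by simp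
    finally show ?thesis by simp
  qed
  have gf: "F.G y \<le> e" if "H.G y = 0" for y using close[OF small[of y]] that by simp
  have fg: "H.G x \<le> e" if "F.G x = 0" for x using close[OF small[of x]] that by simp
  have transfer: "joined f t y y' \<longleftrightarrow> joined g t y y'" if y: "H.G y = 0" "H.G y' = 0" and t: "s \<le> t" for y y' t
  proof -
    have le: "F.G y \<le> s" "F.G y' \<le> s" "H.G y \<le> s" "H.G y' \<le> s" using gf y e by fastforce+
    show ?thesis
    proof
      assume "joined f t y y'"
      then show "joined g t y y'"
        by (intro joined_transfer[OF f g deg B cfg Lf Lg gap e(1) le s t]) auto
    next
      assume "joined g t y y'"
      then show "joined f t y y'"
        using joined_transfer[OF g f deg[symmetric] B(2,1) _ Lg Lf gap e(1) le(3,4,1,2) s t] cgf deg by simp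
    qed
  qed
  show ?thesis
  proof (rule level_equivI[of "\<lambda>x y. F.G x = 0 \<and> H.G y = 0 \<and> joined f s x y"])
    show "\<exists>y. F.G x = 0 \<and> H.G y = 0 \<and> joined f s x y" if x: "F.G x = 0" for x
    proof -
      obtain y where y: "H.G y = 0" "joined g e x y" by (rule H.joined_zero[OF fg[OF x]])
      \<comment> \<open>One e bounds the height of x for g, another is lost in returning from g to
        f; hence the condition 2 e \<le> s.\<close>
      have "joined f (e + e) x y"
        by (rule joined_near[OF g B(2) _ y(2), where T = ?T]) (use cgf e in auto)
      then have "joined f s x y" by (rule joined_mono) (use e in simp)
      then show ?thesis using x y by blast
    qed
    show "\<exists>x. F.G x = 0 \<and> H.G y = 0 \<and> joined f s x y" if y: "H.G y = 0" for y
    proof -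
      obtain x where x: "F.G x = 0" "joined f e y x" by (rule F.joined_zero[OF gf[OF y]])
      have "joined f s x y" using joined_sym[OF x(2)] by (rule joined_mono) (use e in simp)
      then show ?thesis using x y by blast
    qed
    show "joined f t x x' \<longleftrightarrow> joined g t y y'"
      if xy: "F.G x = 0 \<and> H.G y = 0 \<and> joined f s x y" and xy': "F.G x' = 0 \<and> H.G y' = 0 \<and> joined f s x' y'"
        and t: "s \<le> t" for x x' y y' t
    proof -
      have 1: "joined f t x y" "joined f t x' y'" using xy xy' t joined_mono by blast+
      have "joined f t x x' \<longleftrightarrow> joined f t y y'"
        using 1 joined_trans[of f t] joined_sym[of f t] by meson
      then show ?thesis using transfer xy xy' t by blast
    qed
    show "joined g (real (degree f) * s) (poly g y) y'"
      if xy: "F.G x = 0 \<and> H.G y = 0 \<and> joined f s x y"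
        and xy': "F.G (poly f x) = 0 \<and> H.G y' = 0 \<and> joined f s (poly f x) y'" for x y y'
    proof -
      \<comment> \<open>For f at level d s, the point g y is joined to f y by \<open>dyn\<close>, f
        y to f x by applying f, and f x to \<open>y'\<close> by the relation; the outcome is then
        transferred to g.\<close>
      have ds: "s \<le> real (degree f) * s" using level_le[OF _ F.deg2, of s] s by simp
      have "joined f (real (degree f) * s) (poly f x) (poly f y)" using xy F.joined_poly by blast
      moreover have "joined f (real (degree f) * s) (poly f y) (poly g y)" "joined f (real (degree f) * s) (poly f x) y'"
        using joined_mono[OF dyn ds] xy joined_mono[OF _ ds] xy' by blast+
      ultimately have "joined f (real (degree f) * s) (poly g y) y'"
        using joined_trans[of f "real (degree f) * s"] joined_sym[of f "real (degree f) * s"] by meson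
      then show ?thesis using transfer[OF H.G_poly_0 _ ds] xy xy' by blast
    qed
  qed auto
qed

text \<open>Over a possibly uncountable index set Tychonoff's theorem yields a cluster point rather
  than a convergent subsequence. Testing two coordinates at a common n is enough, since each
  condition to be passed to the limit involves two of them.\<close>

lemma product_cluster_point:
  fixes \<Phi> :: "nat \<Rightarrow> 'i \<Rightarrow> complex"
  assumes A: "\<And>i. compact (A i)" and mem: "\<And>n i. \<Phi> n i \<in> A i"
  obtains \<Psi> where "\<And>i. \<Psi> i \<in> A i"
    "\<And>i j U V N. \<lbrakk>open U; open V; \<Psi> i \<in> U; \<Psi> j \<in> V\<rbrakk> \<Longrightarrow> \<exists>n\<ge>N. \<Phi> n i \<in> U \<and> \<Phi> n j \<in> V"
proof -
  have "compactin (product_topology (\<lambda>_. euclidean) UNIV) (PiE UNIV A)"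
    unfolding compactin_PiE using A by simp
  then have "compact (PiE UNIV A)" by (simp add: euclidean_product_topology)
  moreover have "filtermap \<Phi> sequentially \<noteq> bot" by (simp add: filtermap_bot_iff)
  moreover have "eventually (\<lambda>h. h \<in> PiE UNIV A) (filtermap \<Phi> sequentially)"
    using mem by (auto simp: eventually_filtermap PiE_iff)
  ultimately obtain \<Psi> where \<Psi>: "\<Psi> \<in> PiE UNIV A" "inf (nhds \<Psi>) (filtermap \<Phi> sequentially) \<noteq> bot"
    unfolding compact_filter by blast
  show ?thesis
  proof (rule that[of \<Psi>])
    show "\<Psi> i \<in> A i" for i using \<Psi>(1) by auto
    fix i j U V and N :: nat assume UV: "open U" "open V" "\<Psi> i \<in> U" "\<Psi> j \<in> V"
    have op: "open ((\<lambda>h. h i) -` W)" if "open W" for i and W :: "complex set"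
      using that continuous_on_product_coordinates[of i] by (intro open_vimage) auto
    have opUV: "open ((\<lambda>h. h i) -` U \<inter> (\<lambda>h. h j) -` V)" by (intro open_Int op UV(1,2))
    have ev: "eventually (\<lambda>h. h i \<in> U \<and> h j \<in> V) (nhds \<Psi>)"
      unfolding eventually_nhds
      by (rule exI[of _ "(\<lambda>h. h i) -` U \<inter> (\<lambda>h. h j) -` V"]) (use opUV UV(3,4) in simp)
    show "\<exists>n\<ge>N. \<Phi> n i \<in> U \<and> \<Phi> n j \<in> V"
    proof (rule ccontr)
      assume "\<not> ?thesis"
      then have "eventually (\<lambda>h. \<not> (h i \<in> U \<and> h j \<in> V)) (filtermap \<Phi> sequentially)"
        unfolding eventually_filtermap eventually_sequentially by blast
      then have "eventually (\<lambda>h. False) (inf (nhds \<Psi>) (filtermap \<Phi> sequentially))"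
        unfolding eventually_inf using ev by blast
      then show False using \<Psi>(2) by (simp add: trivial_limit_def)
    qed
  qed
qed

lemma (in monic_poly) joined_nbhd:
  assumes "G y < t"
  obtains U where "open U" "y \<in> U" "\<And>z. z \<in> U \<Longrightarrow> joined f t y z"
proof -
  have "y \<in> {w. G w < t}" using assms by simp
  then obtain e where e: "e > 0" "ball y e \<subseteq> {w. G w < t}" using open_lt by (meson openE)
  have "joined f t y z" if z: "z \<in> ball y e" for z
  proof (rule joinedI[OF connected_ball])
    show "G w \<le> t" if "w \<in> ball y e" for w using e(2) that by auto
  qed (use e z in auto)
  then show ?thesis using that[of "ball y e"] e(1) by auto
qed

text \<open>Relations at the levels 1/(n+1) are turned into maps by choice, and a cluster point of
  these maps is taken. The points joined to y at a level t above its height form a neighbourhood of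
  y, so conditions at a level t > 0 survive; level 0 follows by \<open>joined_Inf\<close>.\<close>

lemma tree_equiv_of_level_equiv:
  assumes f: "monic_poly f" and g: "monic_poly g" and deg: "degree f = degree g"
    and eq: "\<And>s. s > 0 \<Longrightarrow> level_equiv s f g"
  shows "tree_equiv (poly_tree f) (poly_tree g)"
proof -
  interpret F: monic_poly f by (rule f)
  interpret H: monic_poly g by (rule g)
  define \<sigma> where "\<sigma> n = 1 / real (Suc n)" for n
  have \<sigma>: "\<sigma> n > 0" for n by (simp add: \<sigma>_def)
  have \<sigma>_le: "\<exists>N. \<forall>n\<ge>N. \<sigma> n \<le> t" if t: "t > 0" for t
  proof -
    obtain N where N: "inverse (real (Suc N)) < t" using reals_Archimedean[OF t] by auto
    have "\<sigma> n \<le> t" if "n \<ge> N" for n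
    proof -
      have "1 / real (Suc n) \<le> 1 / real (Suc N)" using that by (simp add: frac_le)
      then show ?thesis using N by (simp add: \<sigma>_def inverse_eq_divide)
    qed
    then show ?thesis by blast
  qed
  define Q where "Q n R \<longleftrightarrow> (\<forall>x y. R x y \<longrightarrow> F.G x = 0 \<and> H.G y = 0) \<and>
     (\<forall>x. F.G x = 0 \<longrightarrow> (\<exists>y. R x y)) \<and> (\<forall>y. H.G y = 0 \<longrightarrow> (\<exists>x. R x y)) \<and>
     (\<forall>x x' y y' t. R x y \<longrightarrow> R x' y' \<longrightarrow> \<sigma> n \<le> t \<longrightarrow> (joined f t x x' \<longleftrightarrow> joined g t y y')) \<and>
     (\<forall>x y y'. R x y \<longrightarrow> R (poly f x) y' \<longrightarrow> joined g (real (degree f) * \<sigma> n) (poly g y) y')" for n R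
  have "\<exists>R. Q n R" for n
    using eq[OF \<sigma>[of n]] unfolding level_equiv_def Q_def .
  then obtain R where QR: "\<And>n. Q n (R n)" by metis
  note QR' = QR[unfolded Q_def]
  have R: "\<And>n x y. R n x y \<Longrightarrow> F.G x = 0 \<and> H.G y = 0"
     "\<And>n x. F.G x = 0 \<Longrightarrow> \<exists>y. R n x y" "\<And>n y. H.G y = 0 \<Longrightarrow> \<exists>x. R n x y"
     "\<And>n x x' y y' t. \<lbrakk>R n x y; R n x' y'; \<sigma> n \<le> t\<rbrakk> \<Longrightarrow> joined f t x x' \<longleftrightarrow> joined g t y y'"
     "\<And>n x y y'. \<lbrakk>R n x y; R n (poly f x) y'\<rbrakk> \<Longrightarrow> joined g (real (degree f) * \<sigma> n) (poly g y) y'"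
    using QR' by (simp, simp, simp, blast, blast)
  define Yn where "Yn n x = (SOME y. R n x y)" for n x
  define Xn where "Xn n y = (SOME x. R n x y)" for n y
  have Yn: "R n x (Yn n x)" if "F.G x = 0" for n x
    unfolding Yn_def using R(2)[OF that] by (rule someI_ex)
  have Xn: "R n (Xn n y) y" if "H.G y = 0" for n y
    unfolding Xn_def using R(3)[OF that] by (rule someI_ex)
  \<comment> \<open>Both directions share one product, because surjectivity compares a value of
    \<open>Xn\<close> with a value of \<open>Yn\<close> at the same n. The default value 0 keeps the
    remaining coordinates in a compact set.\<close>
  define \<Phi> where "\<Phi> n i = (case i of Inl x \<Rightarrow> if F.G x = 0 then Yn n x else 0
      | Inr y \<Rightarrow> if H.G y = 0 then Xn n y else 0)" for n and i :: "complex + complex"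
  define A where "A i = (case i of Inl x \<Rightarrow> if F.G x = 0 then {y. H.G y \<le> 0} else {0}
      | Inr y \<Rightarrow> if H.G y = 0 then {x. F.G x \<le> 0} else {0})" for i :: "complex + complex"
  have "compact (A i)" for i
    unfolding A_def using F.compact_le H.compact_le by (auto split: sum.split)
  moreover have "\<Phi> n i \<in> A i" for n i
    unfolding A_def \<Phi>_def using R(1)[OF Yn] R(1)[OF Xn] by (auto split: sum.split)
  ultimately obtain \<Psi> where \<Psi>: "\<And>i. \<Psi> i \<in> A i"
    "\<And>i j U V N. \<lbrakk>open U; open V; \<Psi> i \<in> U; \<Psi> j \<in> V\<rbrakk> \<Longrightarrow> \<exists>n\<ge>N. \<Phi> n i \<in> U \<and> \<Phi> n j \<in> V"
    by (rule product_cluster_point) (rule that)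
  define Y where "Y x = \<Psi> (Inl x)" for x
  define X where "X y = \<Psi> (Inr y)" for y
  have Y: "H.G (Y x) = 0" if "F.G x = 0" for x
    using \<Psi>(1)[of "Inl x"] that H.G_nonneg[of "Y x"] by (simp add: A_def Y_def)
  have X: "F.G (X y) = 0" if "H.G y = 0" for y
    using \<Psi>(1)[of "Inr y"] that F.G_nonneg[of "X y"] by (simp add: A_def X_def)
  have pos: "joined f t x x' \<longleftrightarrow> joined g t (Y x) (Y x')"
    if x: "F.G x = 0" "F.G x' = 0" and t: "t > 0" for x x' t
  proof -
    obtain U where U: "open U" "Y x \<in> U" "\<And>z. z \<in> U \<Longrightarrow> joined g t (Y x) z"
      by (rule H.joined_nbhd[of "Y x" t]) (use Y[OF x(1)] t in simp, rule that)
    obtain V where V: "open V" "Y x' \<in> V" "\<And>z. z \<in> V \<Longrightarrow> joined g t (Y x') z"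
      by (rule H.joined_nbhd[of "Y x'" t]) (use Y[OF x(2)] t in simp, rule that)
    obtain N where N: "\<And>n. n \<ge> N \<Longrightarrow> \<sigma> n \<le> t" using \<sigma>_le[OF t] by blast
    obtain n where n: "n \<ge> N" "\<Phi> n (Inl x) \<in> U" "\<Phi> n (Inl x') \<in> V"
      using \<Psi>(2)[OF U(1) V(1), of "Inl x" "Inl x'" N] U(2) V(2) unfolding Y_def by blast
    have "Yn n x \<in> U" "Yn n x' \<in> V" using n(2,3) x by (simp_all add: \<Phi>_def)
    then have j: "joined g t (Y x) (Yn n x)" "joined g t (Y x') (Yn n x')" using U(3) V(3) by blast+
    have "joined f t x x' \<longleftrightarrow> joined g t (Yn n x) (Yn n x')"
      using R(4)[OF Yn[OF x(1)] Yn[OF x(2)] N[OF n(1)]] .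
    also have "\<dots> \<longleftrightarrow> joined g t (Y x) (Y x')"
      using j joined_trans[of g t] joined_sym[of g t] by meson
    finally show ?thesis .
  qed
  show ?thesis
  proof (rule tree_equivI[OF f g deg, of Y])
    show "joined f t x x' \<longleftrightarrow> joined g t (Y x) (Y x')"
      if x: "F.G x = 0" "F.G x' = 0" and t: "0 \<le> t" for x x' t
    proof (cases "t > 0")
      case False
      then have t0: "t = 0" using t by simp
      have "joined f 0 x x' \<longleftrightarrow> (\<forall>u>0. joined f u x x')"
        using F.joined_Inf[of 0 x x'] joined_mono[of f 0 x x'] by (meson less_imp_le)
      moreover have "joined g 0 (Y x) (Y x') \<longleftrightarrow> (\<forall>u>0. joined g u (Y x) (Y x'))"
        using H.joined_Inf[of 0 "Y x" "Y x'"] joined_mono[of g 0 "Y x" "Y x'"] by (meson less_imp_le)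
      ultimately show ?thesis using pos[OF x] t0 by simp
    qed (rule pos[OF x])
    show "joined g 0 (poly g (Y x)) (Y (poly f x))" if x: "F.G x = 0" for x
    proof (rule H.joined_Inf)
      fix t :: real assume t: "0 < t"
      have fx: "F.G (poly f x) = 0" using F.G_poly_0[OF x] .
      have d0: "real (degree f) > 0" "real (degree g) > 0" using F.deg2 deg by auto
      \<comment> \<open>Applying g multiplies levels by the degree, hence the level t / degree
        here.\<close>
      obtain U where U: "open U" "Y x \<in> U" "\<And>z. z \<in> U \<Longrightarrow> joined g (t / degree g) (Y x) z"
        by (rule H.joined_nbhd[of "Y x" "t / degree g"]) (use Y[OF x] t d0 in simp, rule that)
      obtain V where V: "open V" "Y (poly f x) \<in> V" "\<And>z. z \<in> V \<Longrightarrow> joined g t (Y (poly f x)) z"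
        by (rule H.joined_nbhd[of "Y (poly f x)" t]) (use Y[OF fx] t in simp, rule that)
      obtain N where N: "\<And>n. n \<ge> N \<Longrightarrow> \<sigma> n \<le> t / degree f" using \<sigma>_le[of "t / degree f"] t d0 by auto
      obtain n where n: "n \<ge> N" "\<Phi> n (Inl x) \<in> U" "\<Phi> n (Inl (poly f x)) \<in> V"
        using \<Psi>(2)[OF U(1) V(1), of "Inl x" "Inl (poly f x)" N] U(2) V(2) unfolding Y_def by blast
      have "Yn n x \<in> U" "Yn n (poly f x) \<in> V" using n(2,3) x fx by (simp_all add: \<Phi>_def)
      then have j: "joined g (t / degree g) (Y x) (Yn n x)" "joined g t (Y (poly f x)) (Yn n (poly f x))"
        using U(3) V(3) by blast+
      have 1: "joined g t (poly g (Y x)) (poly g (Yn n x))"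
        using H.joined_poly[OF j(1)] d0 by simp
      have "real (degree f) * \<sigma> n \<le> t" using N[OF n(1)] d0 by (simp add: field_simps)
      then have "joined g t (poly g (Yn n x)) (Yn n (poly f x))"
        using joined_mono[OF R(5)[OF Yn[OF x] Yn[OF fx]]] by blast
      then show "joined g t (poly g (Y x)) (Y (poly f x))"
        using 1 joined_trans[of g t] joined_sym[OF j(2)] by meson
    qed
    show "\<exists>x. F.G x = 0 \<and> joined g 0 (Y x) u" if u: "H.G u = 0" for u
    \<comment> \<open>The witness is the cluster value of the points matched with u; at each t > 0 a
      common n links its image under \<open>Y\<close> to u.\<close>
    proof (rule exI[of _ "X u"], rule conjI[OF X[OF u]], rule H.joined_Inf)
      fix t :: real assume t: "0 < t"
      let ?x = "X u"
      obtain U where U: "open U" "?x \<in> U" "\<And>z. z \<in> U \<Longrightarrow> joined f t ?x z"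
        by (rule F.joined_nbhd[of ?x t]) (use X[OF u] t in simp, rule that)
      obtain V where V: "open V" "Y ?x \<in> V" "\<And>z. z \<in> V \<Longrightarrow> joined g t (Y ?x) z"
        by (rule H.joined_nbhd[of "Y ?x" t]) (use Y[OF X[OF u]] t in simp, rule that)
      obtain N where N: "\<And>n. n \<ge> N \<Longrightarrow> \<sigma> n \<le> t" using \<sigma>_le[OF t] by blast
      have "\<Psi> (Inr u) \<in> U" "\<Psi> (Inl ?x) \<in> V" using U(2) V(2) by (simp_all add: X_def Y_def)
      then obtain n where n: "n \<ge> N" "\<Phi> n (Inr u) \<in> U" "\<Phi> n (Inl ?x) \<in> V"
        using \<Psi>(2)[OF U(1) V(1), of "Inr u" "Inl ?x" N] by blast
      have "Xn n u \<in> U" "Yn n ?x \<in> V" using n(2,3) u X[OF u] by (simp_all add: \<Phi>_def)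
      then have j: "joined f t ?x (Xn n u)" "joined g t (Y ?x) (Yn n ?x)" using U(3) V(3) by blast+
      have "joined f t ?x (Xn n u) \<longleftrightarrow> joined g t (Yn n ?x) u"
        using R(4)[OF Yn[OF X[OF u]] Xn[OF u] N[OF n(1)]] .
      then show "joined g t (Y ?x) u" using j joined_trans by blast
    qed
  qed (rule Y)
qed

section \<open>The space of monic centered polynomials\<close>

lemma monic_centered_poly:
  assumes "f \<in> monic_centered d" "d \<ge> 2"
  shows "monic_poly f" "degree f = d" "coeff f d = 1" "coeff f (d - 1) = 0" "\<And>i. i > d \<Longrightarrow> coeff f i = 0"
proof -
  have *: "degree f = d" "lead_coeff f = 1" "coeff f (d - 1) = 0"
    using assms(1) by (auto simp: monic_centered_def)
  then show "monic_poly f" using assms(2) by unfold_locales auto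
  show "degree f = d" "coeff f d = 1" "coeff f (d - 1) = 0" using * by auto
  show "coeff f i = 0" if "i > d" for i using that *(1) coeff_eq_0 by blast
qed

lemma monic_centered_coeff_cases:
  assumes "f \<in> monic_centered d" "d \<ge> 2"
  shows "i < d - 1 \<or> coeff f i = (if i = d then 1 else 0)"
proof -
  have "i < d - 1 \<or> i = d - 1 \<or> i = d \<or> i > d" by linarith
  then show ?thesis using monic_centered_poly[OF assms] by auto
qed

lemma monic_centered_eqI:
  assumes "f \<in> monic_centered d" "g \<in> monic_centered d" "d \<ge> 2" "\<And>i. i < d - 1 \<Longrightarrow> coeff f i = coeff g i"
  shows "f = g"
proof (rule poly_eqI)
  fix i show "coeff f i = coeff g i"
    using monic_centered_coeff_cases[OF assms(1,3), of i] monic_centered_coeff_cases[OF assms(2,3), of i] assms(4)[of i]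
    by auto
qed

lemma monic_centered_exists:
  assumes "d \<ge> 2"
  obtains f where "f \<in> monic_centered d" "\<And>i. i < d - 1 \<Longrightarrow> coeff f i = a i"
proof -
  define f where "f = monom 1 d + (\<Sum>i<d-1. monom (a i) i)"
  have c: "coeff f i = (if i = d then 1 else 0) + (if i < d - 1 then a i else 0)" for i
    by (auto simp: f_def coeff_sum)
  have "degree f = d"
  proof (rule antisym)
    show "degree f \<le> d" by (rule degree_le) (auto simp: c)
    show "d \<le> degree f" by (rule le_degree) (auto simp: c)
  qed
  then have "f \<in> monic_centered d" using assms by (auto simp: monic_centered_def c)
  then show ?thesis using that c assms by auto
qed

lemma topspace_poly_space: "topspace (poly_space d) = monic_centered d"
  by (auto simp: poly_space_def topspace_pullback_topology topspace_product_topology)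

text \<open>There are finitely many coordinates, so basic boxes of the product may be taken with one
  common radius.\<close>

lemma openin_poly_space_iff:
  "openin (poly_space d) U \<longleftrightarrow> U \<subseteq> monic_centered d \<and>
     (\<forall>f\<in>U. \<exists>e>0. \<forall>g\<in>monic_centered d. (\<forall>i<d-1. dist (coeff g i) (coeff f i) < e) \<longrightarrow> g \<in> U)"
  (is "_ \<longleftrightarrow> ?R")
proof
  let ?r = "\<lambda>f :: complex poly. restrict (coeff f) {..<d-1}"
  assume "openin (poly_space d) U"
  then obtain V where V: "openin (product_topology (\<lambda>_. euclidean :: complex topology) {..<d-1}) V"
      "U = ?r -` V \<inter> monic_centered d"
    unfolding poly_space_def openin_pullback_topology by blast
  show ?R
  proof (intro conjI ballI)
    show "U \<subseteq> monic_centered d" using V(2) by blast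
    fix f assume f: "f \<in> U"
    then have "?r f \<in> V" using V(2) by blast
    then have "\<exists>W. (\<forall>i\<in>{..<d-1}. open (W i)) \<and> ?r f \<in> Pi\<^sub>E {..<d-1} W \<and> Pi\<^sub>E {..<d-1} W \<subseteq> V"
      using V(1) unfolding openin_product_topology_alt open_openin[symmetric] by blast
    then obtain W where W': "\<forall>i\<in>{..<d-1}. open (W i)" "?r f \<in> Pi\<^sub>E {..<d-1} W" "Pi\<^sub>E {..<d-1} W \<subseteq> V"
      by blast
    then have W: "\<And>i. i < d - 1 \<Longrightarrow> open (W i)" "?r f \<in> Pi\<^sub>E {..<d-1} W" "Pi\<^sub>E {..<d-1} W \<subseteq> V"
      by simp_all
    have "\<exists>e>0. ball (coeff f i) e \<subseteq> W i" if "i < d - 1" for i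
    proof -
      have "coeff f i \<in> W i" using W(2) that by (auto simp: PiE_iff)
      then show ?thesis using W(1)[OF that] by (meson openE)
    qed
    then obtain e where e: "\<And>i. i < d - 1 \<Longrightarrow> e i > 0 \<and> ball (coeff f i) (e i) \<subseteq> W i" by metis
    define e0 where "e0 = Min (insert 1 (e ` {..<d-1}))"
    have e0: "e0 > 0" "\<And>i. i < d - 1 \<Longrightarrow> e0 \<le> e i" unfolding e0_def using e by auto
    have "g \<in> U" if g: "g \<in> monic_centered d" "\<forall>i<d-1. dist (coeff g i) (coeff f i) < e0" for g
    proof -
      have "coeff g i \<in> W i" if "i < d - 1" for i
        using e[OF that] e0(2)[OF that] g(2) that by (auto simp: dist_commute subset_iff)
      then have "?r g \<in> Pi\<^sub>E {..<d-1} W" by auto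
      then show ?thesis using W(3) V(2) g(1) by blast
    qed
    then show "\<exists>e>0. \<forall>g\<in>monic_centered d. (\<forall>i<d-1. dist (coeff g i) (coeff f i) < e) \<longrightarrow> g \<in> U"
      using e0(1) by blast
  qed
next
  let ?r = "\<lambda>f :: complex poly. restrict (coeff f) {..<d-1}"
  assume R: ?R
  define box where "box f e = Pi\<^sub>E {..<d-1} (\<lambda>i. ball (coeff f i) e)" for f :: "complex poly" and e
  define V where "V = \<Union>{box f e |f e. f \<in> U \<and> ?r -` box f e \<inter> monic_centered d \<subseteq> U}"
  have op: "openin (product_topology (\<lambda>_. euclidean :: complex topology) {..<d-1}) (box f e)" for f e
  proof -
    have "finite {i \<in> {..<d-1}. ball (coeff f i) e \<noteq> topspace (euclidean :: complex topology)}"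
      by (rule finite_subset[of _ "{..<d-1}"]) auto
    then show ?thesis unfolding box_def openin_PiE_gen by simp
  qed
  have "openin (product_topology (\<lambda>_. euclidean :: complex topology) {..<d-1}) V"
    unfolding V_def by (rule openin_Union) (use op in auto)
  moreover have "U = ?r -` V \<inter> monic_centered d"
  proof (intro equalityI subsetI)
    fix f assume f: "f \<in> U"
    then obtain e where e: "e > 0" "\<And>g. \<lbrakk>g \<in> monic_centered d; \<forall>i<d-1. dist (coeff g i) (coeff f i) < e\<rbrakk> \<Longrightarrow> g \<in> U"
      using R by blast
    have "?r -` box f e \<inter> monic_centered d \<subseteq> U"
    proof
      fix g assume g: "g \<in> ?r -` box f e \<inter> monic_centered d"
      then have "dist (coeff g i) (coeff f i) < e" if "i < d - 1" for i
        using that by (auto simp: box_def PiE_iff dist_commute)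
      then show "g \<in> U" using e(2) g by blast
    qed
    moreover have "?r f \<in> box f e" using e(1) by (auto simp: box_def)
    ultimately have "?r f \<in> V" unfolding V_def using f by blast
    then show "f \<in> ?r -` V \<inter> monic_centered d" using f R by blast
  next
    fix f assume "f \<in> ?r -` V \<inter> monic_centered d"
    then show "f \<in> U" unfolding V_def by blast
  qed
  ultimately show "openin (poly_space d) U"
    unfolding poly_space_def openin_pullback_topology by blast
qed

text \<open>The topology is first countable, so neighbourhoods can be tested on sequences.\<close>

lemma coeff_nbhd_seqI:
  assumes d: "d \<ge> 2" and f: "f \<in> monic_centered d"
    and seq: "\<And>F. \<lbrakk>\<And>n. F n \<in> monic_centered d; \<And>i. (\<lambda>n. coeff (F n) i) \<longlonglongrightarrow> coeff f i\<rbrakk> \<Longrightarrow> \<exists>n. P (F n)"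
  shows "\<exists>e>0. \<forall>g\<in>monic_centered d. (\<forall>i<d-1. dist (coeff g i) (coeff f i) < e) \<longrightarrow> P g"
proof (rule ccontr)
  assume no: "\<not> ?thesis"
  have "\<exists>g. g \<in> monic_centered d \<and> (\<forall>i<d-1. dist (coeff g i) (coeff f i) < 1 / real (Suc n)) \<and> \<not> P g" for n
    using no[simplified, rule_format, of "1 / real (Suc n)"] by auto
  then obtain F where F: "\<And>n. F n \<in> monic_centered d" "\<And>n i. i < d - 1 \<Longrightarrow> dist (coeff (F n) i) (coeff f i) < 1 / real (Suc n)"
      "\<And>n. \<not> P (F n)"
    by metis
  have "(\<lambda>n. coeff (F n) i) \<longlonglongrightarrow> coeff f i" for i
  proof (cases "i < d - 1")
    case True
    show ?thesis
    proof (rule metric_tendsto_imp_tendsto[of "\<lambda>n. 1 / real (Suc n)" 0])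
      show "(\<lambda>n. 1 / real (Suc n)) \<longlonglongrightarrow> 0" by (rule LIMSEQ_Suc[OF lim_1_over_n])
      show "\<forall>\<^sub>F n in sequentially. dist (coeff (F n) i) (coeff f i) \<le> dist (1 / real (Suc n)) 0"
        using F(2)[OF True] by (intro always_eventually allI) (simp add: less_imp_le)
    qed
  next
    case False
    then have "coeff (F n) i = coeff f i" for n
      using monic_centered_coeff_cases[OF F(1) d, of i] monic_centered_coeff_cases[OF f d, of i] by auto
    then show ?thesis by simp
  qed
  then have "\<exists>n. P (F n)" by (rule seq[OF F(1)])
  then show False using F(3) by blast
qed

lemma openin_poly_space_seqI:
  assumes d: "d \<ge> 2" and U: "U \<subseteq> monic_centered d"
    and seq: "\<And>f F. \<lbrakk>f \<in> U; \<And>n. F n \<in> monic_centered d; \<And>i. (\<lambda>n. coeff (F n) i) \<longlonglongrightarrow> coeff f i\<rbrakk>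
        \<Longrightarrow> \<exists>n. F n \<in> U"
  shows "openin (poly_space d) U"
  unfolding openin_poly_space_iff
  by (intro conjI U ballI coeff_nbhd_seqI[OF d]) (use U seq in blast)+

lemma openin_poly_space_eventually:
  assumes U: "openin (poly_space d) U" "f \<in> U" and F: "\<And>n. F n \<in> monic_centered d"
    and lim: "\<And>i. (\<lambda>n. coeff (F n) i) \<longlonglongrightarrow> coeff f i"
  shows "eventually (\<lambda>n. F n \<in> U) sequentially"
proof -
  obtain e where e: "e > 0" "\<And>g. \<lbrakk>g \<in> monic_centered d; \<forall>i<d-1. dist (coeff g i) (coeff f i) < e\<rbrakk> \<Longrightarrow> g \<in> U"
    using U unfolding openin_poly_space_iff by meson
  have "eventually (\<lambda>n. \<forall>i\<in>{..<d-1}. dist (coeff (F n) i) (coeff f i) < e) sequentially"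
    using lim e(1) by (intro eventually_ball_finite ballI tendstoD) auto
  then show ?thesis by eventually_elim (use e(2) F in auto)
qed

lemma continuous_map_poly_space_seqI:
  fixes D :: "complex poly \<Rightarrow> 'b::topological_space"
  assumes d: "d \<ge> 2"
    and seq: "\<And>f F. \<lbrakk>f \<in> monic_centered d; \<And>n. F n \<in> monic_centered d; \<And>i. (\<lambda>n. coeff (F n) i) \<longlonglongrightarrow> coeff f i\<rbrakk>
        \<Longrightarrow> (\<lambda>n. D (F n)) \<longlonglongrightarrow> D f"
  shows "continuous_map (poly_space d) euclidean D"
  unfolding continuous_map_def
proof (intro conjI allI impI)
  fix V :: "'b set" assume "openin euclidean V"
  then have V: "open V" by simp
  show "openin (poly_space d) {f \<in> topspace (poly_space d). D f \<in> V}"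
  proof (rule openin_poly_space_seqI[OF d])
    fix f F assume f: "f \<in> {f \<in> topspace (poly_space d). D f \<in> V}"
      and F: "\<And>n. F n \<in> monic_centered d" "\<And>i. (\<lambda>n. coeff (F n) i) \<longlonglongrightarrow> coeff f i"
    have "(\<lambda>n. D (F n)) \<longlonglongrightarrow> D f" using seq[OF _ F] f by (simp add: topspace_poly_space)
    then have "eventually (\<lambda>n. D (F n) \<in> V) sequentially" using V f by (intro topological_tendstoD) auto
    then obtain n where "D (F n) \<in> V" by (meson eventually_sequentially order_refl)
    then show "\<exists>n. F n \<in> {f \<in> topspace (poly_space d). D f \<in> V}"
      using F(1) by (auto simp: topspace_poly_space)
  qed (auto simp: topspace_poly_space)
qed auto

subsection \<open>Joint continuity of the escape rate\<close>

lemma coeff_sum_bounded: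
  assumes d: "d \<ge> 2" and F: "\<And>n. F n \<in> monic_centered d" and lim: "\<And>i. (\<lambda>n. coeff (F n) i) \<longlonglongrightarrow> coeff f i"
    and f: "f \<in> monic_centered d"
  obtains B where "coeff_sum f \<le> B" "\<And>n. coeff_sum (F n) \<le> B"
proof -
  have "(\<lambda>n. coeff_sum (F n)) \<longlonglongrightarrow> coeff_sum f"
    unfolding coeff_sum_def monic_centered_poly(2)[OF F d] monic_centered_poly(2)[OF f d]
    by (intro tendsto_intros lim)
  then have "Bseq (\<lambda>n. coeff_sum (F n))" using convergent_imp_Bseq convergentI by blast
  then obtain K where "\<And>n. norm (coeff_sum (F n)) \<le> K" by (auto simp: Bseq_def)
  then have "coeff_sum f \<le> max K (coeff_sum f)" "\<And>n. coeff_sum (F n) \<le> max K (coeff_sum f)"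
    by (auto simp: le_max_iff_disj abs_le_iff)
  then show ?thesis by (rule that)
qed

lemma tendsto_poly_seq:
  assumes d: "d \<ge> 2" and F: "\<And>n. F n \<in> monic_centered d" and lim: "\<And>i. (\<lambda>n. coeff (F n) i) \<longlonglongrightarrow> coeff f i"
    and f: "f \<in> monic_centered d" and w: "w \<longlonglongrightarrow> z"
  shows "(\<lambda>n. poly (F n) (w n)) \<longlonglongrightarrow> poly f z"
  unfolding poly_altdef monic_centered_poly(2)[OF F d] monic_centered_poly(2)[OF f d]
  by (intro tendsto_intros lim w)

lemma tendsto_funpow_seq:
  assumes d: "d \<ge> 2" and F: "\<And>n. F n \<in> monic_centered d" and lim: "\<And>i. (\<lambda>n. coeff (F n) i) \<longlonglongrightarrow> coeff f i"
    and f: "f \<in> monic_centered d" and w: "w \<longlonglongrightarrow> z"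
  shows "(\<lambda>n. (poly (F n) ^^ k) (w n)) \<longlonglongrightarrow> (poly f ^^ k) z"
  by (induction k) (use w tendsto_poly_seq[OF d F lim f] in auto)

text \<open>A common bound for \<open>coeff_sum\<close> makes the approximation through the k-th
  iterate uniform along the sequence, and for fixed k the approximant is continuous in the
  polynomial and the point together.\<close>

lemma tendsto_escape_rate:
  assumes d: "d \<ge> 2" and F: "\<And>n. F n \<in> monic_centered d" and lim: "\<And>i. (\<lambda>n. coeff (F n) i) \<longlonglongrightarrow> coeff f i"
    and f: "f \<in> monic_centered d" and w: "w \<longlonglongrightarrow> z"
  shows "(\<lambda>n. escape_rate (F n) (w n)) \<longlonglongrightarrow> escape_rate f z"
proof (rule LIMSEQ_I)
  fix e :: real assume e: "e > 0"
  obtain B where B: "coeff_sum f \<le> B" "\<And>n. coeff_sum (F n) \<le> B"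
    using coeff_sum_bounded[OF d F lim f] by metis
  note mf = monic_centered_poly(1,2)[OF f d]
  note mF = monic_centered_poly(1,2)[OF F d]
  define K where "K = d * ln (2 * B)"
  have "(\<lambda>k. K / real (d ^ k)) \<longlonglongrightarrow> 0"
    using monic_poly.bound_tendsto_0[OF mf(1)] mf(2) by simp
  then have "eventually (\<lambda>k. K / real (d ^ k) < e / 3) sequentially"
    using e by (intro order_tendstoD(2)) auto
  then obtain k where k: "K / real (d ^ k) < e / 3" by (meson eventually_sequentially order_refl)
  have "isCont logp y" for y
    using continuous_on_logp[of UNIV "\<lambda>x. x"] by (simp add: continuous_on_eq_continuous_at continuous_on_id)
  then have "(\<lambda>n. logp ((poly (F n) ^^ k) (w n)) / d ^ k) \<longlonglongrightarrow> logp ((poly f ^^ k) z) / d ^ k"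
    using tendsto_funpow_seq[OF d F lim f w, of k] d
    by (intro tendsto_intros isCont_tendsto_compose[of _ logp]) auto
  then obtain N where N: "\<And>n. n \<ge> N \<Longrightarrow>
      norm (logp ((poly (F n) ^^ k) (w n)) / d ^ k - logp ((poly f ^^ k) z) / d ^ k) < e / 3"
    by (rule exE[OF LIMSEQ_D[of _ _ "e / 3"]]) (use e in auto)
  show "\<exists>N. \<forall>n\<ge>N. norm (escape_rate (F n) (w n) - escape_rate f z) < e"
  proof (intro exI allI impI)
    fix n assume n: "n \<ge> N"
    have 1: "\<bar>escape_rate (F n) (w n) - logp ((poly (F n) ^^ k) (w n)) / d ^ k\<bar> \<le> K / real (d ^ k)"
      using monic_poly.G_approx[OF mF(1) B(2), where z = "w n" and n = k] mF(2) unfolding K_def by simp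
    have 2: "\<bar>escape_rate f z - logp ((poly f ^^ k) z) / d ^ k\<bar> \<le> K / real (d ^ k)"
      using monic_poly.G_approx[OF mf(1) B(1), where z = z and n = k] mf(2) unfolding K_def by simp
    show "norm (escape_rate (F n) (w n) - escape_rate f z) < e"
      using 1 2 N[OF n] k unfolding real_norm_def by linarith
  qed
qed

lemma subseq_not_eventually:
  assumes "\<not> eventually P sequentially"
  shows "\<exists>r :: nat \<Rightarrow> nat. strict_mono r \<and> (\<forall>n. \<not> P (r n))"
proof -
  have "infinite {n. \<not> P n}"
    using assms unfolding infinite_nat_iff_unbounded_le eventually_sequentially by auto
  then show ?thesis using infinite_enumerate[of "{n. \<not> P n}"] by auto
qed

lemma bounded_seq_subseq:
  fixes w :: "nat \<Rightarrow> complex"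
  assumes "\<And>n. norm (w n) \<le> b"
  obtains r z where "strict_mono r" "(w \<circ> r) \<longlonglongrightarrow> z"
proof -
  have "seq_compact (cball (0::complex) b)" by (rule compact_imp_seq_compact) simp
  then show ?thesis using assms that unfolding seq_compact_def by (metis mem_cball_0)
qed

text \<open>Violating points in the disc would accumulate somewhere, against joint
  continuity.\<close>

lemma uniform_close:
  assumes d: "d \<ge> 2" and F: "\<And>n. F n \<in> monic_centered d" and lim: "\<And>i. (\<lambda>n. coeff (F n) i) \<longlonglongrightarrow> coeff f i"
    and f: "f \<in> monic_centered d" and e: "e > 0"
  shows "eventually (\<lambda>n. \<forall>z. norm z \<le> b \<longrightarrow> \<bar>escape_rate f z - escape_rate (F n) z\<bar> \<le> e) sequentially"
proof (rule ccontr)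
  assume "\<not> ?thesis"
  then have "\<exists>r :: nat \<Rightarrow> nat. strict_mono r \<and> (\<forall>n. \<not> (\<forall>z. norm z \<le> b \<longrightarrow> \<bar>escape_rate f z - escape_rate (F (r n)) z\<bar> \<le> e))"
    by (rule subseq_not_eventually)
  then obtain r :: "nat \<Rightarrow> nat" where r': "strict_mono r \<and> (\<forall>n. \<not> (\<forall>z. norm z \<le> b \<longrightarrow> \<bar>escape_rate f z - escape_rate (F (r n)) z\<bar> \<le> e))"
    by (rule exE)
  note r = r'[THEN conjunct1] r'[THEN conjunct2, THEN spec]
  have "\<exists>z. norm z \<le> b \<and> \<bar>escape_rate f z - escape_rate (F (r n)) z\<bar> > e" for n
    using r(2)[of n] by (simp add: not_le)
  then have "\<exists>w. \<forall>n. norm (w n) \<le> b \<and> \<bar>escape_rate f (w n) - escape_rate (F (r n)) (w n)\<bar> > e"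
    by (intro choice allI)
  then obtain w where w: "\<And>n. norm (w n) \<le> b" "\<And>n. \<bar>escape_rate f (w n) - escape_rate (F (r n)) (w n)\<bar> > e"
    by auto
  obtain q z where q: "strict_mono q" "(w \<circ> q) \<longlonglongrightarrow> z" by (rule bounded_seq_subseq[OF w(1)]) (rule that)
  have rq: "strict_mono (r \<circ> q)" using r(1) q(1) by (rule strict_mono_o)
  have "(\<lambda>n. escape_rate (F ((r \<circ> q) n)) ((w \<circ> q) n)) \<longlonglongrightarrow> escape_rate f z"
    by (rule tendsto_escape_rate[OF d _ _ f q(2)]) (use F LIMSEQ_subseq_LIMSEQ[OF lim rq] in \<open>auto simp: o_def\<close>)
  moreover have "(\<lambda>n. escape_rate f ((w \<circ> q) n)) \<longlonglongrightarrow> escape_rate f z"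
    using monic_poly.continuous_on_G[OF monic_centered_poly(1)[OF f d], of UNIV]
    by (intro isCont_tendsto_compose[OF _ q(2)]) (simp add: continuous_on_eq_continuous_at)
  ultimately have "(\<lambda>n. \<bar>escape_rate f ((w \<circ> q) n) - escape_rate (F ((r \<circ> q) n)) ((w \<circ> q) n)\<bar>) \<longlonglongrightarrow> \<bar>escape_rate f z - escape_rate f z\<bar>"
    by (intro tendsto_intros)
  then have "\<bar>escape_rate f z - escape_rate f z\<bar> \<ge> e"
    using w(2) by (intro LIMSEQ_le_const) (auto intro: less_imp_le)
  then show False using e by simp
qed

text \<open>Points y of the filled Julia sets of \<open>F n\<close> stay in a fixed disc and
  accumulate only at points z of the filled Julia set of f. There both images of y approach f z,
  which has a neighbourhood joined at level s.\<close>

lemma dynamics_close: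
  assumes d: "d \<ge> 2" and F: "\<And>n. F n \<in> monic_centered d" and lim: "\<And>i. (\<lambda>n. coeff (F n) i) \<longlonglongrightarrow> coeff f i"
    and f: "f \<in> monic_centered d" and s: "s > 0"
  shows "eventually (\<lambda>n. \<forall>y. escape_rate (F n) y = 0 \<longrightarrow> joined f s (poly f y) (poly (F n) y)) sequentially"
proof (rule ccontr)
  assume "\<not> ?thesis"
  then have "\<exists>r :: nat \<Rightarrow> nat. strict_mono r \<and> (\<forall>n. \<not> (\<forall>y. escape_rate (F (r n)) y = 0 \<longrightarrow> joined f s (poly f y) (poly (F (r n)) y)))"
    by (rule subseq_not_eventually)
  then obtain r :: "nat \<Rightarrow> nat" where r': "strict_mono r \<and> (\<forall>n. \<not> (\<forall>y. escape_rate (F (r n)) y = 0 \<longrightarrow> joined f s (poly f y) (poly (F (r n)) y)))"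
    by (rule exE)
  note r = r'[THEN conjunct1] r'[THEN conjunct2, THEN spec]
  have "\<exists>y. escape_rate (F (r n)) y = 0 \<and> \<not> joined f s (poly f y) (poly (F (r n)) y)" for n
    using r(2)[of n] by simp
  then have "\<exists>w. \<forall>n. escape_rate (F (r n)) (w n) = 0 \<and> \<not> joined f s (poly f (w n)) (poly (F (r n)) (w n))"
    by (intro choice allI)
  then obtain w where w: "\<And>n. escape_rate (F (r n)) (w n) = 0" "\<And>n. \<not> joined f s (poly f (w n)) (poly (F (r n)) (w n))"
    by auto
  obtain B where B: "coeff_sum f \<le> B" "\<And>n. coeff_sum (F n) \<le> B"
    using coeff_sum_bounded[OF d F lim f] by metis
  note mf = monic_centered_poly(1,2)[OF f d]
  note mF = monic_centered_poly(1,2)[OF F d]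
  have wb: "norm (w n) \<le> exp (d * ln (2 * B))" for n
  proof -
    have "logp (w n) \<le> d * ln (2 * B)"
      using monic_poly.G_approx[OF mF(1)[of "r n"] B(2)[of "r n"], where z = "w n" and n = 0] w(1)[of n] mF(2) by simp
    then have "max 1 (norm (w n)) \<le> exp (d * ln (2 * B))"
      unfolding logp_def by (subst (asm) ln_le_iff_le_exp) auto
    then show ?thesis by simp
  qed
  obtain q z where q: "strict_mono q" "(w \<circ> q) \<longlonglongrightarrow> z" by (rule bounded_seq_subseq[OF wb]) (rule that)
  have rq: "strict_mono (r \<circ> q)" using r(1) q(1) by (rule strict_mono_o)
  have limq: "(\<lambda>n. coeff (F ((r \<circ> q) n)) i) \<longlonglongrightarrow> coeff f i" for i
    using LIMSEQ_subseq_LIMSEQ[OF lim rq] by (simp add: o_def)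
  have "(\<lambda>n. escape_rate (F ((r \<circ> q) n)) ((w \<circ> q) n)) \<longlonglongrightarrow> escape_rate f z"
    by (rule tendsto_escape_rate[OF d F limq f q(2)])
  then have "escape_rate f z = 0" using w(1) by (simp add: o_def LIMSEQ_const_iff)
  then have "escape_rate f (poly f z) < s" using monic_poly.G_poly_0[OF mf(1)] s by simp
  then obtain U where U: "open U" "poly f z \<in> U" "\<And>y. y \<in> U \<Longrightarrow> joined f s (poly f z) y"
    by (rule monic_poly.joined_nbhd[OF mf(1)]) (rule that)
  have "(\<lambda>n. poly f ((w \<circ> q) n)) \<longlonglongrightarrow> poly f z" by (intro tendsto_intros q(2))
  then have ev1: "eventually (\<lambda>n. poly f ((w \<circ> q) n) \<in> U) sequentially" using U by (intro topological_tendstoD)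
  have "(\<lambda>n. poly (F ((r \<circ> q) n)) ((w \<circ> q) n)) \<longlonglongrightarrow> poly f z"
    by (rule tendsto_poly_seq[OF d F limq f q(2)])
  then have ev2: "eventually (\<lambda>n. poly (F ((r \<circ> q) n)) ((w \<circ> q) n) \<in> U) sequentially" using U by (intro topological_tendstoD)
  have "eventually (\<lambda>n. False) sequentially"
    using ev1 ev2
  proof eventually_elim
    case (elim n)
    have "joined f s (poly f ((w \<circ> q) n)) (poly (F ((r \<circ> q) n)) ((w \<circ> q) n))"
      using joined_trans[OF joined_sym[OF U(3)[OF elim(1)]] U(3)[OF elim(2)]] .
    then show ?case using w(2)[of "q n"] by simp
  qed
  then show False by simp
qed

lemma finite_gap:
  fixes S :: "real set"
  assumes "finite S"
  obtains e where "e > 0" "\<And>v w. \<lbrakk>v \<in> S; w \<in> S; v < w\<rbrakk> \<Longrightarrow> v + e < w"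
proof -
  define D where "D = {x \<in> (\<lambda>(v, w). w - v) ` (S \<times> S). 0 < x}"
  have "finite D" unfolding D_def using assms by simp
  define e where "e = Min (insert 1 D) / 2"
  have pos: "Min (insert 1 D) > 0" using \<open>finite D\<close> by (subst Min_gr_iff) (auto simp: D_def)
  have "v + e < w" if "v \<in> S" "w \<in> S" "v < w" for v w
  proof -
    have "w - v \<in> (\<lambda>(v, w). w - v) ` (S \<times> S)" using that by (intro image_eqI[of _ _ "(v, w)"]) auto
    then have "w - v \<in> D" unfolding D_def using that(3) by simp
    then have "Min (insert 1 D) \<le> w - v" using \<open>finite D\<close> by simp
    then show ?thesis using pos by (simp add: e_def)
  qed
  moreover have "e > 0" using pos by (simp add: e_def)
  ultimately show ?thesis using that[of e] by blast
qed

text \<open>Where components merge is controlled by the set of critical heights; multiplicities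
  return in \<open>height_mset\<close>.\<close>

definition height_set :: "complex poly \<Rightarrow> real set" where
  "height_set f = escape_rate f ` {c. poly (pderiv f) c = 0}"

lemma level_equiv_eventually:
  assumes d: "d \<ge> 2" and F: "\<And>n. F n \<in> monic_centered d" and lim: "\<And>i. (\<lambda>n. coeff (F n) i) \<longlonglongrightarrow> coeff f i"
    and f: "f \<in> monic_centered d" and heights: "\<And>n. height_set (F n) = height_set f" and s: "s > 0"
  shows "eventually (\<lambda>n. level_equiv s f (F n)) sequentially"
proof -
  note mf = monic_centered_poly(1,2)[OF f d]
  note mF = monic_centered_poly(1,2)[OF F d]
  obtain B where B: "coeff_sum f \<le> B" "\<And>n. coeff_sum (F n) \<le> B"
    using coeff_sum_bounded[OF d F lim f] by metis
  \<comment> \<open>If f^j(p) is critical of height h, then p has height h / d^j. This set is common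
    to f and all \<open>F n\<close>.\<close>
  define L where "L = {h / d ^ j |h j. h \<in> height_set f}"
  have "pderiv f \<noteq> 0" using mf(2) d by (simp add: pderiv_eq_0_iff)
  then have finH: "finite (height_set f)" unfolding height_set_def by (intro finite_imageI poly_roots_finite)
  \<comment> \<open>The condition h / d^j \<ge> s bounds d^j by H / s, so finitely many j
    remain.\<close>
  have finL: "finite {v \<in> L. v \<ge> s}"
  proof -
    obtain H where H: "\<And>h. h \<in> height_set f \<Longrightarrow> h \<le> H"
      using finH by (metis Max_ge)
    obtain J where J: "H / s < 2 ^ J" using real_arch_pow[of 2] by auto
    have "{v \<in> L. v \<ge> s} \<subseteq> (\<lambda>(h, j). h / d ^ j) ` (height_set f \<times> {..<J})"
    proof
      fix v assume "v \<in> {v \<in> L. v \<ge> s}"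
      then obtain h j where hj: "v = h / d ^ j" "h \<in> height_set f" "s \<le> h / d ^ j" unfolding L_def by auto
      have dj: "real (d ^ j) > 0" using d by simp
      have "s * d ^ j \<le> h" using hj(3) dj by (simp only: pos_le_divide_eq)
      then have "s * d ^ j \<le> H" using H[OF hj(2)] by simp
      then have "real (d ^ j) \<le> H / s" using s by (simp add: field_simps)
      moreover have "(2::real) ^ j \<le> real (d ^ j)" using d power_mono[of 2 "real d" j] by simp
      ultimately have "(2::real) ^ j < 2 ^ J" using J by linarith
      then have "j < J" by simp
      then show "v \<in> (\<lambda>(h, j). h / d ^ j) ` (height_set f \<times> {..<J})"
        using hj by (intro image_eqI[of _ _ "(h, j)"]) auto
    qed
    then show ?thesis using finH by (meson finite_SigmaI finite_imageI finite_lessThan finite_subset)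
  qed
  obtain e0 where e0: "e0 > 0" "\<And>v w. \<lbrakk>v \<in> insert s {v \<in> L. v \<ge> s}; w \<in> insert s {v \<in> L. v \<ge> s}; v < w\<rbrakk> \<Longrightarrow> v + e0 < w"
    by (rule finite_gap[of "insert s {v \<in> L. v \<ge> s}"]) (use finL in simp, rule that)
  \<comment> \<open>The gap is \<open>e0\<close>; the bound s / 2 is the condition 2 e \<le> s of
    \<open>level_equiv_near\<close>.\<close>
  define e where "e = min e0 (s / 2)"
  have e: "e > 0" "2 * e \<le> s" "e \<le> e0" using e0(1) s by (auto simp: e_def)
  have gap: "v + e < v'" if "v \<in> insert s L" "s \<le> v" "v' \<in> L" "v < v'" for v v'
    using e0(2)[of v v'] that e(3) by auto
  have L: "escape_rate g p \<in> L"
    if g: "monic_poly g" "degree g = d" "height_set g = height_set f" and j: "poly (pderiv g) ((poly g ^^ j) p) = 0" for g p j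
  proof -
    have "escape_rate g ((poly g ^^ j) p) \<in> height_set f" using j g(3) by (auto simp: height_set_def)
    moreover have "escape_rate g p = escape_rate g ((poly g ^^ j) p) / d ^ j"
      using monic_poly.G_funpow[OF g(1), of j p] g(2) d by simp
    ultimately show ?thesis unfolding L_def by blast
  qed
  let ?b = "exp (max s (2 * (real (degree f) * ln (2 * B))) + real (degree f) * ln (2 * B))"
  show ?thesis
    using uniform_close[OF d F lim f e(1), of ?b] dynamics_close[OF d F lim f s]
  proof eventually_elim
    case (elim n)
    show ?case
    proof (rule level_equiv_near[OF mf(1) mF(1) _ B(1) B(2), where s = s and e = e and L = L])
      show "degree f = degree (F n)" using mf(2) mF(2) by simp
      show "\<bar>escape_rate f z - escape_rate (F n) z\<bar> \<le> e" if "norm z \<le> ?b" for z using elim(1) that by blast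
      show "escape_rate f p \<in> L" if "poly (pderiv f) ((poly f ^^ j) p) = 0" for p j
        using L[OF mf refl that] .
      show "escape_rate (F n) p \<in> L" if "poly (pderiv (F n)) ((poly (F n) ^^ j) p) = 0" for p j
        using L[OF mF heights that] .
      show "joined f s (poly f y) (poly (F n) y)" if "escape_rate (F n) y = 0" for y using elim(2) that by blast
    qed (use e gap in auto)
  qed
qed

section \<open>Critical heights\<close>

text \<open>Isolating the leading term gives this bound, which keeps the critical points of a
  convergent sequence of polynomials in a fixed disc.\<close>

lemma root_bound:
  fixes p :: "complex poly"
  assumes "poly p w = 0" "degree p = m" "m > 0"
  shows "norm w \<le> max 1 ((\<Sum>i<m. norm (coeff p i)) / norm (coeff p m))"
proof (cases "norm w \<le> 1")
  case False
  then have w: "norm w > 1" by simp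
  have lc: "norm (coeff p m) > 0" using assms by auto
  have "coeff p m * w ^ m = - (\<Sum>i<m. coeff p i * w ^ i)"
    using assms(1,2) by (simp add: poly_altdef lessThan_Suc_atMost[symmetric] eq_neg_iff_add_eq_0 add.commute)
  then have "norm (coeff p m) * norm w ^ m = norm (\<Sum>i<m. coeff p i * w ^ i)"
    by (metis norm_minus_cancel norm_mult norm_power)
  also have "\<dots> \<le> (\<Sum>i<m. norm (coeff p i) * norm w ^ i)"
    by (rule order_trans[OF norm_sum]) (simp add: norm_mult norm_power)
  also have "\<dots> \<le> (\<Sum>i<m. norm (coeff p i) * norm w ^ (m - 1))"
    using w by (intro sum_mono mult_left_mono power_increasing) auto
  also have "\<dots> = (\<Sum>i<m. norm (coeff p i)) * norm w ^ (m - 1)" by (simp add: sum_distrib_right)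
  also have "norm w ^ m = norm w * norm w ^ (m - 1)" using assms(3) by (simp add: power_eq_if)
  finally have "(norm (coeff p m) * norm w) * norm w ^ (m - 1) \<le> (\<Sum>i<m. norm (coeff p i)) * norm w ^ (m - 1)"
    by (simp only: mult.assoc)
  moreover have "norm w ^ (m - 1) > 0" using w by (intro zero_less_power) linarith
  ultimately have "norm (coeff p m) * norm w \<le> (\<Sum>i<m. norm (coeff p i))"
    by (rule mult_right_le_imp_le)
  then have "norm w \<le> (\<Sum>i<m. norm (coeff p i)) / norm (coeff p m)"
    using lc by (simp add: pos_le_divide_eq mult.commute)
  then show ?thesis by simp
qed simp

lemma pderiv_monic_centered:
  assumes "f \<in> monic_centered d" "d \<ge> 2"
  shows "degree (pderiv f) = d - 1" "coeff (pderiv f) (d - 1) = of_nat d" "pderiv f \<noteq> 0"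
proof -
  note mf = monic_centered_poly[OF assms]
  show 1: "degree (pderiv f) = d - 1" using mf(2) by (simp add: degree_pderiv)
  show "coeff (pderiv f) (d - 1) = of_nat d" using mf(3) assms(2) by (simp add: coeff_pderiv)
  then show "pderiv f \<noteq> 0" using assms(2) by auto
qed

lemma image_mset_nth: "image_mset (\<lambda>i. xs ! i) (mset_set {..<length xs}) = mset xs"
proof -
  have "mset xs = mset (map (\<lambda>i. xs ! i) [0..<length xs])" by (simp add: map_nth)
  also have "\<dots> = image_mset (\<lambda>i. xs ! i) (mset_set {..<length xs})"
    by (simp only: mset_map mset_upt atLeast0LessThan)
  finally show ?thesis by simp
qed

text \<open>Critical points are indexed so that limits can be taken coordinatewise; the value 0 from
  d - 1 on makes the families members of one compact product.\<close>

lemma critical_points_family: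
  assumes "f \<in> monic_centered d" "d \<ge> 2"
  shows "\<exists>c. proots (pderiv f) = image_mset c (mset_set {..<d-1}) \<and> (\<forall>i\<ge>d-1. c i = 0)"
proof -
  obtain cs where cs: "mset cs = proots (pderiv f)" using ex_mset by blast
  have "length cs = d - 1"
    using cs size_proots_complex[of "pderiv f"] pderiv_monic_centered[OF assms] by (metis size_mset)
  define c where "c i = (if i < d - 1 then cs ! i else 0)" for i
  have "image_mset c (mset_set {..<d-1}) = image_mset (\<lambda>i. cs ! i) (mset_set {..<d-1})"
    by (rule image_mset_cong) (simp add: c_def)
  then have "proots (pderiv f) = image_mset c (mset_set {..<d-1})"
    using image_mset_nth[of cs] cs \<open>length cs = d - 1\<close> by simp
  then show ?thesis using c_def by auto
qed

lemma prod_mset_image_family: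
  "(\<Prod>x\<in>#image_mset c (mset_set A). g x) = (\<Prod>i\<in>A. g (c i))"
  by (simp add: prod_unfold_prod_mset multiset.map_comp o_def)

lemma proots_prod_linear:
  fixes l :: "'i \<Rightarrow> complex"
  assumes "finite A"
  shows "proots (\<Prod>i\<in>A. [:- l i, 1:]) = image_mset l (mset_set A)"
  using assms
proof induction
  case (insert x A)
  have nz: "(\<Prod>i\<in>A. [:- l i, 1:]) \<noteq> 0" using insert by (simp add: prod_zero_iff)
  have "proots (\<Prod>i\<in>insert x A. [:- l i, 1:]) = proots ([:- l x, 1:] * (\<Prod>i\<in>A. [:- l i, 1:]))"
    by (subst prod.insert[OF insert(1,2)]) (rule refl)
  also have "\<dots> = proots [:- l x, 1:] + proots (\<Prod>i\<in>A. [:- l i, 1:])"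
    by (rule proots_mult) (use nz in auto)
  finally show ?case using insert by simp
qed simp

lemma poly_pderiv_family:
  assumes f: "f \<in> monic_centered d" "d \<ge> 2" and c: "proots (pderiv f) = image_mset c (mset_set {..<d-1})"
  shows "pderiv f = smult (of_nat d) (\<Prod>i<d-1. [:- c i, 1:])"
proof -
  have "pderiv f = smult (lead_coeff (pderiv f)) (\<Prod>x\<in>#proots (pderiv f). [:-x, 1:])"
    by (rule complex_poly_decompose_multiset[symmetric])
  also have "lead_coeff (pderiv f) = of_nat d" using pderiv_monic_centered[OF f] by simp
  finally show ?thesis unfolding c prod_mset_image_family .
qed

text \<open>Indexed critical points converge along a subsequence by compactness. Passing to the
  limit in the factorization of the derivative identifies their limits as the critical points of f,
  with multiplicity.\<close>

lemma roots_subsequence: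
  assumes d: "d \<ge> 2" and F: "\<And>n. F n \<in> monic_centered d" and lim: "\<And>i. (\<lambda>n. coeff (F n) i) \<longlonglongrightarrow> coeff f i"
    and f: "f \<in> monic_centered d"
  obtains r :: "nat \<Rightarrow> nat" and c :: "nat \<Rightarrow> nat \<Rightarrow> complex" and l where "strict_mono r"
    "\<And>n. proots (pderiv (F (r n))) = image_mset (c n) (mset_set {..<d-1})"
    "proots (pderiv f) = image_mset l (mset_set {..<d-1})" "\<And>i. (\<lambda>n. c n i) \<longlonglongrightarrow> l i"
proof -
  have "\<exists>C. \<forall>n. proots (pderiv (F n)) = image_mset (C n) (mset_set {..<d-1}) \<and> (\<forall>i\<ge>d-1. C n i = 0)"
    by (intro choice allI critical_points_family[OF F d])
  then obtain C where C: "\<And>n. proots (pderiv (F n)) = image_mset (C n) (mset_set {..<d-1})"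
      "\<And>n i. i \<ge> d - 1 \<Longrightarrow> C n i = 0"
    by auto
  have limd: "(\<lambda>n. coeff (pderiv (F n)) i) \<longlonglongrightarrow> coeff (pderiv f) i" for i
    unfolding coeff_pderiv by (intro tendsto_intros lim)
  have "(\<lambda>n. \<Sum>i<d-1. norm (coeff (pderiv (F n)) i)) \<longlonglongrightarrow> (\<Sum>i<d-1. norm (coeff (pderiv f) i))"
    by (intro tendsto_intros limd)
  then have "Bseq (\<lambda>n. \<Sum>i<d-1. norm (coeff (pderiv (F n)) i))" using convergent_imp_Bseq convergentI by blast
  then obtain K where K: "\<And>n. norm (\<Sum>i<d-1. norm (coeff (pderiv (F n)) i)) \<le> K" by (auto simp: Bseq_def)
  have "norm (C n i) \<le> max 1 (K / d)" for n i
  proof (cases "i < d - 1")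
    case True
    then have "C n i \<in># proots (pderiv (F n))" unfolding C(1) by simp
    then have "poly (pderiv (F n)) (C n i) = 0"
      using set_count_proots[OF pderiv_monic_centered(3)[OF F d]] by blast
    then have "norm (C n i) \<le> max 1 ((\<Sum>i<d-1. norm (coeff (pderiv (F n)) i)) / norm (coeff (pderiv (F n)) (d-1)))"
      by (rule root_bound) (use pderiv_monic_centered(1)[OF F d] d in auto)
    also have "norm (coeff (pderiv (F n)) (d-1)) = d" using pderiv_monic_centered(2)[OF F d, of n] by simp
    also have "max 1 ((\<Sum>i<d-1. norm (coeff (pderiv (F n)) i)) / d) \<le> max 1 (K / d)"
      using K[of n] by (intro max.mono divide_right_mono) auto
    finally show ?thesis .
  qed (use C(2) in simp)
  then have CP: "C n \<in> PiE UNIV (\<lambda>_. cball 0 (max 1 (K / d)))" for n by auto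
  have "compactin (product_topology (\<lambda>_. euclidean) UNIV) (PiE UNIV (\<lambda>_::nat. cball (0::complex) (max 1 (K / d))))"
    unfolding compactin_PiE by simp
  then have "compact (PiE UNIV (\<lambda>_::nat. cball (0::complex) (max 1 (K / d))))" by (simp add: euclidean_product_topology)
  then have "seq_compact (PiE UNIV (\<lambda>_::nat. cball (0::complex) (max 1 (K / d))))" by (rule compact_imp_seq_compact)
  then obtain l r where lr: "strict_mono r" "(C \<circ> r) \<longlonglongrightarrow> l"
    using CP unfolding seq_compact_def by meson
  have cl: "(\<lambda>n. C (r n) i) \<longlonglongrightarrow> l i" for i
  proof -
    have "isCont (\<lambda>x :: nat \<Rightarrow> complex. x i) l"
      by (rule continuous_on_eq_continuous_at[OF open_UNIV, THEN iffD1, rule_format, OF continuous_on_product_coordinates UNIV_I])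
    then show ?thesis using isCont_tendsto_compose[OF _ lr(2)] by (simp add: o_def)
  qed
  have "poly (pderiv f) z = poly (smult (of_nat d) (\<Prod>i<d-1. [:- l i, 1:])) z" for z
  proof (rule LIMSEQ_unique)
    have deg: "degree (pderiv (F n)) = d - 1" "degree (pderiv f) = d - 1" for n
      using pderiv_monic_centered(1)[OF _ d] F f by auto
    show "(\<lambda>n. poly (pderiv (F (r n))) z) \<longlonglongrightarrow> poly (pderiv f) z"
      unfolding poly_altdef deg using LIMSEQ_subseq_LIMSEQ[OF limd lr(1)] by (intro tendsto_intros) (simp add: o_def)
    have f1: "poly (pderiv (F (r n))) z = of_nat d * (\<Prod>i<d-1. z - C (r n) i)" for n
      unfolding poly_pderiv_family[OF F d C(1)] by (simp add: poly_prod)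
    have f2: "poly (smult (of_nat d) (\<Prod>i<d-1. [:- l i, 1:])) z = of_nat d * (\<Prod>i<d-1. z - l i)"
      by (simp add: poly_prod)
    show "(\<lambda>n. poly (pderiv (F (r n))) z) \<longlonglongrightarrow> poly (smult (of_nat d) (\<Prod>i<d-1. [:- l i, 1:])) z"
      unfolding f1 f2 by (intro tendsto_intros cl)
  qed
  then have eq: "pderiv f = smult (of_nat d) (\<Prod>i<d-1. [:- l i, 1:])"
    using poly_eq_poly_eq_iff by blast
  have "proots (pderiv f) = image_mset l (mset_set {..<d-1})"
    unfolding eq using d by (simp add: proots_prod_linear)
  then show ?thesis using that[of r "\<lambda>n. C (r n)" l] lr(1) C(1) cl by simp
qed

text \<open>The multiset determines and is determined by \<open>critical_heights\<close>; its
  continuity is expressed by the values of \<open>height_poly\<close>.\<close>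

definition height_mset :: "complex poly \<Rightarrow> real multiset" where
  "height_mset f = image_mset (escape_rate f) (proots (pderiv f))"

text \<open>The critical heights are the negatives of the roots of this polynomial; with this choice of sign
  its value at \<open>1\<close> bounds all of them.\<close>

definition height_poly :: "complex poly \<Rightarrow> nat \<Rightarrow> real" where
  "height_poly f n = (\<Prod>h\<in>#height_mset f. real n + h)"

lemma proots_height:
  fixes M :: "real multiset"
  shows "proots (\<Prod>x\<in>#M. [:x, 1:]) = image_mset uminus M"
proof (induction M)
  case (add x M)
  have nz: "(\<Prod>x\<in>#M. [:x, 1:]) \<noteq> 0" by auto
  have "proots (\<Prod>x\<in>#add_mset x M. [:x, 1:]) = proots ([:x, 1:] * (\<Prod>x\<in>#M. [:x, 1:]))"
    by (simp only: image_mset_add_mset prod_mset.add_mset)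
  also have "\<dots> = proots [:x, 1:] + proots (\<Prod>x\<in>#M. [:x, 1:])"
    by (rule proots_mult) (use nz in auto)
  finally show ?case using add by simp
qed simp

lemma poly_prod_mset_linear: "poly (\<Prod>x\<in>#M. [:x, 1:]) t = (\<Prod>x\<in>#M. t + x)" for t :: real
  by (induction M) (auto simp: algebra_simps)

text \<open>A polynomial is determined by its values at the natural numbers, and its roots return
  the multiset up to sign.\<close>

lemma height_poly_eq_iff: "height_poly f = height_poly g \<longleftrightarrow> height_mset f = height_mset g"
proof
  assume eq: "height_poly f = height_poly g"
  define p where "p = (\<Prod>x\<in>#height_mset f. [:x, 1:]) - (\<Prod>x\<in>#height_mset g. [:x, 1:])"
  have "poly p (real n) = 0" for n
    using fun_cong[OF eq, of n] by (simp add: p_def poly_prod_mset_linear height_poly_def)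
  then have "range real \<subseteq> {t. poly p t = 0}" by auto
  moreover have "infinite (range real)" by (simp add: range_inj_infinite inj_on_def)
  ultimately have "p = 0" using poly_roots_finite[of p] finite_subset by blast
  then have "(\<Prod>x\<in>#height_mset f. [:x, 1:]) = (\<Prod>x\<in>#height_mset g. [:x, 1:])" by (simp add: p_def)
  then have "image_mset uminus (height_mset f) = image_mset uminus (height_mset g)" using proots_height by metis
  then have "image_mset uminus (image_mset uminus (height_mset f)) = image_mset uminus (image_mset uminus (height_mset g))"
    by (rule arg_cong)
  then show "height_mset f = height_mset g" by (simp add: multiset.map_comp o_def)
next
  assume "height_mset f = height_mset g"
  then show "height_poly f = height_poly g" by (simp add: height_poly_def fun_eq_iff)
qed

lemma critical_heights_eq_iff: "critical_heights f = critical_heights g \<longleftrightarrow> height_mset f = height_mset g"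
  unfolding critical_heights_def height_mset_def
  by (metis mset_sorted_list_of_multiset rev_rev_ident)

lemma set_height_mset:
  assumes "f \<in> monic_centered d" "d \<ge> 2"
  shows "set_mset (height_mset f) = height_set f"
  unfolding height_mset_def height_set_def
  using set_count_proots[OF pderiv_monic_centered(3)[OF assms]] by simp

text \<open>Every subsequence has a further one along which indexed critical points converge. The
  product is symmetric in them, so the limit is always the same.\<close>

lemma tendsto_height_poly:
  assumes d: "d \<ge> 2" and F: "\<And>n. F n \<in> monic_centered d" and lim: "\<And>i. (\<lambda>n. coeff (F n) i) \<longlonglongrightarrow> coeff f i"
    and f: "f \<in> monic_centered d"
  shows "(\<lambda>n. height_poly (F n) t) \<longlonglongrightarrow> height_poly f t"
proof (rule tendstoI, rule ccontr)
  fix e :: real assume e: "e > 0" and "\<not> (\<forall>\<^sub>F n in sequentially. dist (height_poly (F n) t) (height_poly f t) < e)"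
  then have "\<exists>r :: nat \<Rightarrow> nat. strict_mono r \<and> (\<forall>n. \<not> dist (height_poly (F (r n)) t) (height_poly f t) < e)"
    by (intro subseq_not_eventually)
  then obtain r :: "nat \<Rightarrow> nat" where r': "strict_mono r \<and> (\<forall>n. \<not> dist (height_poly (F (r n)) t) (height_poly f t) < e)"
    by (rule exE)
  note r = r'[THEN conjunct1] r'[THEN conjunct2, THEN spec]
  have limr: "(\<lambda>n. coeff (F (r n)) i) \<longlonglongrightarrow> coeff f i" for i
    using LIMSEQ_subseq_LIMSEQ[OF lim r(1)] by (simp add: o_def)
  obtain q c l where q: "strict_mono q"
    "\<And>n. proots (pderiv (F (r (q n)))) = image_mset (c n) (mset_set {..<d-1})"
    "proots (pderiv f) = image_mset l (mset_set {..<d-1})" "\<And>i. (\<lambda>n. c n i) \<longlonglongrightarrow> l i"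
    by (rule roots_subsequence[of d "\<lambda>n. F (r n)" f, OF d F limr f]) (rule that)
  have limq: "(\<lambda>n. coeff (F (r (q n))) i) \<longlonglongrightarrow> coeff f i" for i
    using LIMSEQ_subseq_LIMSEQ[OF limr q(1)] by (simp add: o_def)
  have "(\<lambda>n. \<Prod>i<d-1. real t + escape_rate (F (r (q n))) (c n i)) \<longlonglongrightarrow> (\<Prod>i<d-1. real t + escape_rate f (l i))"
    by (intro tendsto_intros tendsto_escape_rate[of d "\<lambda>n. F (r (q n))" f, OF d F limq f q(4)])
  moreover have "height_poly (F (r (q n))) t = (\<Prod>i<d-1. real t + escape_rate (F (r (q n))) (c n i))" for n
    by (simp add: height_poly_def height_mset_def q(2) prod_unfold_prod_mset multiset.map_comp o_def)
  moreover have "height_poly f t = (\<Prod>i<d-1. real t + escape_rate f (l i))"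
    by (simp add: height_poly_def height_mset_def q(3) prod_unfold_prod_mset multiset.map_comp o_def)
  ultimately have "(\<lambda>n. height_poly (F (r (q n))) t) \<longlonglongrightarrow> height_poly f t" by simp
  then have "eventually (\<lambda>n. dist (height_poly (F (r (q n))) t) (height_poly f t) < e) sequentially"
    using e by (rule tendstoD)
  then show False using r(2) by simp
qed

subsection \<open>Properness\<close>

text \<open>For a d-th power of a linear factor this makes the centering condition say that the root
  is 0.\<close>

lemma coeff_linear_power_Suc: "coeff ([:a, 1:] ^ Suc n) n = of_nat (Suc n) * a" for a :: complex
proof (induction n)
  case (Suc n)
  have lc: "coeff ([:a, 1:] ^ Suc n) (Suc n) = 1"
    using degree_linear_power[of a "Suc n"] lead_coeff_power[of "[:a, 1:]" "Suc n"] by simp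
  have "coeff ([:a, 1:] ^ Suc (Suc n)) (Suc n) =
      a * coeff ([:a, 1:] ^ Suc n) (Suc n) + coeff ([:a, 1:] ^ Suc n) n"
    by (subst power_Suc) (simp only: mult_pCons_left coeff_add coeff_smult coeff_pCons_Suc mult_1_left smult_1_left mult_zero_left pCons_0_0 coeff_0 add_0_right)
  then show ?case using Suc lc by (simp add: algebra_simps)
qed simp

text \<open>When all critical points are roots, comparing multiplicities of f and its derivative
  gives d = (d - 1) + the number of distinct roots. So there is one root, and centering puts it at
  0.\<close>

lemma critical_values_zero_imp_power:
  assumes f: "f \<in> monic_centered d" and d: "d \<ge> 2"
    and zero: "\<And>c. poly (pderiv f) c = 0 \<Longrightarrow> poly f c = 0"
  shows "f = monom 1 d"
proof -
  note mf = monic_centered_poly[OF f d]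
  have f0: "f \<noteq> 0" using mf(3) by auto
  have fin: "finite {z. poly f z = 0}" by (rule poly_roots_finite[OF f0])
  have "proots f = proots (pderiv f) + mset_set {z. poly f z = 0}"
  proof (rule multiset_eqI)
    fix a
    show "count (proots f) a = count (proots (pderiv f) + mset_set {z. poly f z = 0}) a"
    proof (cases "poly f a = 0")
      case True
      then have "order a f = Suc (order a (pderiv f))" by (rule order_pderiv[OF f0])
      then show ?thesis using True fin f0 pderiv_monic_centered(3)[OF f d] by (simp add: count_mset_set)
    next
      case False
      then have "poly (pderiv f) a \<noteq> 0" using zero by blast
      then show ?thesis using False f0 pderiv_monic_centered(3)[OF f d] by (simp add: order_0I count_mset_set)
    qed
  qed
  then have "size (proots f) = size (proots (pderiv f)) + card {z. poly f z = 0}" by simp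
  then have "card {z. poly f z = 0} = 1"
    using size_proots_complex[of f] size_proots_complex[of "pderiv f"] mf(2) pderiv_monic_centered(1)[OF f d] d by simp
  then obtain a where a: "{z. poly f z = 0} = {a}" by (rule card_1_singletonE)
  have "f = smult (lead_coeff f) (\<Prod>z|poly f z = 0. [:-z, 1:] ^ order z f)"
    by (rule complex_poly_decompose[symmetric])
  then have 1: "f = [:- a, 1:] ^ order a f" using a mf(2,3) by simp
  then have "degree f = order a f" by (metis degree_linear_power)
  then have fa: "f = [:- a, 1:] ^ d" using 1 mf(2) by simp
  have "coeff ([:- a, 1:] ^ Suc (d - 1)) (d - 1) = of_nat d * (- a)"
    using coeff_linear_power_Suc[of "- a" "d - 1"] d by simp
  then have "of_nat d * (- a) = 0" using mf(4) fa d by simp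
  then have "a = 0" using d by simp
  then show ?thesis using fa by (simp add: monom_altdef)
qed

text \<open>Normalised coefficients form a compact set. If critical values could be arbitrarily
  small, a limit polynomial would have only the critical value 0 and so be z^d, whose lower
  coefficients all vanish, although one of them should have norm 1 in the limit.\<close>

lemma critical_value_lower_bound:
  assumes d: "d \<ge> 2"
  shows "\<exists>\<delta>>0. \<forall>g\<in>monic_centered d. (\<forall>i<d-1. norm (coeff g i) \<le> 1) \<longrightarrow>
      (\<exists>i<d-1. norm (coeff g i) = 1) \<longrightarrow> (\<exists>c. poly (pderiv g) c = 0 \<and> \<delta> \<le> norm (poly g c))"
proof (rule ccontr)
  assume no: "\<not> ?thesis"
  have "\<exists>g. g \<in> monic_centered d \<and> (\<forall>i<d-1. norm (coeff g i) \<le> 1) \<and> (\<exists>i<d-1. norm (coeff g i) = 1) \<and>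
      (\<forall>c. poly (pderiv g) c = 0 \<longrightarrow> norm (poly g c) < 1 / real (Suc n))" for n
  proof -
    have "\<not> (\<forall>g\<in>monic_centered d. (\<forall>i<d-1. norm (coeff g i) \<le> 1) \<longrightarrow>
      (\<exists>i<d-1. norm (coeff g i) = 1) \<longrightarrow> (\<exists>c. poly (pderiv g) c = 0 \<and> 1 / real (Suc n) \<le> norm (poly g c)))"
      using no by (metis of_nat_0_less_iff zero_less_Suc zero_less_divide_1_iff)
    then show ?thesis by (meson not_le)
  qed
  then have "\<exists>g. \<forall>n. g n \<in> monic_centered d \<and> (\<forall>i<d-1. norm (coeff (g n) i) \<le> 1) \<and> (\<exists>i<d-1. norm (coeff (g n) i) = 1) \<and>
      (\<forall>c. poly (pderiv (g n)) c = 0 \<longrightarrow> norm (poly (g n) c) < 1 / real (Suc n))"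
    by (intro choice allI)
  then obtain g where g: "\<And>n. g n \<in> monic_centered d" "\<And>n i. i < d - 1 \<Longrightarrow> norm (coeff (g n) i) \<le> 1"
      "\<And>n. \<exists>i<d-1. norm (coeff (g n) i) = 1"
      "\<And>n c. poly (pderiv (g n)) c = 0 \<Longrightarrow> norm (poly (g n) c) < 1 / real (Suc n)"
    by auto
  define A where "A n i = (if i < d - 1 then coeff (g n) i else 0)" for n i
  have AP: "A n \<in> PiE UNIV (\<lambda>_. cball 0 1)" for n using g(2) by (auto simp: A_def)
  have "compactin (product_topology (\<lambda>_. euclidean) UNIV) (PiE UNIV (\<lambda>_::nat. cball (0::complex) 1))"
    unfolding compactin_PiE by simp
  then have "compact (PiE UNIV (\<lambda>_::nat. cball (0::complex) 1))" by (simp add: euclidean_product_topology)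
  then have "seq_compact (PiE UNIV (\<lambda>_::nat. cball (0::complex) 1))" by (rule compact_imp_seq_compact)
  then obtain l r where lr: "strict_mono r" "(A \<circ> r) \<longlonglongrightarrow> l"
    using AP unfolding seq_compact_def by meson
  have Al: "(\<lambda>n. A (r n) i) \<longlonglongrightarrow> l i" for i
  proof -
    have "isCont (\<lambda>x :: nat \<Rightarrow> complex. x i) l"
      by (rule continuous_on_eq_continuous_at[OF open_UNIV, THEN iffD1, rule_format, OF continuous_on_product_coordinates UNIV_I])
    then show ?thesis using isCont_tendsto_compose[OF _ lr(2)] by (simp add: o_def)
  qed
  obtain f where f: "f \<in> monic_centered d" "\<And>i. i < d - 1 \<Longrightarrow> coeff f i = l i"
    by (rule monic_centered_exists[OF d, of l]) (rule that)
  have lim: "(\<lambda>n. coeff (g (r n)) i) \<longlonglongrightarrow> coeff f i" for i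
  proof (cases "i < d - 1")
    case True
    then show ?thesis using Al[of i] f(2) by (simp add: A_def)
  next
    case False
    then have "coeff (g (r n)) i = coeff f i" for n
      using monic_centered_coeff_cases[OF g(1) d, of i] monic_centered_coeff_cases[OF f(1) d, of i] by auto
    then show ?thesis by simp
  qed
  obtain q c m where q: "strict_mono q"
    "\<And>n. proots (pderiv (g (r (q n)))) = image_mset (c n) (mset_set {..<d-1})"
    "proots (pderiv f) = image_mset m (mset_set {..<d-1})" "\<And>i. (\<lambda>n. c n i) \<longlonglongrightarrow> m i"
    by (rule roots_subsequence[of d "\<lambda>n. g (r n)" f, OF d g(1) lim f(1)]) (rule that)
  have limq: "(\<lambda>n. coeff (g (r (q n))) i) \<longlonglongrightarrow> coeff f i" for i
    using LIMSEQ_subseq_LIMSEQ[OF lim q(1)] by (simp add: o_def)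
  have rq: "n \<le> r (q n)" for n using seq_suble[OF strict_mono_o[OF lr(1) q(1)], of n] by simp
  have "poly f z = 0" if z: "poly (pderiv f) z = 0" for z
  proof -
    have "z \<in># proots (pderiv f)" using z set_count_proots[OF pderiv_monic_centered(3)[OF f(1) d]] by blast
    then obtain i where i: "i < d - 1" "z = m i" unfolding q(3) by auto
    have "(\<lambda>n. poly (g (r (q n))) (c n i)) \<longlonglongrightarrow> poly f z"
      unfolding i(2) by (rule tendsto_poly_seq[of d "\<lambda>n. g (r (q n))", OF d g(1) limq f(1) q(4)])
    moreover have "(\<lambda>n. poly (g (r (q n))) (c n i)) \<longlonglongrightarrow> 0"
    proof (rule Lim_null_comparison)
      show "(\<lambda>n. 1 / real (Suc n)) \<longlonglongrightarrow> 0" by (rule LIMSEQ_Suc[OF lim_1_over_n])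
      show "\<forall>\<^sub>F n in sequentially. norm (poly (g (r (q n))) (c n i)) \<le> 1 / real (Suc n)"
      proof (intro always_eventually allI)
        fix n
        have "c n i \<in># proots (pderiv (g (r (q n))))" unfolding q(2) using i(1) by simp
        then have "poly (pderiv (g (r (q n)))) (c n i) = 0"
          using set_count_proots[OF pderiv_monic_centered(3)[OF g(1) d]] by blast
        then have "norm (poly (g (r (q n))) (c n i)) < 1 / real (Suc (r (q n)))" by (rule g(4))
        also have "\<dots> \<le> 1 / real (Suc n)" using rq[of n] by (simp add: frac_le)
        finally show "norm (poly (g (r (q n))) (c n i)) \<le> 1 / real (Suc n)" by simp
      qed
    qed
    ultimately show ?thesis by (rule LIMSEQ_unique)
  qed
  then have "f = monom 1 d" by (rule critical_values_zero_imp_power[OF f(1) d])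
  then have f0: "(\<Sum>i<d-1. norm (coeff f i)) = 0" by (intro sum.neutral) auto
  have "(\<lambda>n. \<Sum>i<d-1. norm (coeff (g (r n)) i)) \<longlonglongrightarrow> (\<Sum>i<d-1. norm (coeff f i))"
    by (intro tendsto_intros lim)
  moreover have "(\<Sum>i<d-1. norm (coeff (g (r n)) i)) \<ge> 1" for n
  proof -
    obtain i where i: "i < d - 1" "norm (coeff (g (r n)) i) = 1" using g(3) by blast
    have "norm (coeff (g (r n)) i) \<le> (\<Sum>i<d-1. norm (coeff (g (r n)) i))"
      using i(1) by (intro member_le_sum) auto
    then show ?thesis using i(2) by simp
  qed
  ultimately have "(\<Sum>i<d-1. norm (coeff f i)) \<ge> 1" by (intro LIMSEQ_le_const) auto
  then show False using f0 by simp
qed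

text \<open>\<open>G_approx\<close> loses d ln(2 \<open>coeff_sum\<close>), which can be of order
  d^2 ln \<rho> here and is too much for properness. With weighted coefficients the threshold is
  linear in \<rho>, and beyond it only ln 2 is lost.\<close>

lemma escape_rate_scaled_ge:
  assumes f: "f \<in> monic_centered d" and d: "d \<ge> 2" and \<rho>: "\<rho> \<ge> 1"
    and co: "\<And>i. i < d - 1 \<Longrightarrow> norm (coeff f i) \<le> \<rho> ^ (d - i)" and w: "norm w \<ge> 2 * d * \<rho>"
  shows "escape_rate f w \<ge> ln (norm w) - ln 2"
proof -
  note mf = monic_centered_poly[OF f d]
  have big: "2 * real d * \<rho> \<ge> 4"
  proof -
    have "2 * 2 * 1 \<le> 2 * real d * \<rho>" using d \<rho> by (intro mult_mono) auto
    then show ?thesis by simp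
  qed
  have half: "norm (poly f z) \<ge> norm z ^ d / 2" if z: "norm z \<ge> 2 * d * \<rho>" for z
  proof -
    have z1: "norm z \<ge> 4" "norm z \<ge> \<rho>"
    proof -
      show "norm z \<ge> 4" using z big by linarith
      have "1 * \<rho> \<le> 2 * real d * \<rho>" using d \<rho> by (intro mult_right_mono) auto
      then show "norm z \<ge> \<rho>" using z by linarith
    qed
    have "poly f z - z ^ d = (\<Sum>i<d. coeff f i * z ^ i)"
      using mf(2,3) by (simp add: poly_altdef lessThan_Suc_atMost[symmetric])
    then have "norm (poly f z - z ^ d) \<le> (\<Sum>i<d. norm (coeff f i) * norm z ^ i)"
      using norm_sum[of "\<lambda>i. coeff f i * z ^ i" "{..<d}"] by (simp add: norm_mult norm_power)
    also have "\<dots> \<le> (\<Sum>i<d. \<rho> * norm z ^ (d - 1))"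
    proof (rule sum_mono)
      fix i assume i: "i \<in> {..<d}"
      show "norm (coeff f i) * norm z ^ i \<le> \<rho> * norm z ^ (d - 1)"
      proof (cases "i < d - 1")
        case True
        have "norm (coeff f i) * norm z ^ i \<le> \<rho> ^ (d - i) * norm z ^ i"
          using co[OF True] by (intro mult_right_mono) auto
        also have "\<rho> ^ (d - i) = \<rho> * \<rho> ^ (d - 1 - i)"
        proof -
          have "d - i = Suc (d - 1 - i)" using True by simp
          then show ?thesis by simp
        qed
        also have "\<rho> * \<rho> ^ (d - 1 - i) * norm z ^ i \<le> \<rho> * norm z ^ (d - 1 - i) * norm z ^ i"
          using z1 \<rho> by (intro mult_right_mono mult_left_mono power_mono) auto
        also have "\<dots> = \<rho> * norm z ^ (d - 1)"
          using True by (simp add: power_add[symmetric] mult.assoc)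
        finally show ?thesis .
      next
        case False
        then have "i = d - 1" using i by auto
        then show ?thesis using mf(4) \<rho> by simp
      qed
    qed
    also have "\<dots> = (d * \<rho>) * norm z ^ (d - 1)" by simp
    also have "\<dots> \<le> norm z / 2 * norm z ^ (d - 1)" using z by (intro mult_right_mono) auto
    also have "\<dots> = norm z ^ d / 2" using d by (simp add: power_eq_if)
    finally have "norm (poly f z - z ^ d) \<le> norm z ^ d / 2" .
    moreover have "norm (z ^ d) \<le> norm (poly f z) + norm (poly f z - z ^ d)"
      by (metis norm_minus_commute norm_triangle_sub)
    ultimately show ?thesis by (simp add: norm_power)
  qed
  have grow: "norm (poly f z) \<ge> norm z" if z: "norm z \<ge> 2 * d * \<rho>" for z
  proof -
    have z4: "norm z \<ge> 4" using z big by linarith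
    have "norm z ^ 2 \<le> norm z ^ d" using z4 d by (intro power_increasing) auto
    moreover have "4 * norm z \<le> norm z ^ 2" using z4 by (simp add: power2_eq_square mult_right_mono)
    ultimately show ?thesis using half[OF z] z4 by linarith
  qed
  have orbit: "norm ((poly f ^^ n) w) \<ge> 2 * d * \<rho>" for n
    by (induction n) (use w grow in \<open>auto intro: order_trans\<close>)
  \<comment> \<open>From |f z| \<ge> |z|^d / 2 and 2 ln 2 \<le> d ln 2 one gets ln |f z| - ln 2
    \<ge> d (ln |z| - ln 2); the shift by ln 2 is what lets the estimate iterate.\<close>
  have est: "ln (norm ((poly f ^^ n) w)) - ln 2 \<ge> d ^ n * (ln (norm w) - ln 2)" for n
  proof (induction n)
    case (Suc n)
    define z where "z = (poly f ^^ n) w"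
    have z: "norm z \<ge> 2 * d * \<rho>" "norm z \<ge> 4" using orbit[of n] big unfolding z_def by linarith+
    have zd: "norm z ^ d > 0" using z(2) by (intro zero_less_power) linarith
    have "ln (norm z ^ d / 2) \<le> ln (norm (poly f z))"
      using half[OF z(1)] zd by (subst ln_le_cancel_iff) auto
    moreover have "ln (norm z ^ d / 2) = d * ln (norm z) - ln 2"
      using zd z(2) by (subst ln_div) (auto simp: ln_realpow)
    ultimately have "ln (norm (poly f z)) - ln 2 \<ge> d * ln (norm z) - 2 * ln 2" by linarith
    moreover have "2 * ln 2 \<le> real d * ln 2" using d by (intro mult_right_mono) auto
    moreover have "d * (ln (norm z) - ln 2) = d * ln (norm z) - d * ln 2" by (rule right_diff_distrib)
    ultimately have "ln (norm (poly f z)) - ln 2 \<ge> d * (ln (norm z) - ln 2)" by linarith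
    also have "d * (ln (norm z) - ln 2) \<ge> d * (d ^ n * (ln (norm w) - ln 2))"
      using Suc.IH by (intro mult_left_mono) (simp_all add: z_def)
    finally show ?case by (simp add: z_def mult.assoc)
  qed simp
  show ?thesis
  proof (rule LIMSEQ_le_const[OF monic_poly.Gn_LIMSEQ[OF mf(1)]], intro exI allI impI)
    fix n
    have dn: "real (d ^ n) > 0" using d by simp
    have "ln (norm ((poly f ^^ n) w)) \<le> logp ((poly f ^^ n) w)"
    proof -
      have "norm ((poly f ^^ n) w) \<ge> 4" using orbit[of n] big by linarith
      then show ?thesis unfolding logp_def by (subst ln_le_cancel_iff) auto
    qed
    then have "real (d ^ n) * (ln (norm w) - ln 2) \<le> logp ((poly f ^^ n) w)"
      using est[of n] ln_gt_zero[of 2] by linarith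
    then show "ln (norm w) - ln 2 \<le> logp ((poly f ^^ n) w) / real (degree f ^ n)"
      using dn mf(2) by (simp add: pos_le_divide_eq mult.commute)
  qed
qed

text \<open>If \<rho> is the weighted size of the coefficients, then g(z) = f(\<rho> z) / \<rho>^d
  is normalised and has a critical value of norm at least \<delta>, so f has one of norm at least
  \<delta> \<rho>^d. Its escape rate is d times a critical height, hence at most d M, and this
  bounds \<rho>.\<close>

lemma bounded_critical_heights:
  assumes d: "d \<ge> 2"
  obtains B where "\<And>f i. \<lbrakk>f \<in> monic_centered d; \<And>c. poly (pderiv f) c = 0 \<Longrightarrow> escape_rate f c \<le> M; i < d - 1\<rbrakk>
      \<Longrightarrow> norm (coeff f i) \<le> B"
proof -
  obtain \<delta> where \<delta>': "\<delta> > 0 \<and> (\<forall>g\<in>monic_centered d. (\<forall>i<d-1. norm (coeff g i) \<le> 1) \<longrightarrow>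
      (\<exists>i<d-1. norm (coeff g i) = 1) \<longrightarrow> (\<exists>c. poly (pderiv g) c = 0 \<and> \<delta> \<le> norm (poly g c)))"
    using critical_value_lower_bound[OF d] by (rule exE)
  have \<delta>: "\<delta> > 0" "\<And>g. \<lbrakk>g \<in> monic_centered d; \<And>i. i < d - 1 \<Longrightarrow> norm (coeff g i) \<le> 1;
      \<exists>i<d-1. norm (coeff g i) = 1\<rbrakk> \<Longrightarrow> \<exists>c. poly (pderiv g) c = 0 \<and> \<delta> \<le> norm (poly g c)"
    using \<delta>' by simp_all
  \<comment> \<open>For \<rho> > 2 d / \<delta> the critical value passes the threshold of
    \<open>escape_rate_scaled_ge\<close>; for \<rho> > 2 exp(d M) / \<delta> its escape rate would
    exceed d M.\<close>
  define P where "P = max (max 1 (2 * d / \<delta>)) (2 * exp (d * M) / \<delta>)"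
  have P1: "P \<ge> 1" by (simp add: P_def)
  have "norm (coeff f i) \<le> P ^ d"
    if f: "f \<in> monic_centered d" and M: "\<And>c. poly (pderiv f) c = 0 \<Longrightarrow> escape_rate f c \<le> M" and i: "i < d - 1" for f i
  proof -
    note mf = monic_centered_poly[OF f d]
    \<comment> \<open>The least \<rho> \<ge> 0 such that the i-th coefficient has norm at most
      \<rho>^(d-i) for all i < d - 1; equality at the index \<open>k\<close> makes the rescaled
      polynomial normalised.\<close>
    define \<rho> where "\<rho> = Max ((\<lambda>i. root (d - i) (norm (coeff f i))) ` {..<d-1})"
    have fin: "finite ((\<lambda>i. root (d - i) (norm (coeff f i))) ` {..<d-1})" by simp
    have "\<rho> \<in> (\<lambda>i. root (d - i) (norm (coeff f i))) ` {..<d-1}"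
      unfolding \<rho>_def using i by (intro Max_in) auto
    then obtain k where k: "k < d - 1" "\<rho> = root (d - k) (norm (coeff f k))" by auto
    have \<rho>0: "\<rho> \<ge> 0" unfolding k(2) by (simp add: real_root_ge_zero)
    have co: "norm (coeff f j) \<le> \<rho> ^ (d - j)" if j: "j < d - 1" for j
    proof -
      have "root (d - j) (norm (coeff f j)) \<le> \<rho>" unfolding \<rho>_def using j fin by (intro Max_ge) auto
      then have "root (d - j) (norm (coeff f j)) ^ (d - j) \<le> \<rho> ^ (d - j)" by (intro power_mono) (auto simp: real_root_ge_zero)
      then show ?thesis using j by (simp add: real_root_pow_pos2)
    qed
    have cok: "norm (coeff f k) = \<rho> ^ (d - k)" unfolding k(2) using k(1) by (simp add: real_root_pow_pos2)
    have "\<rho> \<le> P"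
    proof (rule ccontr)
      assume "\<not> \<rho> \<le> P"
      then have \<rho>: "\<rho> > 1" "\<rho> > 2 * d / \<delta>" "\<rho> > 2 * exp (d * M) / \<delta>" by (auto simp: P_def)
      obtain g where g: "g \<in> monic_centered d" "\<And>j. j < d - 1 \<Longrightarrow> coeff g j = coeff f j / of_real \<rho> ^ (d - j)"
        by (rule monic_centered_exists[OF d, of "\<lambda>j. coeff f j / of_real \<rho> ^ (d - j)"]) (rule that)
      have ng: "norm (coeff g j) = norm (coeff f j) / \<rho> ^ (d - j)" if "j < d - 1" for j
        using g(2)[OF that] \<rho>(1) by (simp add: norm_divide norm_power)
      have geq: "g = smult (inverse (of_real \<rho> ^ d)) (pcompose f [:0, of_real \<rho>:])"
      proof (rule poly_eqI)
        fix j
        have "coeff g j = inverse (of_real \<rho> ^ d) * (of_real \<rho> ^ j * coeff f j)"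
        proof (cases "j < d - 1")
          case True
          have "(of_real \<rho> :: complex) ^ d = of_real \<rho> ^ (d - j) * of_real \<rho> ^ j"
            using True by (simp add: power_add[symmetric])
          then show ?thesis using g(2)[OF True] \<rho>(1) by (simp add: field_simps)
        next
          case False
          then show ?thesis
            using monic_centered_coeff_cases[OF g(1) d, of j] monic_centered_coeff_cases[OF f d, of j] \<rho>(1) by auto
        qed
        then show "coeff g j = coeff (smult (inverse (of_real \<rho> ^ d)) (pcompose f [:0, of_real \<rho>:])) j"
          by (simp add: coeff_pcompose_linear)
      qed
      have "\<exists>c. poly (pderiv g) c = 0 \<and> \<delta> \<le> norm (poly g c)"
      proof (rule \<delta>(2)[OF g(1)])
        show "norm (coeff g j) \<le> 1" if "j < d - 1" for j
          using ng[OF that] co[OF that] \<rho>(1) by (simp add: divide_le_eq_1)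
        show "\<exists>j<d-1. norm (coeff g j) = 1"
          using ng[OF k(1)] cok k(1) \<rho>(1) by (intro exI[of _ k]) simp
      qed
      then obtain c where c: "poly (pderiv g) c = 0" "\<delta> \<le> norm (poly g c)" by blast
      let ?c = "of_real \<rho> * c"
      have "poly (pderiv f) ?c = 0"
        using c(1) \<rho>(1) unfolding geq
        by (simp add: pderiv_smult pderiv_pcompose poly_pcompose pderiv_pCons mult.commute)
      then have "escape_rate f ?c \<le> M" by (rule M)
      then have le: "escape_rate f (poly f ?c) \<le> d * M"
        using monic_poly.G_poly[OF mf(1), of ?c] mf(2) d by simp
      have "norm (poly g c) = norm (poly f ?c) / \<rho> ^ d"
      proof -
        have "poly g c = inverse (of_real \<rho> ^ d) * poly f ?c"
          unfolding geq by (simp add: poly_pcompose mult.commute)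
        then show ?thesis using \<rho>(1) by (simp add: norm_mult norm_inverse norm_power divide_inverse mult.commute)
      qed
      then have w: "norm (poly f ?c) \<ge> \<delta> * \<rho> ^ d"
        using c(2) \<rho>(1) by (simp add: pos_le_divide_eq)
      have "\<rho> ^ 2 \<le> \<rho> ^ d" using \<rho>(1) d by (intro power_increasing) auto
      then have "\<delta> * \<rho> ^ 2 \<le> \<delta> * \<rho> ^ d" using \<delta>(1) by (intro mult_left_mono) auto
      then have w2: "norm (poly f ?c) \<ge> (\<delta> * \<rho>) * \<rho>" using w by (simp add: power2_eq_square mult.assoc)
      have "\<delta> * \<rho> > 2 * d" "\<delta> * \<rho> > 2 * exp (d * M)" using \<rho>(2,3) \<delta>(1) by (auto simp: pos_divide_less_eq mult.commute)
      moreover from this have "(\<delta> * \<rho>) * \<rho> \<ge> 2 * d * \<rho>" "(\<delta> * \<rho>) * \<rho> \<ge> (\<delta> * \<rho>) * 1"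
        using \<rho>(1) \<delta>(1) by (auto intro!: mult_right_mono mult_left_mono)
      ultimately have w3: "norm (poly f ?c) \<ge> 2 * d * \<rho>" "norm (poly f ?c) > 2 * exp (d * M)" using w2 by linarith+
      have "escape_rate f (poly f ?c) \<ge> ln (norm (poly f ?c)) - ln 2"
        by (rule escape_rate_scaled_ge[OF f d _ co]) (use \<rho>(1) w3(1) in auto)
      moreover have "ln (norm (poly f ?c)) > ln (2 * exp (d * M))"
        using w3(2) by (subst ln_less_cancel_iff) (auto intro: less_trans[rotated])
      moreover have "ln (2 * exp (d * M)) = ln 2 + d * M" by (simp add: ln_mult_pos)
      ultimately show False using le by linarith
    qed
    have "norm (coeff f i) \<le> \<rho> ^ (d - i)" by (rule co[OF i])
    also have "\<dots> \<le> P ^ (d - i)" using \<open>\<rho> \<le> P\<close> \<rho>0 by (intro power_mono)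
    also have "\<dots> \<le> P ^ d" using P1 by (intro power_increasing) auto
    finally show ?thesis .
  qed
  then show ?thesis using that[of "P ^ d"] by blast
qed

section \<open>The moduli space\<close>

definition unit_roots :: "nat \<Rightarrow> complex set" where
  "unit_roots d = {\<zeta>. \<zeta> ^ (d - 1) = 1}"

definition conj_poly :: "complex \<Rightarrow> complex poly \<Rightarrow> complex poly" where
  "conj_poly \<zeta> f = smult (inverse \<zeta>) (pcompose f [:0, \<zeta>:])"

abbreviation conj_class :: "nat \<Rightarrow> complex poly \<Rightarrow> complex poly set" where
  "conj_class d f \<equiv> conj_rel d `` {f}"

lemma unit_roots:
  assumes "\<zeta> \<in> unit_roots d" "d \<ge> 2"
  shows "norm \<zeta> = 1" "\<zeta> \<noteq> 0" "inverse \<zeta> \<in> unit_roots d" "\<zeta> ^ d = \<zeta>"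
proof -
  have z: "\<zeta> ^ (d - 1) = 1" using assms by (simp add: unit_roots_def)
  then have "norm \<zeta> ^ (d - 1) = 1 ^ (d - 1)" by (metis norm_one norm_power power_one)
  then show "norm \<zeta> = 1" using assms(2) by (subst (asm) power_eq_iff_eq_base) auto
  then show "\<zeta> \<noteq> 0" by auto
  show "inverse \<zeta> \<in> unit_roots d" using z by (simp add: unit_roots_def power_inverse)
  have "\<zeta> ^ d = \<zeta> * \<zeta> ^ (d - 1)" using assms(2) by (simp add: power_eq_if)
  then show "\<zeta> ^ d = \<zeta>" using z by simp
qed

lemma finite_unit_roots: "d \<ge> 2 \<Longrightarrow> finite (unit_roots d)"
  unfolding unit_roots_def by (rule finite_roots_unity) simp

lemma coeff_conj_poly: "coeff (conj_poly \<zeta> f) i = inverse \<zeta> * (\<zeta> ^ i * coeff f i)"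
  by (simp add: conj_poly_def coeff_pcompose_linear)

lemma poly_conj_poly: "poly (conj_poly \<zeta> f) z = inverse \<zeta> * poly f (\<zeta> * z)"
  by (simp add: conj_poly_def poly_pcompose mult.commute)

lemma conj_poly_conj_poly: "conj_poly \<zeta> (conj_poly \<eta> f) = conj_poly (\<zeta> * \<eta>) f"
  by (rule poly_eqI) (simp add: coeff_conj_poly power_mult_distrib mult_ac)

lemma conj_poly_1 [simp]: "conj_poly 1 f = f"
  by (rule poly_eqI) (simp add: coeff_conj_poly)

lemma conj_poly_inverse: "\<zeta> \<noteq> 0 \<Longrightarrow> conj_poly (inverse \<zeta>) (conj_poly \<zeta> f) = f"
  by (simp add: conj_poly_conj_poly)

lemma conj_poly_monic_centered:
  assumes f: "f \<in> monic_centered d" and d: "d \<ge> 2" and z: "\<zeta> \<in> unit_roots d"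
  shows "conj_poly \<zeta> f \<in> monic_centered d"
proof -
  note mf = monic_centered_poly[OF f d]
  note u = unit_roots[OF z d]
  have 1: "coeff (conj_poly \<zeta> f) d = 1" using u mf(3) by (simp add: coeff_conj_poly)
  have "degree (conj_poly \<zeta> f) = d"
  proof (rule antisym)
    show "degree (conj_poly \<zeta> f) \<le> d" by (rule degree_le) (auto simp: coeff_conj_poly mf(5))
    show "d \<le> degree (conj_poly \<zeta> f)" by (rule le_degree) (simp add: 1)
  qed
  then show ?thesis using 1 mf(4) by (simp add: monic_centered_def coeff_conj_poly)
qed

lemma conj_class_eq:
  assumes "f \<in> monic_centered d" "d \<ge> 2"
  shows "conj_class d f = (\<lambda>\<zeta>. conj_poly \<zeta> f) ` unit_roots d"
  using conj_poly_monic_centered[OF assms] assms(1)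
  by (auto simp: conj_rel_def conj_poly_def unit_roots_def)

lemma mem_conj_class:
  assumes "f \<in> monic_centered d" "d \<ge> 2"
  shows "f \<in> conj_class d f"
  unfolding conj_class_eq[OF assms] by (rule image_eqI[of _ _ 1]) (auto simp: unit_roots_def)

lemma conj_class_eq_iff:
  assumes f: "f \<in> monic_centered d" and g: "g \<in> monic_centered d" and d: "d \<ge> 2"
  shows "conj_class d f = conj_class d g \<longleftrightarrow> (\<exists>\<zeta>\<in>unit_roots d. g = conj_poly \<zeta> f)"
proof
  assume "conj_class d f = conj_class d g"
  then have "g \<in> conj_class d f" using mem_conj_class[OF g d] by simp
  then show "\<exists>\<zeta>\<in>unit_roots d. g = conj_poly \<zeta> f" unfolding conj_class_eq[OF f d] by blast
next
  have sub: "conj_class d (conj_poly \<zeta> h) \<subseteq> conj_class d h"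
    if h: "h \<in> monic_centered d" and z: "\<zeta> \<in> unit_roots d" for h \<zeta>
  proof
    fix k assume "k \<in> conj_class d (conj_poly \<zeta> h)"
    then obtain \<eta> where e: "\<eta> \<in> unit_roots d" "k = conj_poly \<eta> (conj_poly \<zeta> h)"
      unfolding conj_class_eq[OF conj_poly_monic_centered[OF h d z] d] by blast
    have "\<eta> * \<zeta> \<in> unit_roots d" using e z by (simp add: unit_roots_def power_mult_distrib)
    then show "k \<in> conj_class d h" unfolding conj_class_eq[OF h d] e(2) conj_poly_conj_poly by blast
  qed
  assume "\<exists>\<zeta>\<in>unit_roots d. g = conj_poly \<zeta> f"
  then obtain \<zeta> where z: "\<zeta> \<in> unit_roots d" "g = conj_poly \<zeta> f" by blast
  then have "f = conj_poly (inverse \<zeta>) g" using conj_poly_inverse unit_roots(2)[OF z(1) d] by simp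
  then show "conj_class d f = conj_class d g"
    using sub[OF f z(1)] sub[OF g unit_roots(3)[OF z(1) d]] z(2) by simp
qed

section \<open>Invariance of trees and critical heights under conjugation\<close>

lemma escape_rate_conj_poly:
  assumes f: "f \<in> monic_centered d" and d: "d \<ge> 2" and z: "\<zeta> \<in> unit_roots d"
  shows "escape_rate (conj_poly \<zeta> f) w = escape_rate f (\<zeta> * w)"
proof -
  note u = unit_roots[OF z d]
  have it: "(poly (conj_poly \<zeta> f) ^^ n) w = inverse \<zeta> * (poly f ^^ n) (\<zeta> * w)" for n
    by (induction n) (use u(2) in \<open>simp_all add: poly_conj_poly mult.assoc[symmetric]\<close>)
  have "degree (conj_poly \<zeta> f) = degree f"
    using monic_centered_poly(2)[OF f d] monic_centered_poly(2)[OF conj_poly_monic_centered[OF f d z] d] by simp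
  then show ?thesis
    unfolding escape_rate_def it using u by (simp add: norm_mult norm_inverse)
qed

lemma joined_conj_poly_imp:
  assumes f: "f \<in> monic_centered d" and d: "d \<ge> 2" and z: "\<zeta> \<in> unit_roots d"
    and j: "joined f t (\<zeta> * x) (\<zeta> * y)"
  shows "joined (conj_poly \<zeta> f) t x y"
proof -
  note u = unit_roots[OF z d]
  obtain T where T: "connected T" "T \<subseteq> {w. escape_rate f w \<le> t}" "\<zeta> * x \<in> T" "\<zeta> * y \<in> T"
    using j unfolding joined_def connected_component_def by blast
  show ?thesis
  proof (rule joinedI)
    show "connected ((\<lambda>w. inverse \<zeta> * w) ` T)" using T(1) by (intro connected_continuous_image continuous_intros)
    show "x \<in> (\<lambda>w. inverse \<zeta> * w) ` T"
      by (rule image_eqI[OF _ T(3)]) (use u(2) in \<open>simp add: mult.assoc[symmetric]\<close>)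
    show "y \<in> (\<lambda>w. inverse \<zeta> * w) ` T"
      by (rule image_eqI[OF _ T(4)]) (use u(2) in \<open>simp add: mult.assoc[symmetric]\<close>)
    fix w assume "w \<in> (\<lambda>w. inverse \<zeta> * w) ` T"
    then show "escape_rate (conj_poly \<zeta> f) w \<le> t"
      using T(2) u(2) by (auto simp: escape_rate_conj_poly[OF f d z] mult.assoc[symmetric])
  qed
qed

lemma joined_conj_poly:
  assumes f: "f \<in> monic_centered d" and d: "d \<ge> 2" and z: "\<zeta> \<in> unit_roots d"
  shows "joined (conj_poly \<zeta> f) t x y \<longleftrightarrow> joined f t (\<zeta> * x) (\<zeta> * y)"
proof
  note u = unit_roots[OF z d]
  assume "joined (conj_poly \<zeta> f) t x y"
  then have "joined (conj_poly \<zeta> f) t (inverse \<zeta> * (\<zeta> * x)) (inverse \<zeta> * (\<zeta> * y))"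
    using u(2) by (simp add: mult.assoc[symmetric])
  then have "joined (conj_poly (inverse \<zeta>) (conj_poly \<zeta> f)) t (\<zeta> * x) (\<zeta> * y)"
    by (rule joined_conj_poly_imp[OF conj_poly_monic_centered[OF f d z] d u(3)])
  then show "joined f t (\<zeta> * x) (\<zeta> * y)" using conj_poly_inverse[OF u(2)] by simp
qed (rule joined_conj_poly_imp[OF f d z])

text \<open>Multiplication by \<zeta> carries one filled Julia set exactly onto the other. Stated as
  a \<open>level_equiv\<close> this serves twice: for the trees of conjugate polynomials, and for
  changing representatives of a point of the moduli space.\<close>

lemma level_equiv_conj_poly:
  assumes f: "f \<in> monic_centered d" and d: "d \<ge> 2" and z: "\<zeta> \<in> unit_roots d" and s: "s \<ge> 0"
  shows "level_equiv s f (conj_poly \<zeta> f)"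
proof (rule level_equivI[of "\<lambda>x y. escape_rate f x = 0 \<and> x = \<zeta> * y"])
  note u = unit_roots[OF z d]
  note esc = escape_rate_conj_poly[OF f d z]
  interpret F: monic_poly f by (rule monic_centered_poly(1)[OF f d])
  show "\<exists>y. escape_rate f x = 0 \<and> x = \<zeta> * y" if "escape_rate f x = 0" for x
    using that u by (intro exI[of _ "inverse \<zeta> * x"]) simp
  show "\<exists>x. escape_rate f x = 0 \<and> x = \<zeta> * y" if "escape_rate (conj_poly \<zeta> f) y = 0" for y
    using that esc by simp
  show "joined f t x x' \<longleftrightarrow> joined (conj_poly \<zeta> f) t y y'"
    if "escape_rate f x = 0 \<and> x = \<zeta> * y" "escape_rate f x' = 0 \<and> x' = \<zeta> * y'" "s \<le> t" for x x' y y' t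
    using that joined_conj_poly[OF f d z] by simp
  show "joined (conj_poly \<zeta> f) (real (degree f) * s) (poly (conj_poly \<zeta> f) y) y'"
    if "escape_rate f x = 0 \<and> x = \<zeta> * y" "escape_rate f (poly f x) = 0 \<and> poly f x = \<zeta> * y'" for x y y'
  proof -
    have fx: "poly f (\<zeta> * y) = \<zeta> * y'" using that by simp
    have "poly (conj_poly \<zeta> f) y = y'" using u(2) by (simp add: poly_conj_poly fx mult.assoc[symmetric])
    moreover have "escape_rate f (\<zeta> * y') = 0" using that(2) by (metis (no_types))
    then have "escape_rate (conj_poly \<zeta> f) y' = 0" by (simp only: esc)
    ultimately show ?thesis using s by (simp add: joined_refl)
  qed
qed (use escape_rate_conj_poly[OF f d z] in auto)

lemma tree_equiv_conj_poly:
  assumes f: "f \<in> monic_centered d" and d: "d \<ge> 2" and z: "\<zeta> \<in> unit_roots d"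
  shows "tree_equiv (poly_tree f) (poly_tree (conj_poly \<zeta> f))"
  using monic_centered_poly(1,2)[OF f d] monic_centered_poly(1,2)[OF conj_poly_monic_centered[OF f d z] d]
    level_equiv_conj_poly[OF f d z]
  by (intro tree_equiv_of_level_equiv) auto

lemma height_mset_conj_poly:
  assumes f: "f \<in> monic_centered d" and d: "d \<ge> 2" and z: "\<zeta> \<in> unit_roots d"
  shows "height_mset (conj_poly \<zeta> f) = height_mset f"
proof -
  note u = unit_roots[OF z d]
  obtain c where c: "proots (pderiv f) = image_mset c (mset_set {..<d-1})"
    using critical_points_family[OF f d] by blast
  have pf: "pderiv f = smult (of_nat d) (\<Prod>i<d-1. [:- c i, 1:])" by (rule poly_pderiv_family[OF f d c])
  have "poly (pderiv (conj_poly \<zeta> f)) w = poly (smult (of_nat d) (\<Prod>i<d-1. [:- (inverse \<zeta> * c i), 1:])) w" for w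
  proof -
    have "poly (pderiv (conj_poly \<zeta> f)) w = poly (pderiv f) (\<zeta> * w)"
      using u by (simp add: conj_poly_def pderiv_smult pderiv_pcompose pderiv_pCons poly_pcompose mult.commute)
    also have "\<dots> = of_nat d * (\<Prod>i<d-1. \<zeta> * w - c i)" unfolding pf by (simp add: poly_prod)
    also have "(\<Prod>i<d-1. \<zeta> * w - c i) = (\<Prod>i<d-1. \<zeta> * (w - inverse \<zeta> * c i))"
      using u by (intro prod.cong) (auto simp: algebra_simps)
    \<comment> \<open>The d - 1 factors \<zeta> multiply to 1.\<close>
    also have "\<dots> = (\<Prod>i<d-1. w - inverse \<zeta> * c i)"
      using z by (simp add: prod.distrib unit_roots_def)
    finally show ?thesis by (simp add: poly_prod)
  qed
  then have "pderiv (conj_poly \<zeta> f) = smult (of_nat d) (\<Prod>i<d-1. [:- (inverse \<zeta> * c i), 1:])"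
    using poly_eq_poly_eq_iff by blast
  then have "proots (pderiv (conj_poly \<zeta> f)) = image_mset (\<lambda>i. inverse \<zeta> * c i) (mset_set {..<d-1})"
    using d proots_prod_linear[of "{..<d-1}" "\<lambda>i. inverse \<zeta> * c i"] by simp
  then show ?thesis
    using u by (simp add: height_mset_def c multiset.map_comp o_def escape_rate_conj_poly[OF f d z] mult.assoc[symmetric])
qed

lemma height_mset_conj_class:
  assumes f: "f \<in> monic_centered d" and d: "d \<ge> 2" and g: "g \<in> conj_class d f"
  shows "height_mset g = height_mset f"
  using g height_mset_conj_poly[OF f d] unfolding conj_class_eq[OF f d] by auto

lemma the_elem_constant:
  assumes "x \<in> A" "\<And>y. y \<in> A \<Longrightarrow> h y = h x"
  shows "the_elem (h ` A) = h x"
proof -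
  have "h ` A \<subseteq> {h x}" using assms(2) by blast
  then have "h ` A = {h x}" using assms(1) by blast
  then show ?thesis by simp
qed

lemma critical_heights_map_class:
  assumes f: "f \<in> monic_centered d" and d: "d \<ge> 2"
  shows "critical_heights_map (conj_class d f) = critical_heights f"
  unfolding critical_heights_map_def
  by (rule the_elem_constant[OF mem_conj_class[OF f d]])
     (simp only: critical_heights_eq_iff, rule height_mset_conj_class[OF f d])

definition height_poly_map :: "complex poly set \<Rightarrow> nat \<Rightarrow> real" where
  "height_poly_map u = the_elem (height_poly ` u)"

lemma height_poly_map_class:
  assumes f: "f \<in> monic_centered d" and d: "d \<ge> 2"
  shows "height_poly_map (conj_class d f) = height_poly f"
  unfolding height_poly_map_def
  by (rule the_elem_constant[OF mem_conj_class[OF f d]])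
     (simp only: height_poly_eq_iff, rule height_mset_conj_class[OF f d])

section \<open>Topology of the moduli space\<close>

lemma topspace_moduli_space: "topspace (moduli_space d) = conj_class d ` monic_centered d"
  by (simp add: moduli_space_def topspace_quotient_topology topspace_poly_space)

lemma quotient_map_conj_class: "quotient_map (poly_space d) (moduli_space d) (conj_class d)"
  unfolding moduli_space_def by (rule quotient_map_quotient_topology)

text \<open>The quotient is by a group acting by homeomorphisms, so the saturation of an open set is
  a union of open translates.\<close>

lemma openin_conj_class_image:
  assumes d: "d \<ge> 2" and U: "openin (poly_space d) U"
  shows "openin (moduli_space d) (conj_class d ` U)"
proof -
  have UM: "U \<subseteq> monic_centered d" using U openin_subset topspace_poly_space by blast
  let ?V = "{f \<in> monic_centered d. \<exists>\<zeta>\<in>unit_roots d. conj_poly \<zeta> f \<in> U}"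
  have "{f \<in> topspace (poly_space d). conj_class d f \<in> conj_class d ` U} = ?V"
  proof (intro equalityI subsetI)
    fix f assume "f \<in> {f \<in> topspace (poly_space d). conj_class d f \<in> conj_class d ` U}"
    then obtain g where "f \<in> monic_centered d" "g \<in> U" "conj_class d f = conj_class d g"
      by (auto simp: topspace_poly_space)
    then show "f \<in> ?V" using conj_class_eq_iff[OF _ _ d, of f g] UM by auto
  next
    fix f assume "f \<in> ?V"
    then obtain \<zeta> where z: "f \<in> monic_centered d" "\<zeta> \<in> unit_roots d" "conj_poly \<zeta> f \<in> U" by blast
    then have "conj_class d f = conj_class d (conj_poly \<zeta> f)"
      using conj_class_eq_iff[OF z(1) _ d, of "conj_poly \<zeta> f"] UM by blast
    then show "f \<in> {f \<in> topspace (poly_space d). conj_class d f \<in> conj_class d ` U}"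
      using z by (auto simp: topspace_poly_space)
  qed
  moreover have "openin (poly_space d) ?V"
  proof (rule openin_poly_space_seqI[OF d])
    fix f F assume f: "f \<in> ?V" and F: "\<And>n. F n \<in> monic_centered d" "\<And>i. (\<lambda>n. coeff (F n) i) \<longlonglongrightarrow> coeff f i"
    then obtain \<zeta> where z: "\<zeta> \<in> unit_roots d" "conj_poly \<zeta> f \<in> U" by blast
    have "eventually (\<lambda>n. conj_poly \<zeta> (F n) \<in> U) sequentially"
    proof (rule openin_poly_space_eventually[OF U z(2)])
      show "conj_poly \<zeta> (F n) \<in> monic_centered d" for n by (rule conj_poly_monic_centered[OF F(1) d z(1)])
      show "(\<lambda>n. coeff (conj_poly \<zeta> (F n)) i) \<longlonglongrightarrow> coeff (conj_poly \<zeta> f) i" for i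
        unfolding coeff_conj_poly by (intro tendsto_intros F(2))
    qed
    then obtain n where "conj_poly \<zeta> (F n) \<in> U" using eventually_happens'[OF sequentially_bot] by blast
    then show "\<exists>n. F n \<in> ?V" using F(1) z(1) by blast
  qed blast
  ultimately show ?thesis
    unfolding moduli_space_def openin_quotient_topology using UM by (auto simp: topspace_poly_space)
qed

definition coeff_ball :: "nat \<Rightarrow> complex poly \<Rightarrow> real \<Rightarrow> complex poly set" where
  "coeff_ball d f e = {g \<in> monic_centered d. \<forall>i<d-1. dist (coeff g i) (coeff f i) < e}"

lemma openin_coeff_ball:
  assumes d: "d \<ge> 2"
  shows "openin (poly_space d) (coeff_ball d f e)"
proof (rule openin_poly_space_seqI[OF d])
  fix g F assume g: "g \<in> coeff_ball d f e" and F: "\<And>n. F n \<in> monic_centered d" "\<And>i. (\<lambda>n. coeff (F n) i) \<longlonglongrightarrow> coeff g i"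
  have "eventually (\<lambda>n. \<forall>i\<in>{..<d-1}. dist (coeff (F n) i) (coeff f i) < e) sequentially"
  proof (intro eventually_ball_finite ballI)
    fix i assume "i \<in> {..<d-1}"
    then have "dist (coeff g i) (coeff f i) < e" using g by (simp add: coeff_ball_def)
    moreover have "(\<lambda>n. dist (coeff (F n) i) (coeff f i)) \<longlonglongrightarrow> dist (coeff g i) (coeff f i)"
      by (intro tendsto_intros F(2))
    ultimately show "eventually (\<lambda>n. dist (coeff (F n) i) (coeff f i) < e) sequentially"
      by (intro order_tendstoD(2))
  qed simp
  then have "\<exists>n. \<forall>i\<in>{..<d-1}. dist (coeff (F n) i) (coeff f i) < e"
    by (rule eventually_happens'[OF sequentially_bot])
  then obtain n where "\<forall>i\<in>{..<d-1}. dist (coeff (F n) i) (coeff f i) < e" by (rule exE)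
  then show "\<exists>n. F n \<in> coeff_ball d f e" using F(1) by (auto simp: coeff_ball_def)
qed (auto simp: coeff_ball_def)

text \<open>Conjugation by roots of unity preserves distances between corresponding coefficients,
  and there are finitely many conjugations, so distinct orbits are a positive distance
  apart.\<close>

lemma Hausdorff_moduli_space:
  assumes d: "d \<ge> 2"
  shows "Hausdorff_space (moduli_space d)"
  unfolding Hausdorff_space_def
proof (intro allI impI)
  fix u v assume uv: "u \<in> topspace (moduli_space d) \<and> v \<in> topspace (moduli_space d) \<and> u \<noteq> v"
  then obtain f g where fg: "f \<in> monic_centered d" "u = conj_class d f" "g \<in> monic_centered d" "v = conj_class d g"
    by (auto simp: topspace_moduli_space)
  have "\<exists>e>0. \<exists>i<d-1. dist (coeff (conj_poly \<zeta> f) i) (coeff g i) \<ge> e" if z: "\<zeta> \<in> unit_roots d" for \<zeta>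
  proof -
    have "conj_poly \<zeta> f \<noteq> g" using conj_class_eq_iff[OF fg(1,3) d] z uv fg(2,4) by blast
    then obtain i where "i < d - 1" "coeff (conj_poly \<zeta> f) i \<noteq> coeff g i"
      using monic_centered_eqI[OF conj_poly_monic_centered[OF fg(1) d z] fg(3) d] by blast
    then show ?thesis by (intro exI[of _ "dist (coeff (conj_poly \<zeta> f) i) (coeff g i)"]) auto
  qed
  then have "\<exists>e. \<forall>\<zeta>\<in>unit_roots d. e \<zeta> > 0 \<and> (\<exists>i<d-1. dist (coeff (conj_poly \<zeta> f) i) (coeff g i) \<ge> e \<zeta>)"
    by (intro bchoice) blast
  then obtain e where e: "\<And>\<zeta>. \<zeta> \<in> unit_roots d \<Longrightarrow> e \<zeta> > 0"
      "\<And>\<zeta>. \<zeta> \<in> unit_roots d \<Longrightarrow> \<exists>i<d-1. dist (coeff (conj_poly \<zeta> f) i) (coeff g i) \<ge> e \<zeta>"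
    by auto
  \<comment> \<open>Half the least separation, since the triangle inequality uses one \<epsilon> for
    each of the two balls.\<close>
  define \<epsilon> where "\<epsilon> = Min (insert 1 (e ` unit_roots d)) / 2"
  have fin: "finite (e ` unit_roots d)" using finite_unit_roots[OF d] by simp
  have \<epsilon>: "\<epsilon> > 0" "\<And>\<zeta>. \<zeta> \<in> unit_roots d \<Longrightarrow> 2 * \<epsilon> \<le> e \<zeta>"
    unfolding \<epsilon>_def using fin e(1) by auto
  have "disjnt (conj_class d ` coeff_ball d f \<epsilon>) (conj_class d ` coeff_ball d g \<epsilon>)"
  proof (rule ccontr)
    assume "\<not> ?thesis"
    then obtain a b where ab: "a \<in> coeff_ball d f \<epsilon>" "b \<in> coeff_ball d g \<epsilon>" "conj_class d a = conj_class d b"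
      by (auto simp: disjnt_iff)
    have M: "a \<in> monic_centered d" "b \<in> monic_centered d" using ab by (auto simp: coeff_ball_def)
    obtain \<zeta> where z: "\<zeta> \<in> unit_roots d" "b = conj_poly \<zeta> a" using conj_class_eq_iff[OF M d] ab(3) by blast
    obtain i where i: "i < d - 1" "dist (coeff (conj_poly \<zeta> f) i) (coeff g i) \<ge> e \<zeta>" using e(2)[OF z(1)] by blast
    have "dist (coeff b i) (coeff (conj_poly \<zeta> f) i) = dist (coeff a i) (coeff f i)"
    proof -
      have "coeff b i - coeff (conj_poly \<zeta> f) i = inverse \<zeta> * \<zeta> ^ i * (coeff a i - coeff f i)"
        by (simp add: z(2) coeff_conj_poly algebra_simps)
      then show ?thesis using unit_roots(1)[OF z(1) d] by (simp add: dist_norm norm_mult norm_inverse norm_power)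
    qed
    also have "\<dots> < \<epsilon>" using ab(1) i(1) by (simp add: coeff_ball_def)
    finally have "dist (coeff b i) (coeff (conj_poly \<zeta> f) i) < \<epsilon>" .
    moreover have "dist (coeff b i) (coeff g i) < \<epsilon>" using ab(2) i(1) by (simp add: coeff_ball_def)
    moreover have "dist (coeff (conj_poly \<zeta> f) i) (coeff g i) \<le>
        dist (coeff b i) (coeff (conj_poly \<zeta> f) i) + dist (coeff b i) (coeff g i)"
      by (rule dist_triangle3)
    ultimately show False using i(2) \<epsilon>(2)[OF z(1)] by linarith
  qed
  moreover have "u \<in> conj_class d ` coeff_ball d f \<epsilon>" "v \<in> conj_class d ` coeff_ball d g \<epsilon>"
    using fg \<epsilon>(1) by (auto simp: coeff_ball_def)
  ultimately show "\<exists>U V. openin (moduli_space d) U \<and> openin (moduli_space d) V \<and> u \<in> U \<and> v \<in> V \<and> disjnt U V"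
    using openin_conj_class_image[OF d openin_coeff_ball[OF d]] by blast
qed

text \<open>The set is the image of a product of closed discs under the continuous inverse \<phi> of
  the coordinate map.\<close>

lemma compactin_coeff_bounded:
  assumes d: "d \<ge> 2"
  shows "compactin (poly_space d) {f \<in> monic_centered d. \<forall>i<d-1. norm (coeff f i) \<le> B}"
proof -
  let ?P = "product_topology (\<lambda>_. euclidean :: complex topology) {..<d-1}"
  have "\<exists>f. f \<in> monic_centered d \<and> (\<forall>i<d-1. coeff f i = a i)" for a
    using monic_centered_exists[OF d, of a] by metis
  then obtain \<phi> where \<phi>: "\<And>a. \<phi> a \<in> monic_centered d" "\<And>a i. i < d - 1 \<Longrightarrow> coeff (\<phi> a) i = a i" by metis
  have r: "restrict (coeff (\<phi> a)) {..<d-1} = a" if "a \<in> extensional {..<d-1}" for a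
    by (rule extensionalityI[OF restrict_extensional that]) (use \<phi>(2) in auto)
  have cont: "continuous_map ?P (poly_space d) \<phi>"
    unfolding poly_space_def
  proof (rule continuous_map_pullback')
    show "continuous_map ?P ?P ((\<lambda>f. restrict (coeff f) {..<d-1}) \<circ> \<phi>)"
      by (rule continuous_map_eq[OF continuous_map_id]) (use r in \<open>auto simp: PiE_iff\<close>)
  qed (use \<phi>(1) in auto)
  have "compactin ?P (Pi\<^sub>E {..<d-1} (\<lambda>_. cball 0 B))"
    unfolding compactin_PiE by simp
  then have "compactin (poly_space d) (\<phi> ` Pi\<^sub>E {..<d-1} (\<lambda>_. cball 0 B))"
    using cont by (rule image_compactin)
  moreover have "\<phi> ` Pi\<^sub>E {..<d-1} (\<lambda>_. cball 0 B) = {f \<in> monic_centered d. \<forall>i<d-1. norm (coeff f i) \<le> B}"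
  proof (intro equalityI subsetI)
    fix f assume "f \<in> \<phi> ` Pi\<^sub>E {..<d-1} (\<lambda>_. cball 0 B)"
    then show "f \<in> {f \<in> monic_centered d. \<forall>i<d-1. norm (coeff f i) \<le> B}" using \<phi> by (auto simp: PiE_iff)
  next
    fix f assume f: "f \<in> {f \<in> monic_centered d. \<forall>i<d-1. norm (coeff f i) \<le> B}"
    have "f = \<phi> (restrict (coeff f) {..<d-1})"
      by (rule monic_centered_eqI[OF _ \<phi>(1) d]) (use f \<phi>(2) in auto)
    moreover have "restrict (coeff f) {..<d-1} \<in> Pi\<^sub>E {..<d-1} (\<lambda>_. cball 0 B)"
      using f by (auto simp: restrict_PiE_iff)
    ultimately show "f \<in> \<phi> ` Pi\<^sub>E {..<d-1} (\<lambda>_. cball 0 B)" by (rule image_eqI)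
  qed
  ultimately show ?thesis by simp
qed

lemma continuous_map_height_poly_map:
  assumes d: "d \<ge> 2"
  shows "continuous_map (moduli_space d) euclidean height_poly_map"
proof -
  have "continuous_map (poly_space d) (product_topology (\<lambda>_. euclidean) UNIV) height_poly"
    unfolding continuous_map_componentwise_UNIV
    by (intro allI continuous_map_poly_space_seqI[OF d] tendsto_height_poly[OF d])
  then have "continuous_map (poly_space d) euclidean height_poly" by (simp add: euclidean_product_topology)
  then have "continuous_map (poly_space d) euclidean (height_poly_map \<circ> conj_class d)"
    by (rule continuous_map_eq) (simp add: topspace_poly_space height_poly_map_class[OF _ d])
  then show ?thesis using quotient_map_conj_class continuous_compose_quotient_map by blast
qed

text \<open>All factors 1 + h are at least 1, so the product dominates each of them.\<close>

lemma height_le_height_poly: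
  assumes f: "f \<in> monic_centered d" and d: "d \<ge> 2" and c: "poly (pderiv f) c = 0"
  shows "escape_rate f c \<le> height_poly f 1"
proof -
  interpret F: monic_poly f by (rule monic_centered_poly(1)[OF f d])
  \<comment> \<open>The alternative h = 0 allows the induction hypothesis to be used for the lower
    bound 1 when no element is singled out.\<close>
  have *: "h \<le> (\<Prod>x\<in>#M. 1 + x) \<and> 1 \<le> (\<Prod>x\<in>#M. 1 + x)" if "\<And>x. x \<in># M \<Longrightarrow> 0 \<le> x" "h \<in># M \<or> h = 0" for M and h :: real
    using that
  proof (induction M arbitrary: h)
    case (add x M)
    have x: "0 \<le> x" using add.prems(1) by simp
    have M1: "1 \<le> (\<Prod>x\<in>#M. 1 + x)" using add.IH[of 0] add.prems(1) by simp
    have "1 \<le> (1 + x) * 1" using x by simp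
    also have "\<dots> \<le> (1 + x) * (\<Prod>x\<in>#M. 1 + x)" using M1 x by (intro mult_left_mono) auto
    finally have P1: "1 \<le> (1 + x) * (\<Prod>x\<in>#M. 1 + x)" .
    have Ph: "h \<le> (1 + x) * (\<Prod>x\<in>#M. 1 + x)"
    proof (cases "h = x")
      case False
      then have "h \<le> (\<Prod>x\<in>#M. 1 + x)" using add by auto
      also have "\<dots> \<le> (1 + x) * (\<Prod>x\<in>#M. 1 + x)" using x M1 by (simp add: mult_le_cancel_right1)
      finally show ?thesis .
    next
      case True
      have "x \<le> (1 + x) * 1" by simp
      also have "\<dots> \<le> (1 + x) * (\<Prod>x\<in>#M. 1 + x)" using M1 x by (intro mult_left_mono) auto
      finally show ?thesis using True by simp
    qed
    have "(\<Prod>x\<in>#add_mset x M. 1 + x) = (1 + x) * (\<Prod>x\<in>#M. 1 + x)" by simp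
    then show ?case using P1 Ph by (simp only: simp_thms)
  qed auto
  have "escape_rate f c \<in># height_mset f"
    using c set_height_mset[OF f d] by (auto simp: height_set_def)
  moreover have "0 \<le> x" if "x \<in># height_mset f" for x
    using that F.G_nonneg by (auto simp: height_mset_def)
  ultimately show ?thesis using *[of "height_mset f" "escape_rate f c"] by (simp add: height_poly_def)
qed

lemma closed_map_Tstar_proj:
  assumes d: "d \<ge> 2"
  shows "closed_map (moduli_space d) (Tstar_space d) (Tstar_proj d)"
  unfolding Tstar_space_def Tstar_proj_def
proof (rule closed_map_fibre_component[OF Hausdorff_moduli_space[OF d] _ continuous_map_height_poly_map[OF d]])
  show "Hausdorff_space (euclidean :: (nat \<Rightarrow> real) topology)" by (rule Hausdorff_space_euclidean)
  show "critical_heights_map x = critical_heights_map y \<longleftrightarrow> height_poly_map x = height_poly_map y"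
    if "x \<in> topspace (moduli_space d)" "y \<in> topspace (moduli_space d)" for x y
    using that by (auto simp: topspace_moduli_space critical_heights_map_class[OF _ d] height_poly_map_class[OF _ d]
        height_poly_eq_iff critical_heights_eq_iff)
  fix x assume "x \<in> topspace (moduli_space d)"
  define M where "M = height_poly_map x 1 + 1"
  obtain B where B: "\<And>f i. \<lbrakk>f \<in> monic_centered d; \<And>c. poly (pderiv f) c = 0 \<Longrightarrow> escape_rate f c \<le> M; i < d - 1\<rbrakk>
      \<Longrightarrow> norm (coeff f i) \<le> B"
    using bounded_critical_heights[OF d, of M] by blast
  \<comment> \<open>One coordinate suffices: the value at 1 bounds every critical height, and with
    them, by \<open>bounded_critical_heights\<close>, all coefficients.\<close>
  define N where "N = {\<phi> :: nat \<Rightarrow> real. \<phi> 1 < M}"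
  define K where "K = conj_class d ` {f \<in> monic_centered d. \<forall>i<d-1. norm (coeff f i) \<le> B}"
  have "open N"
    unfolding N_def by (intro open_Collect_less continuous_intros continuous_on_product_coordinates)
  moreover have "height_poly_map x \<in> N" by (simp add: N_def M_def)
  moreover have "compactin (moduli_space d) K"
    unfolding K_def using compactin_coeff_bounded[OF d] quotient_imp_continuous_map[OF quotient_map_conj_class]
    by (rule image_compactin)
  moreover have "{y \<in> topspace (moduli_space d). height_poly_map y \<in> N} \<subseteq> K"
  proof
    fix y assume y: "y \<in> {y \<in> topspace (moduli_space d). height_poly_map y \<in> N}"
    then obtain f where f: "f \<in> monic_centered d" "y = conj_class d f" by (auto simp: topspace_moduli_space)
    have "height_poly f 1 < M" using y f height_poly_map_class[OF f(1) d] by (simp add: N_def)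
    then have "escape_rate f c \<le> M" if "poly (pderiv f) c = 0" for c
      using height_le_height_poly[OF f(1) d that] by simp
    then have "norm (coeff f i) \<le> B" if "i < d - 1" for i using B[OF f(1) _ that] by blast
    then show "y \<in> K" unfolding K_def using f by blast
  qed
  ultimately show "\<exists>N K. openin euclidean N \<and> height_poly_map x \<in> N \<and> compactin (moduli_space d) K \<and>
      {y \<in> topspace (moduli_space d). height_poly_map y \<in> N} \<subseteq> K"
    unfolding open_openin[symmetric] by blast
qed

text \<open>Conjugate polynomials have equivalent trees, so the union defining
  \<open>tree_proj\<close> is the equivalence class of any one of these trees.\<close>

lemma tree_proj_eq_iff:
  assumes f: "f \<in> monic_centered d" and g: "g \<in> monic_centered d" and d: "d \<ge> 2"
  shows "tree_proj d (conj_class d f) = tree_proj d (conj_class d g) \<longleftrightarrow> tree_equiv (poly_tree f) (poly_tree g)"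
proof -
  have eq: "tree_proj d (conj_class d h) = {poly_tree k |k. k \<in> monic_centered d \<and> tree_equiv (poly_tree h) (poly_tree k)}"
    if h: "h \<in> monic_centered d" for h
  proof (intro equalityI subsetI)
    fix T assume "T \<in> tree_proj d (conj_class d h)"
    then obtain h' k where *: "h' \<in> conj_class d h" "k \<in> monic_centered d" "T = poly_tree k" "tree_equiv (poly_tree h') (poly_tree k)"
      by (auto simp: tree_proj_def tree_rel_def)
    obtain \<zeta> where "\<zeta> \<in> unit_roots d" "h' = conj_poly \<zeta> h" using *(1) conj_class_eq[OF h d] by auto
    then have "tree_equiv (poly_tree h) (poly_tree h')" using tree_equiv_conj_poly[OF h d] by blast
    then have "tree_equiv (poly_tree h) (poly_tree k)" using *(4) by (rule tree_equiv_trans)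
    then show "T \<in> {poly_tree k |k. k \<in> monic_centered d \<and> tree_equiv (poly_tree h) (poly_tree k)}" using * by blast
  next
    fix T assume "T \<in> {poly_tree k |k. k \<in> monic_centered d \<and> tree_equiv (poly_tree h) (poly_tree k)}"
    then obtain k where k: "k \<in> monic_centered d" "T = poly_tree k" "tree_equiv (poly_tree h) (poly_tree k)" by blast
    then have "(poly_tree h, T) \<in> tree_rel d" using h by (auto simp: tree_rel_def)
    then show "T \<in> tree_proj d (conj_class d h)" unfolding tree_proj_def using mem_conj_class[OF h d] by blast
  qed
  show ?thesis
  proof
    assume "tree_proj d (conj_class d f) = tree_proj d (conj_class d g)"
    moreover have "poly_tree g \<in> tree_proj d (conj_class d g)" using eq[OF g] g tree_equiv_refl by blast
    ultimately have "poly_tree g \<in> {poly_tree k |k. k \<in> monic_centered d \<and> tree_equiv (poly_tree f) (poly_tree k)}"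
      using eq[OF f] by simp
    then show "tree_equiv (poly_tree f) (poly_tree g)" by auto
  next
    assume fg: "tree_equiv (poly_tree f) (poly_tree g)"
    then have gf: "tree_equiv (poly_tree g) (poly_tree f)"
      by (rule poly_tree_equiv_sym[OF monic_centered_poly(1)[OF f d]])
    have "tree_equiv (poly_tree f) T \<longleftrightarrow> tree_equiv (poly_tree g) T" for T :: "complex set dyn_tree"
      using tree_equiv_trans[OF fg, of T] tree_equiv_trans[OF gf, of T] by blast
    then show "tree_proj d (conj_class d f) = tree_proj d (conj_class d g)" using eq[OF f] eq[OF g] by simp
  qed
qed

text \<open>All polynomials in \<open>S\<close> have their branching heights among those of one of
  them, so for each n the values of \<open>height_poly_map\<close> at n lie in a countable set of
  finite products. A connected set of reals with two points is uncountable.\<close>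

lemma critical_heights_constant:
  assumes d: "d \<ge> 2" and S: "connectedin (moduli_space d) S"
    and const: "\<And>u v. \<lbrakk>u \<in> S; v \<in> S\<rbrakk> \<Longrightarrow> tree_proj d u = tree_proj d v" and xy: "x \<in> S" "y \<in> S"
  shows "critical_heights_map x = critical_heights_map y"
proof -
  have rep: "\<exists>f. f \<in> monic_centered d \<and> u = conj_class d f" if "u \<in> S" for u
    using connectedin_subset_topspace[OF S] that by (auto simp: topspace_moduli_space)
  obtain f0 where f0: "f0 \<in> monic_centered d" "x = conj_class d f0" using rep[OF xy(1)] by blast
  define A where "A = insert 0 (branch_heights f0)"
  have cA: "countable A"
    unfolding A_def using monic_poly.countable_branch_heights[OF monic_centered_poly(1)[OF f0(1) d]] by simp
  have mem: "height_poly_map u n \<in> (\<lambda>hs. prod_list (map (\<lambda>h. real n + h) hs)) ` lists A" if u: "u \<in> S" for u n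
  proof -
    obtain f where f: "f \<in> monic_centered d" "u = conj_class d f" using rep[OF u] by blast
    have "tree_equiv (poly_tree f0) (poly_tree f)"
      using const[OF xy(1) u] tree_proj_eq_iff[OF f0(1) f(1) d] f0(2) f(2) by simp
    then have "tree_equiv (poly_tree f) (poly_tree f0)"
      by (rule poly_tree_equiv_sym[OF monic_centered_poly(1)[OF f0(1) d]])
    then have sub: "branch_heights f \<subseteq> branch_heights f0"
      by (rule branch_heights_subset[OF monic_centered_poly(1)[OF f(1) d] monic_centered_poly(1)[OF f0(1) d]])
    obtain hs where hs: "mset hs = height_mset f" using ex_mset by blast
    have "set hs \<subseteq> A"
    proof
      fix h assume "h \<in> set hs"
      then have "h \<in># height_mset f" using hs by (metis set_mset_mset)
      then obtain c where "h = escape_rate f c" "poly (pderiv f) c = 0"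
        using set_height_mset[OF f(1) d] by (auto simp: height_set_def)
      then have "h \<in> insert 0 (branch_heights f)"
        using monic_poly.critical_height_branch[OF monic_centered_poly(1)[OF f(1) d]] by blast
      then show "h \<in> A" using sub by (auto simp: A_def)
    qed
    then have "hs \<in> lists A" by auto
    moreover have "height_poly_map u n = prod_list (map (\<lambda>h. real n + h) hs)"
      using height_poly_map_class[OF f(1) d] f(2) by (simp add: height_poly_def hs[symmetric] prod_mset_prod_list flip: mset_map)
    ultimately show ?thesis by blast
  qed
  have "height_poly_map x n = height_poly_map y n" for n
  proof (rule ccontr)
    assume ne: "height_poly_map x n \<noteq> height_poly_map y n"
    have "continuous_map euclidean euclidean (\<lambda>\<phi> :: nat \<Rightarrow> real. \<phi> n)"
      using continuous_on_product_coordinates[of n] by (simp only: continuous_map_iff_continuous2)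
    then have "continuous_map (moduli_space d) euclidean ((\<lambda>\<phi>. \<phi> n) \<circ> height_poly_map)"
      using continuous_map_height_poly_map[OF d] by (intro continuous_map_compose)
    then have "connectedin euclidean (((\<lambda>\<phi>. \<phi> n) \<circ> height_poly_map) ` S)"
      using S by (rule connectedin_continuous_map_image)
    then have "connected ((\<lambda>u. height_poly_map u n) ` S)" by (simp add: o_def)
    then have "uncountable ((\<lambda>u. height_poly_map u n) ` S)"
      by (rule connected_uncountable[of _ "height_poly_map x n" "height_poly_map y n"]) (use xy ne in auto)
    moreover have "(\<lambda>u. height_poly_map u n) ` S \<subseteq> (\<lambda>hs. prod_list (map (\<lambda>h. real n + h) hs)) ` lists A"
      using mem by blast
    ultimately show False using cA by (meson countable_image countable_lists countable_subset)
  qed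
  then have "height_poly_map x = height_poly_map y" by (rule ext)
  moreover obtain g0 where g0: "g0 \<in> monic_centered d" "y = conj_class d g0" using rep[OF xy(2)] by blast
  ultimately show ?thesis
    using f0 g0 by (simp add: height_poly_map_class[OF _ d] critical_heights_map_class[OF _ d] height_poly_eq_iff critical_heights_eq_iff)
qed

text \<open>The class of x in S and its complement in S are both relatively open. They are realised
  by open sets of X, namely the unions of all open sets whose points in S are of one kind.\<close>

lemma connectedin_locally_related:
  assumes S: "connectedin X S" and sym: "\<And>u v. \<lbrakk>u \<in> S; v \<in> S; R u v\<rbrakk> \<Longrightarrow> R v u"
    and trans: "\<And>u v w. \<lbrakk>u \<in> S; v \<in> S; w \<in> S; R u v; R v w\<rbrakk> \<Longrightarrow> R u w"
    and local: "\<And>u. u \<in> S \<Longrightarrow> \<exists>U. openin X U \<and> u \<in> U \<and> (\<forall>v\<in>U \<inter> S. R u v)"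
    and xy: "x \<in> S" "y \<in> S"
  shows "R x y"
proof (rule ccontr)
  assume no: "\<not> R x y"
  define A where "A = \<Union>{U. openin X U \<and> (\<forall>v\<in>U \<inter> S. R x v)}"
  define B where "B = \<Union>{U. openin X U \<and> (\<forall>v\<in>U \<inter> S. \<not> R x v)}"
  have "openin X A" "openin X B" unfolding A_def B_def by (rule openin_Union, blast)+
  moreover have "u \<in> A \<or> u \<in> B" if u: "u \<in> S" for u
  proof -
    obtain U where U: "openin X U" "u \<in> U" "\<And>v. v \<in> U \<Longrightarrow> v \<in> S \<Longrightarrow> R u v" using local[OF u] by blast
    show ?thesis
    proof (cases "R x u")
      case True
      then have "\<forall>v\<in>U \<inter> S. R x v" using U(3) trans[OF xy(1) u] by blast
      then show ?thesis unfolding A_def using U by blast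
    next
      case False
      then have "\<forall>v\<in>U \<inter> S. \<not> R x v" using U(3) trans[OF xy(1) _ u] sym[OF u] by blast
      then show ?thesis unfolding B_def using U by blast
    qed
  qed
  moreover have "A \<inter> B \<inter> S = {}" unfolding A_def B_def by blast
  moreover have "x \<in> A"
  proof -
    obtain U where "openin X U" "x \<in> U" "\<forall>v\<in>U \<inter> S. R x v" using local[OF xy(1)] by blast
    then show ?thesis unfolding A_def by blast
  qed
  moreover have "y \<in> B" using calculation(3)[OF xy(2)] no xy(2) unfolding A_def by blast
  ultimately show False using S xy unfolding connectedin by blast
qed

text \<open>At each level s > 0, \<open>level_equiv\<close> is locally constant among polynomials
  with the same critical heights, so a connected set lies in one class. Then
  \<open>tree_equiv_of_level_equiv\<close> combines all levels.\<close>

lemma tree_proj_constant: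
  assumes d: "d \<ge> 2" and S: "connectedin (moduli_space d) S"
    and const: "\<And>u v. \<lbrakk>u \<in> S; v \<in> S\<rbrakk> \<Longrightarrow> critical_heights_map u = critical_heights_map v" and xy: "x \<in> S" "y \<in> S"
  shows "tree_proj d x = tree_proj d y"
proof -
  have rep: "\<exists>f. f \<in> monic_centered d \<and> u = conj_class d f" if "u \<in> S" for u
    using connectedin_subset_topspace[OF S] that by (auto simp: topspace_moduli_space)
  obtain f0 where f0: "f0 \<in> monic_centered d" "x = conj_class d f0" using rep[OF xy(1)] by blast
  obtain g0 where g0: "g0 \<in> monic_centered d" "y = conj_class d g0" using rep[OF xy(2)] by blast
  note mp = monic_centered_poly(1)[OF _ d]
  note dg = monic_centered_poly(2)[OF _ d]
  have lsym: "level_equiv s g f" if "level_equiv s f g" "f \<in> monic_centered d" "g \<in> monic_centered d" "s > 0" for f g s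
    using level_equiv_sym[OF mp[OF that(2)] _ _ that(1)] dg[OF that(2)] dg[OF that(3)] that(4) by simp
  have ltrans: "level_equiv s f h"
    if "level_equiv s f g" "level_equiv s g h" "f \<in> monic_centered d" "g \<in> monic_centered d" "h \<in> monic_centered d" "s > 0" for f g h s
    using level_equiv_trans[OF mp[OF that(3)] mp[OF that(4)] mp[OF that(5)] _ _ _ that(1,2)]
      dg[OF that(3)] dg[OF that(4)] dg[OF that(5)] that(6) by simp
  have "level_equiv s f0 g0" if s: "s > 0" for s
  proof -
    \<comment> \<open>On conjugacy classes the relation asks for some pair of representatives;
      \<open>RD\<close> shows that it then holds for every pair.\<close>
    define R where "R u v \<longleftrightarrow> (\<exists>f\<in>monic_centered d. \<exists>g\<in>monic_centered d. u = conj_class d f \<and> v = conj_class d g \<and> level_equiv s f g)" for u v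
    have conj: "level_equiv s f g" if "f \<in> monic_centered d" "g \<in> monic_centered d" "conj_class d f = conj_class d g" for f g
      using conj_class_eq_iff[OF that(1,2) d] that(3) level_equiv_conj_poly[OF that(1) d] s by auto
    have RD: "level_equiv s f g"
      if R: "R (conj_class d f) (conj_class d g)" and fg: "f \<in> monic_centered d" "g \<in> monic_centered d" for f g
    proof -
      obtain f' g' where *: "f' \<in> monic_centered d" "g' \<in> monic_centered d" "conj_class d f = conj_class d f'"
          "conj_class d g = conj_class d g'" "level_equiv s f' g'"
        using R unfolding R_def by blast
      have "level_equiv s f g'" by (rule ltrans[OF conj[OF fg(1) *(1,3)] *(5) fg(1) *(1,2) s])
      then show ?thesis by (rule ltrans[OF _ conj[OF *(2) fg(2) *(4)[symmetric]] fg(1) *(2) fg(2) s])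
    qed
    have "R x y"
    proof (rule connectedin_locally_related[OF S])
      show "R v u" if "u \<in> S" "v \<in> S" "R u v" for u v
        using that(3) lsym s unfolding R_def by blast
      show "R u w" if uvw: "u \<in> S" "v \<in> S" "w \<in> S" and R: "R u v" "R v w" for u v w
      proof -
        obtain f where f: "f \<in> monic_centered d" "u = conj_class d f" using rep[OF uvw(1)] by blast
        obtain g where g: "g \<in> monic_centered d" "v = conj_class d g" using rep[OF uvw(2)] by blast
        obtain h where h: "h \<in> monic_centered d" "w = conj_class d h" using rep[OF uvw(3)] by blast
        have "level_equiv s f g" using RD[OF _ f(1) g(1)] R(1) f(2) g(2) by simp
        moreover have "level_equiv s g h" using RD[OF _ g(1) h(1)] R(2) g(2) h(2) by simp
        ultimately have "level_equiv s f h" using ltrans f(1) g(1) h(1) s by blast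
        then show ?thesis unfolding R_def using f h by blast
      qed
      show "\<exists>U. openin (moduli_space d) U \<and> u \<in> U \<and> (\<forall>v\<in>U \<inter> S. R u v)" if u: "u \<in> S" for u
      proof -
        obtain f where f: "f \<in> monic_centered d" "u = conj_class d f" using rep[OF u] by blast
        \<comment> \<open>Equality of critical heights is kept as a premise inside the neighbourhood
          statement, because nearby polynomials need not represent points of \<open>S\<close>; a
          sequence that violates it somewhere satisfies the implication there.\<close>
        have "\<exists>e>0. \<forall>g\<in>monic_centered d. (\<forall>i<d-1. dist (coeff g i) (coeff f i) < e) \<longrightarrow>
            (height_mset g = height_mset f \<longrightarrow> level_equiv s f g)"
        proof (rule coeff_nbhd_seqI[OF d f(1)])
          fix F assume F: "\<And>n. F n \<in> monic_centered d" "\<And>i. (\<lambda>n. coeff (F n) i) \<longlonglongrightarrow> coeff f i"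
          show "\<exists>n. height_mset (F n) = height_mset f \<longrightarrow> level_equiv s f (F n)"
          proof (cases "\<forall>n. height_mset (F n) = height_mset f")
            case True
            then have "height_set (F n) = height_set f" for n
              using set_height_mset[OF F(1) d] set_height_mset[OF f(1) d] by metis
            then have "eventually (\<lambda>n. level_equiv s f (F n)) sequentially"
              by (intro level_equiv_eventually[OF d F f(1) _ s])
            then have "\<exists>n. level_equiv s f (F n)" by (rule eventually_happens'[OF sequentially_bot])
            then show ?thesis by blast
          qed blast
        qed
        then obtain e where e: "e > 0" "\<And>g. \<lbrakk>g \<in> monic_centered d; \<forall>i<d-1. dist (coeff g i) (coeff f i) < e;
            height_mset g = height_mset f\<rbrakk> \<Longrightarrow> level_equiv s f g"
          by blast
        have "R u v" if v: "v \<in> conj_class d ` coeff_ball d f e" "v \<in> S" for v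
        proof -
          obtain g where g: "g \<in> coeff_ball d f e" "v = conj_class d g" using v(1) by blast
          then have gM: "g \<in> monic_centered d" by (simp add: coeff_ball_def)
          have "critical_heights g = critical_heights f"
            using const[OF u v(2)] f g(2) gM by (simp add: critical_heights_map_class[OF _ d])
          then have "level_equiv s f g" using e(2)[OF gM] g(1) by (simp add: critical_heights_eq_iff coeff_ball_def)
          then show ?thesis unfolding R_def using f gM g(2) by blast
        qed
        moreover have "u \<in> conj_class d ` coeff_ball d f e" using f e(1) by (auto simp: coeff_ball_def)
        ultimately show ?thesis
          using openin_conj_class_image[OF d openin_coeff_ball[OF d, of f e]] by blast
      qed
    qed (rule xy)+
    then show ?thesis using RD f0 g0 by simp
  qed
  then have "tree_equiv (poly_tree f0) (poly_tree g0)"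
    using dg[OF f0(1)] dg[OF g0(1)] by (intro tree_equiv_of_level_equiv mp[OF f0(1)] mp[OF g0(1)]) auto
  then show ?thesis using tree_proj_eq_iff[OF f0(1) g0(1) d] f0(2) g0(2) by simp
qed

theorem corollary1p4:
  fixes d :: nat
  assumes "d \<ge> 2"
  shows "\<exists>l. monotone_light_factorization (moduli_space d) (tree_space d) (tree_proj d)
               (Tstar_space d) (Tstar_proj d) l \<and>
             (\<forall>(Z :: 'z topology) m' l'.
                monotone_light_factorization (moduli_space d) (tree_space d) (tree_proj d) Z m' l' \<longrightarrow>
                (\<exists>h. homeomorphic_map (Tstar_space d) Z h \<and>
                     (\<forall>x \<in> topspace (moduli_space d). h (Tstar_proj d x) = m' x) \<and>
                     (\<forall>t \<in> topspace (Tstar_space d). l' (h t) = l t)))"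
  unfolding Tstar_space_def Tstar_proj_def tree_space_def
  by (rule collapse_fibre_components_monotone_light[OF tree_proj_constant[OF assms]
        critical_heights_constant[OF assms] closed_map_Tstar_proj[OF assms, unfolded Tstar_space_def Tstar_proj_def]])

end
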